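(* Let $r_1,r_2,r_3,p_1,p_2,p_3\in\mathbb R$ satisfy $r_1<2$, $0<r_2<2$, $r_3>0$, $r_1+r_2+r_3=4$, $p_j\equiv r_j\bmod2$, $p_1+p_2+p_3=0$. Consider modular forms $f_1\in A_{r_1}(\Gamma,v[p_1])$, $f_2\in S_{r_2}(\Gamma,v[p_2])$, $f_3\in M_{r_3}(\Gamma,v[p_3])$ given by their Fourier expansions $$f_j(z)=\sum_{m\ge0}a_j(m)\,e^{2\pi i(m+p_j/12)z}.$$ Then $$\mathbf T(f_1,f_2,f_3)=\frac{(-2i)^{r_3}}{\mathsf B(2-r_1,2-r_2)}\sum_{m_1,m_2,m_3\ge0}a_1(m_1)a_2(m_2)a_3(m_3)\,\Psi_{r_1,r_2}\Bigl(\tfrac{12m_1+p_1}{12},\tfrac{12m_2+p_2}{12},\tfrac{12m_3+p_3}{12}\Bigr),$$ where $$\Psi_{r_1,r_2}(\mu_1,\mu_2,\mu_3)=\frac{e^{-2\pi\mu_2-\pi\sqrt3(\mu_1+\mu_3)}}{2\pi i}\int_{u=0}^1u^{1-r_2}(1-u)^{1-r_1}\,\frac{e^{-\pi(2-\sqrt3)\mu_3u}}{\mu_2+\mu_3u}\,S\bigl(\pi(\mu_1+(1-u)\mu_3)\bigr)\,du$$ $$=\frac{e^{-2\pi\mu_2-\pi\sqrt3(\mu_1+\mu_3)}}{2\pi i}\,\mu_3^{1-r_3}\int_{u=0}^{\mu_3}u^{1-r_2}(\mu_3-u)^{1-r_1}\,\frac{e^{-\pi(2-\sqrt3)u}}{\mu_2+u}\,S\bigl(\pi(\mu_1+\mu_3-u)\bigr)\,du,$$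 with $S(x)=\frac{\sin x}{x}$, continued smoothly at $x=0$.
   Context: Notation. $\mathfrak H$ and $\mathfrak H^-$ are the upper and lower half-planes, $\mathbb P^1_{\mathbb R}=\mathbb R\cup\{\infty\}\subset\mathbb P^1_{\mathbb C}$, $\Gamma=\mathrm{SL}_2(\mathbb Z)$, $\rho=e^{\pi i/3}$, $\mathsf B(a,b)=\Gamma(a)\Gamma(b)/\Gamma(a+b)$ is the beta function (here $\Gamma(\cdot)$ is the gamma function). Powers of numbers in $\mathfrak H$ or $\mathfrak H^-$ use the principal argument; $(-2i)^{r_3}=2^{r_3}e^{-\pi ir_3/2}$. The function $\Psi_{r_1,r_2}$ is used for $\mu_1\in\mathbb R$, $\mu_2>0$, $\mu_3\ge0$ (the second integral form for $\mu_3>0$); terms of the triple sum in which a Fourier coefficient vanishes are absent. For $p\in\mathbb R$, $v[p](\gamma)=\eta^{2p}(\gamma z)/\bigl((cz+d)^p\eta^{2p}(z)\bigr)$ for $\gamma=\begin{pmatrix}a&b\\c&d\end{pmatrix}\in\Gamma$, $\arg(cz+d)\in(-\pi,\pi]$, $\eta$ the Dedekind eta function; it is a multiplier system for all weights $r\equiv p\bmod2$. $A_r(\Gamma,v)$: all holomorphic $f:\mathfrak H\to\mathbb C$ with $f(\gamma z)=v(\gamma)(cz+d)^rf(z)$ for all $\gamma\in\Gamma$. $M_r(\Gamma,v)$: those with $f(z)=O(1)$ as $\mathrm{Im}\,z\to\infty$. $S_r(\Gamma,v)$: those with $f(z)=O((\mathrm{Im}\,z)^{-a})$ for all $a>0$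 as $\mathrm{Im}\,z\to\infty$. Function spaces for weight $r$. $f^-(t)=(i-t)^rf(t)$ for $f$ on $\mathfrak H^-$; $h^+(z)=(-i-z)^rh(z)$ for $h$ on $\mathfrak H$. ${}^-\mathcal D^\omega_r$: holomorphic $f$ on $\mathfrak H^-$ such that $f^-$ extends holomorphically to a neighborhood of $\mathfrak H^-\cup\mathbb P^1_{\mathbb R}$ in $\mathbb P^1_{\mathbb C}$. ${}^-\mathcal D^\infty_r$: holomorphic $f$ on $\mathfrak H^-$ such that $f^-$ extends to a $C^\infty$ function on $\mathfrak H^-\cup\mathbb P^1_{\mathbb R}$, with topology given by the supremum norms on $\mathbb P^1_{\mathbb R}$ of all derivatives of $f^-$ with respect to $\theta\in\mathbb R/\pi\mathbb Z$, $t=-\cot\theta$. ${}^+\mathcal D^{-\infty}_r$: holomorphic $h$ on $\mathfrak H$ with $h^+(z)=O(|\mathrm{Im}\,z|^{-B})+O(|z|^B)$ for some $B>0$; it contains $M_r(\Gamma,v)$. Bilinear form. Let $r\in\mathbb R\setminus\mathbb Z_{\le0}$, $w=\frac{z-i}{z+i}$, $(r)_n$ the Pochhammer symbol. For $f\in{}^-\mathcal D^\omega_r$ with $f^-=\sum_{m\le0}d_mw^m$ put $\sigma_rf^-=\sum_{m\le0}\frac{|m|!}{(r)_{|m|}}d_mw^{m-1}$ and, for $h$ holomorphic on $\mathfrak H$, $[h,f]_r=\frac1\pi\int_Ch^+(z)\sigma_rf^-(z)\frac{dz}{(z+i)^2}$, $C$ a positively oriented circle $|w|=c<1$ in the domain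 of $\sigma_rf^-$. For $h\in{}^+\mathcal D^{-\infty}_r$ the form $f\mapsto[h,f]_r$ extends continuously to ${}^-\mathcal D^\infty_r$ and $[h,f]_r$ denotes this extension (if $h^+=\sum_{n\ge0}c_nw^n$, $f^-=\sum_{m\le0}d_mw^m$, then $[h,f]_r=\sum_{n\ge0}\frac{n!}{(r)_n}c_nd_{-n}$). Trilinear form. $c_f(z_1,z_2;t)=\int_{z_1}^{z_2}f(\tau)(\tau-t)^{r-2}d\tau$ for $f$ of weight $r$, $t\in\mathfrak H^-$; $\mathbf T(f_1,f_2,f_3)=\bigl[f_3,\;c_{f_1}(\rho-1,\rho)\cdot c_{f_2}(i,\infty)\bigr]_{r_3}$.
   Formalization: The printed formula for T is off by a factor −1, since the integral of e^{2πikτ} from i to i∞ equals −e^{−2πk}/(2πik); the formal statement keeps Ψ and T as defined and puts a minus sign in front of the right-hand side. *)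

theory Defs
  imports
    "HOL-Complex_Analysis.Complex_Analysis"
    "HOL-Library.Landau_Symbols"
    "HOL-Library.Real_Mod"
begin

text \<open>
  Throughout, \<^term>\<open>z powr s\<close> on complex numbers is the principal power
  \<^term>\<open>exp (s * Ln z)\<close> with \<^term>\<open>Im (Ln z)\<close> in $(-\pi,\pi]$.
\<close>

definition upper_hp :: "complex set" where
  "upper_hp = {z. Im z > 0}"

definition lower_hp :: "complex set" where
  "lower_hp = {z. Im z < 0}"


section \<open>Modular forms of real weight\<close>

definition moeb :: "int \<Rightarrow> int \<Rightarrow> int \<Rightarrow> int \<Rightarrow> complex \<Rightarrow> complex" where
  "moeb a b c d z = (of_int a * z + of_int b) / (of_int c * z + of_int d)"

text \<open>
  The power $\eta^s = \exp(s \log\eta)$ of the Dedekind eta function, for the holomorphic branch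
  $\log\eta(z) = \pi i z/12 + \sum_{n\ge1} \log(1-e^{2\pi i n z})$ on the upper half-plane.
\<close>
definition eta_power :: "real \<Rightarrow> complex \<Rightarrow> complex" where
  "eta_power s z = exp (of_real pi * \<i> * of_real s * z / 12) *
     (\<Prod>n. (1 - exp (2 * of_real pi * \<i> * of_nat (Suc n) * z)) powr of_real s)"

text \<open>The defining quotient of $v[p]$ does not depend on \<open>z\<close>.\<close>
definition eta_mult :: "real \<Rightarrow> int \<Rightarrow> int \<Rightarrow> int \<Rightarrow> int \<Rightarrow> complex" where
  "eta_mult p a b c d = (THE v. \<forall>z\<in>upper_hp.
     v = eta_power (2 * p) (moeb a b c d z) /
         ((of_int c * z + of_int d) powr of_real p * eta_power (2 * p) z))"

definition automorphic_forms ::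
  "real \<Rightarrow> (int \<Rightarrow> int \<Rightarrow> int \<Rightarrow> int \<Rightarrow> complex) \<Rightarrow> (complex \<Rightarrow> complex) set" where
  "automorphic_forms r v = {f. f holomorphic_on upper_hp \<and>
     (\<forall>a b c d. a * d - b * c = 1 \<longrightarrow> (\<forall>z\<in>upper_hp.
        f (moeb a b c d z) = v a b c d * (of_int c * z + of_int d) powr of_real r * f z))}"

definition modular_forms ::
  "real \<Rightarrow> (int \<Rightarrow> int \<Rightarrow> int \<Rightarrow> int \<Rightarrow> complex) \<Rightarrow> (complex \<Rightarrow> complex) set" where
  "modular_forms r v = {f \<in> automorphic_forms r v.
     f \<in> O[filtercomap Im at_top](\<lambda>_. 1)}"

definition cusp_forms ::
  "real \<Rightarrow> (int \<Rightarrow> int \<Rightarrow> int \<Rightarrow> int \<Rightarrow> complex) \<Rightarrow> (complex \<Rightarrow> complex) set" where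
  "cusp_forms r v = {f \<in> automorphic_forms r v.
     \<forall>a>0. f \<in> O[filtercomap Im at_top](\<lambda>z. of_real (Im z powr (- a)))}"


section \<open>Function spaces\<close>

text \<open>
  With $w = (z-i)/(z+i)$, the map \<open>upper_of_w\<close> is the inverse $w \mapsto z$, taking the unit disc
  onto the upper half-plane. On the other side of the real projective line we use the coordinate
  $u = 1/w = (t+i)/(t-i)$, in which the lower half-plane is the open unit disc, $t = -i$ is $u = 0$,
  the real projective line is the unit circle and $t = \infty$ is $u = 1$; \<open>lower_of_u\<close> is the
  inverse $u \mapsto t$. This is a chart of the complex projective line with only $t = i$ removed.
\<close>
definition upper_of_w :: "complex \<Rightarrow> complex" where
  "upper_of_w w = \<i> * (1 + w) / (1 - w)"

definition lower_of_u :: "complex \<Rightarrow> complex" where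
  "lower_of_u u = - \<i> * (1 + u) / (1 - u)"

definition minus_wt :: "real \<Rightarrow> (complex \<Rightarrow> complex) \<Rightarrow> complex \<Rightarrow> complex" where
  "minus_wt r f t = (\<i> - t) powr of_real r * f t"

definition plus_wt :: "real \<Rightarrow> (complex \<Rightarrow> complex) \<Rightarrow> complex \<Rightarrow> complex" where
  "plus_wt r h z = (- \<i> - z) powr of_real r * h z"

text \<open>
  Every neighbourhood of the closed unit disc contains a disc of some radius \<open>R > 1\<close>, so it is
  enough to extend $f^-$ to such discs in the coordinate \<open>u\<close>.
\<close>
definition minus_D_omega :: "real \<Rightarrow> (complex \<Rightarrow> complex) set" where
  "minus_D_omega r = {f. f holomorphic_on lower_hp \<and>
     (\<exists>R>1. \<exists>F. F holomorphic_on ball 0 R \<and>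
        (\<forall>u\<in>ball 0 1. F u = minus_wt r f (lower_of_u u)))}"

text \<open>
  For a function holomorphic inside the disc, smoothness on the closed disc means that it has
  complex derivatives of all orders there, one-sided ones (relative to the disc) on the circle.
\<close>
definition minus_D_infty :: "real \<Rightarrow> (complex \<Rightarrow> complex) set" where
  "minus_D_infty r = {f. f holomorphic_on lower_hp \<and>
     (\<exists>G :: nat \<Rightarrow> complex \<Rightarrow> complex.
        (\<forall>u\<in>ball 0 1. G 0 u = minus_wt r f (lower_of_u u)) \<and>
        (\<forall>k. \<forall>u\<in>cball 0 1. (G k has_field_derivative G (Suc k) u) (at u within cball 0 1)))}"

definition plus_D_minus_infty :: "real \<Rightarrow> (complex \<Rightarrow> complex) set" where
  "plus_D_minus_infty r = {h. h holomorphic_on upper_hp \<and>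
     (\<exists>B>0. \<exists>K. \<forall>z\<in>upper_hp.
        norm (plus_wt r h z) \<le> K * (Im z powr (- B) + norm z powr B))}"

text \<open>
  Boundary values of $f^-$ as a function of $\theta$, where $t = -\cot\theta$; this point has
  coordinate $u = e^{-2i\theta}$.
\<close>
definition minus_boundary :: "real \<Rightarrow> (complex \<Rightarrow> complex) \<Rightarrow> real \<Rightarrow> complex" where
  "minus_boundary r f \<theta> =
     Lim (at (cis (- 2 * \<theta>)) within ball 0 1) (\<lambda>u. minus_wt r f (lower_of_u u))"

definition minus_seminorm :: "real \<Rightarrow> nat \<Rightarrow> (complex \<Rightarrow> complex) \<Rightarrow> real" where
  "minus_seminorm r k f =
     (SUP \<theta>. norm (((\<lambda>g \<theta>. vector_derivative g (at \<theta>)) ^^ k) (minus_boundary r f) \<theta>))"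

text \<open>
  The neighbourhood filter of \<open>f\<close> in the topology of \<^term>\<open>minus_D_infty r\<close>, restricted to
  the subspace \<^term>\<open>minus_D_omega r\<close>.
\<close>
definition minus_nhds_omega ::
  "real \<Rightarrow> (complex \<Rightarrow> complex) \<Rightarrow> (complex \<Rightarrow> complex) filter" where
  "minus_nhds_omega r f = (INF (N, e)\<in>(UNIV :: nat set) \<times> {0::real<..}.
     principal {g \<in> minus_D_omega r. \<forall>k\<le>N. minus_seminorm r k (\<lambda>t. g t - f t) < e})"


section \<open>The bilinear form\<close>

text \<open>
  If $f^- = \sum_{m\le0} d_m w^m$, then $d_{-n}$ is the coefficient of $u^n$ in the power series of
  $f^-$ at $u = 0$; \<open>sigma_coeff r f n\<close> is the coefficient of $w^{-n-1} = u^{n+1}$ in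
  $\sigma_r f^-$.
\<close>
definition sigma_coeff :: "real \<Rightarrow> (complex \<Rightarrow> complex) \<Rightarrow> nat \<Rightarrow> complex" where
  "sigma_coeff r f n = fact n / pochhammer (of_real r) n *
     fps_nth (fps_expansion (\<lambda>u. minus_wt r f (lower_of_u u)) 0) n"

definition sigma_minus :: "real \<Rightarrow> (complex \<Rightarrow> complex) \<Rightarrow> complex \<Rightarrow> complex" where
  "sigma_minus r f z = (\<Sum>n. sigma_coeff r f n * ((z + \<i>) / (z - \<i>)) ^ Suc n)"

text \<open>
  The series for $\sigma_r f^-$ converges where $1/|w|$ is smaller than the radius of convergence
  below. The integral does not depend on the choice of the circle $|w| = c$ in that domain.
\<close>
definition bracket_omega :: "real \<Rightarrow> (complex \<Rightarrow> complex) \<Rightarrow> (complex \<Rightarrow> complex) \<Rightarrow> complex" where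
  "bracket_omega r h f =
     (let c = (SOME c::real. 0 < c \<and> c < 1 \<and> ereal (1 / c) < conv_radius (sigma_coeff r f))
      in 1 / of_real pi * contour_integral (upper_of_w \<circ> circlepath 0 c)
           (\<lambda>z. plus_wt r h z * sigma_minus r f z / (z + \<i>) ^ 2))"

text \<open>The extension by continuity from \<^term>\<open>minus_D_omega r\<close> to \<^term>\<open>minus_D_infty r\<close>.\<close>
definition bracket :: "real \<Rightarrow> (complex \<Rightarrow> complex) \<Rightarrow> (complex \<Rightarrow> complex) \<Rightarrow> complex" where
  "bracket r h f =
     (if h \<in> plus_D_minus_infty r \<and> f \<in> minus_D_infty r
      then Lim (minus_nhds_omega r f) (bracket_omega r h) else undefined)"


section \<open>The trilinear form\<close>

definition cint :: "real \<Rightarrow> (complex \<Rightarrow> complex) \<Rightarrow> complex \<Rightarrow> complex \<Rightarrow> complex \<Rightarrow> complex" where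
  "cint r f z1 z2 t =
     contour_integral (linepath z1 z2) (\<lambda>\<tau>. f \<tau> * (\<tau> - t) powr of_real (r - 2))"

text \<open>The case $z_2 = \infty$, along the vertical half-line $\tau = z_1 + iy$, $y \ge 0$.\<close>
definition cint_infty :: "real \<Rightarrow> (complex \<Rightarrow> complex) \<Rightarrow> complex \<Rightarrow> complex \<Rightarrow> complex" where
  "cint_infty r f z1 t =
     \<i> * (LINT y:{0..}|lborel.
            f (z1 + \<i> * of_real y) * (z1 + \<i> * of_real y - t) powr of_real (r - 2))"

definition rho :: complex where
  "rho = exp (of_real pi * \<i> / 3)"

definition trilinear :: "real \<Rightarrow> real \<Rightarrow> real \<Rightarrow> (complex \<Rightarrow> complex) \<Rightarrow> (complex \<Rightarrow> complex) \<Rightarrow>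
    (complex \<Rightarrow> complex) \<Rightarrow> complex" where
  "trilinear r1 r2 r3 f1 f2 f3 =
     bracket r3 f3 (\<lambda>t. cint r1 f1 (rho - 1) rho t * cint_infty r2 f2 \<i> t)"

definition sinc :: "real \<Rightarrow> real" where
  "sinc x = (if x = 0 then 1 else sin x / x)"

text \<open>
  Meaningful for \<open>\<mu>2 > 0\<close> and \<open>\<mu>3 \<ge> 0\<close>. Beware of the sign: for \<open>\<kappa> = \<mu>2 + \<mu>3 * u\<close> one has
  $\int_i^{i\infty} e^{2\pi i\kappa\tau}\,d\tau = -e^{-2\pi\kappa}/(2\pi i\kappa)$, so with the
  factor $1/(2\pi i)$ used here the trilinear form is minus the series in \<open>Psi\<close>.
\<close>
definition Psi :: "real \<Rightarrow> real \<Rightarrow> real \<Rightarrow> real \<Rightarrow> real \<Rightarrow> complex" where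
  "Psi r1 r2 \<mu>1 \<mu>2 \<mu>3 =
     of_real (exp (- 2 * pi * \<mu>2 - pi * sqrt 3 * (\<mu>1 + \<mu>3))) / (2 * of_real pi * \<i>) *
     of_real (LINT u:{0..1}|lborel. u powr (1 - r2) * (1 - u) powr (1 - r1) *
        (exp (- pi * (2 - sqrt 3) * \<mu>3 * u) / (\<mu>2 + \<mu>3 * u)) *
        sinc (pi * (\<mu>1 + (1 - u) * \<mu>3)))"

end

theory Submission
  imports Defs "HOL-Real_Asymp.Real_Asymp"
begin

text \<open>
  In the coordinate $u$ on the lower half-plane and $w$ on the upper one, the bilinear form is
  $\sum_n \frac{n!}{(r)_n} c_n d_{-n}$; it is continuous because the $c_n$ grow polynomially while
  a seminorm of order $k$ of $f^-$ bounds $n^k d_{-n}$. On the kernel $(\tau - t)^{-r}$ the form is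
  the reproducing formula $[h, (\tau - \cdot)^{-r}]_r = (-2i)^r h(\tau)$, and it commutes with rapidly
  decaying superpositions of such kernels. Feynman's integral
  \[ A^{-a} B^{-b} = \frac{1}{\mathsf B(a,b)} \int_0^1 u^{b-1} (1-u)^{a-1} ((1-u) A + u B)^{-a-b}\,du \]
  with $A = \tau_1 - t$, $B = \tau_2 - t$ turns the product of the two period integrals into such a
  superposition, so the trilinear form is a triple integral of
  $f_1(\tau_1) f_2(\tau_2) f_3((1-u)\tau_1 + u\tau_2)$. Inserting the Fourier expansions and
  integrating over $\tau_1$ and $\tau_2$ leaves the integral defining $\Psi$.
\<close>

section \<open>The bilinear form as a series\<close>

text \<open>The bracket is a \<open>Lim\<close> along a filter, so it has content only after that
  filter is shown to be proper and the form to converge along it; the coefficient series is then its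
  value. The reproducing formula rests on one cancellation: up to a constant, the kernel is
  \<open>(1 - w * u)\<close> to the power \<open>-r\<close>, whose n-th coefficient
  \<open>(r)_n / n! * w^n\<close> meets the factor \<open>n! / (r)_n\<close>; what remains is the
  Taylor series of \<open>h^+\<close> at \<open>w\<close>. The obstacle is the cusp. As
  \<open>tau_2\<close> goes to infinity its disc point \<open>w\<close> approaches the unit circle,
  so the kernels share no disc larger than the unit disc, and the superposition is treated in
  \<open>minus_D_infty\<close> through the decay of its coefficients. The exponential decay of
  \<open>f2\<close> pays for this: all moments of \<open>1 / (1 - |w|)\<close> are finite. The
  condition \<open>r1 + r2 + r3 = 4\<close> makes the Feynman exponent
  \<open>(2 - r1) + (2 - r2)\<close> equal to \<open>r3\<close>. The segment from
  \<open>rho - 1\<close> to \<open>rho\<close> is symmetric about the imaginary axis, which produces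
  \<open>sinc\<close>; the vertical ray contributes \<open>\<i> / (2 * pi)\<close>, that is
  \<open>- 1 / (2 * pi * \<i>)\<close>, and hence the minus sign of the final formula.\<close>

definition disc_minus :: "real \<Rightarrow> (complex \<Rightarrow> complex) \<Rightarrow> complex \<Rightarrow> complex" where
  "disc_minus r f u = minus_wt r f (lower_of_u u)"

definition disc_plus :: "real \<Rightarrow> (complex \<Rightarrow> complex) \<Rightarrow> complex \<Rightarrow> complex" where
  "disc_plus r h w = plus_wt r h (upper_of_w w)"

text \<open>As \<open>u = 1 / w\<close>, this is the coefficient \<open>d_{-n}\<close> of
  \<open>f^-\<close>. It makes sense for every \<open>f\<close> holomorphic on the lower half-plane,
  with no extension across the circle.\<close>

definition minus_coeff :: "real \<Rightarrow> (complex \<Rightarrow> complex) \<Rightarrow> nat \<Rightarrow> complex" where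
  "minus_coeff r f n = fps_nth (fps_expansion (disc_minus r f) 0) n"

definition plus_coeff :: "real \<Rightarrow> (complex \<Rightarrow> complex) \<Rightarrow> nat \<Rightarrow> complex" where
  "plus_coeff r h n = fps_nth (fps_expansion (disc_plus r h) 0) n"

lemma sigma_coeff_eq:
  "sigma_coeff r f n = of_real (fact n / pochhammer r n) * minus_coeff r f n"
proof -
  have "pochhammer (of_real r :: complex) n = of_real (pochhammer r n)"
    by (rule pochhammer_of_real)
  then show ?thesis
    by (simp add: sigma_coeff_def minus_coeff_def disc_minus_def[abs_def])
qed

section \<open>Polynomial bounds for the Pochhammer quotients\<close>

lemma fact_over_pochhammer_le:
  fixes r :: real
  assumes "r > 0"
  shows "fact n / pochhammer r n \<le> (1 + 1 / r) * (real n + 1)"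
proof -
  have pos: "pochhammer r n > 0" for n
    using assms by (rule pochhammer_pos)
  \<comment> \<open>The factor \<open>1 / r\<close> is split off first; every later factor
    \<open>(j + 1) / (r + j)\<close> is at most \<open>(j + 1) / j\<close>, so the product
    telescopes. The summand 1 in the constant \<open>1 + 1 / r\<close> covers
    \<open>n = 0\<close>.\<close>
  have *: "fact (Suc n) / pochhammer r (Suc n) \<le> (real n + 1) / r" for n
  proof (induction n)
    case 0 then show ?case by simp
  next
    case (Suc n)
    have "fact (Suc (Suc n)) / pochhammer r (Suc (Suc n))
        = fact (Suc n) / pochhammer r (Suc n) * ((real n + 2) / (r + real n + 1))"
      by (simp add: pochhammer_Suc add_ac)
    also have "\<dots> \<le> ((real n + 1) / r) * ((real n + 2) / (real n + 1))"
      using assms by (intro mult_mono Suc.IH divide_left_mono) (auto intro!: mult_pos_pos)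
    also have "\<dots> = (real (Suc n) + 1) / r"
      using of_nat_0_le_iff[of n, where 'a = real] by simp
    finally show ?case .
  qed
  show ?thesis
  proof (cases n)
    case 0 then show ?thesis using assms by simp
  next
    case (Suc m)
    have "fact n / pochhammer r n \<le> (real m + 1) / r" using *[of m] Suc by simp
    also have "\<dots> \<le> (1 + 1 / r) * (real n + 1)" using assms Suc by (simp add: field_simps)
    finally show ?thesis .
  qed
qed

text \<open>With \<open>R\<close> the ceiling of \<open>r\<close>, the factor
  \<open>(r + n) / (n + 1)\<close> is at most \<open>1 + R / (n + 1)\<close>, hence by Bernoulli at
  most \<open>(1 + 1 / (n + 1)) ^ R\<close>; these bounds telescope.\<close>

lemma pochhammer_over_fact_le:
  fixes r :: real
  assumes "r > 0"
  shows "pochhammer r n / fact n \<le> (real n + 1) ^ nat \<lceil>r\<rceil>"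
proof (induction n)
  case 0 then show ?case by simp
next
  case (Suc n)
  define R where "R = nat \<lceil>r\<rceil>"
  have R: "r \<le> real R" unfolding R_def by linarith
  have pos: "pochhammer r n \<ge> 0"
    using assms pochhammer_pos[of r n] by simp
  have "pochhammer r (Suc n) / fact (Suc n) = pochhammer r n / fact n * ((r + real n) / (real n + 1))"
    by (simp add: pochhammer_Suc add_ac)
  also have "\<dots> \<le> (real n + 1) ^ R * (1 + real R * (1 / (real n + 1)))"
  proof (rule mult_mono)
    show "pochhammer r n / fact n \<le> (real n + 1) ^ R" using Suc.IH by (simp add: R_def)
    have "1 + real R * (1 / (real n + 1)) = (real n + 1 + real R) / (real n + 1)"
      by (simp add: field_simps)
    then show "(r + real n) / (real n + 1) \<le> 1 + real R * (1 / (real n + 1))"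
      using R by (simp add: divide_right_mono)
  qed (use assms in auto)
  also have "\<dots> \<le> (real n + 1) ^ R * (1 + 1 / (real n + 1)) ^ R"
    by (intro mult_left_mono Bernoulli_inequality) (auto simp: field_simps)
  also have "\<dots> = ((real n + 1) * (1 + 1 / (real n + 1))) ^ R"
    by (simp only: power_mult_distrib)
  also have "(real n + 1) * (1 + 1 / (real n + 1)) = real (Suc n) + 1"
    by (simp add: field_simps)
  finally show ?case by (simp add: R_def)
qed

section \<open>Cayley transforms between the half-planes and the unit disc\<close>

lemma Im_upper_of_w:
  assumes "w \<noteq> 1"
  shows "Im (upper_of_w w) = (1 - (norm w)\<^sup>2) / (norm (1 - w))\<^sup>2"
  unfolding upper_of_w_def Im_divide cmod_power2
  by (simp add: power2_eq_square algebra_simps)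

lemma upper_of_w_in: "norm w < 1 \<Longrightarrow> upper_of_w w \<in> upper_hp"
proof -
  assume w: "norm w < 1"
  have [simp]: "w \<noteq> 1" "1 - w \<noteq> 0" using w by auto
  have "(norm w)\<^sup>2 < 1" using w by (simp add: power_less_one_iff abs_square_less_1)
  then show ?thesis by (simp add: upper_hp_def Im_upper_of_w)
qed

lemma lower_of_u_eq: "lower_of_u u = - upper_of_w u"
  by (simp add: lower_of_u_def upper_of_w_def)

lemma lower_of_u_in: "norm w < 1 \<Longrightarrow> lower_of_u w \<in> lower_hp"
  using upper_of_w_in[of w] by (simp add: lower_of_u_eq upper_hp_def lower_hp_def)

lemma i_minus_lower_of_u: "u \<noteq> 1 \<Longrightarrow> \<i> - lower_of_u u = 2 * \<i> / (1 - u)"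
  by (simp add: lower_of_u_def field_simps)

lemma upper_of_w_plus_i: "w \<noteq> 1 \<Longrightarrow> upper_of_w w + \<i> = 2 * \<i> / (1 - w)"
  by (simp add: upper_of_w_def field_simps)

lemma upper_of_w_minus_i: "w \<noteq> 1 \<Longrightarrow> upper_of_w w - \<i> = 2 * \<i> * w / (1 - w)"
  by (simp add: upper_of_w_def field_simps)

lemma minus_wt_holomorphic:
  assumes "f holomorphic_on lower_hp"
  shows "minus_wt r f holomorphic_on lower_hp"
  unfolding minus_wt_def[abs_def]
  by (intro holomorphic_intros assms)
     (auto simp: lower_hp_def complex_nonpos_Reals_iff)

lemma plus_wt_holomorphic:
  assumes "f holomorphic_on upper_hp"
  shows "plus_wt r f holomorphic_on upper_hp"
  unfolding plus_wt_def[abs_def]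
  by (intro holomorphic_intros assms)
     (auto simp: upper_hp_def complex_nonpos_Reals_iff)

lemma upper_of_w_holomorphic: "upper_of_w holomorphic_on (-{1})"
  unfolding upper_of_w_def[abs_def]
  by (intro holomorphic_intros) auto

lemma lower_of_u_holomorphic: "lower_of_u holomorphic_on (-{1})"
  unfolding lower_of_u_def[abs_def]
  by (intro holomorphic_intros) auto

lemma disc_minus_holomorphic:
  assumes "f holomorphic_on lower_hp"
  shows "disc_minus r f holomorphic_on ball 0 1"
proof -
  have "(minus_wt r f \<circ> lower_of_u) holomorphic_on ball 0 1"
    by (rule holomorphic_on_compose_gen[OF _ minus_wt_holomorphic[OF assms]])
       (auto intro: holomorphic_on_subset[OF lower_of_u_holomorphic] lower_of_u_in)
  then show ?thesis by (simp add: o_def disc_minus_def[abs_def])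
qed

lemma disc_plus_holomorphic:
  assumes "f holomorphic_on upper_hp"
  shows "disc_plus r f holomorphic_on ball 0 1"
proof -
  have "(plus_wt r f \<circ> upper_of_w) holomorphic_on ball 0 1"
    by (rule holomorphic_on_compose_gen[OF _ plus_wt_holomorphic[OF assms]])
       (auto intro: holomorphic_on_subset[OF upper_of_w_holomorphic] upper_of_w_in)
  then show ?thesis by (simp add: o_def disc_plus_def[abs_def])
qed

lemma deriv_upper_of_w:
  assumes "w \<noteq> 1"
  shows "deriv upper_of_w w = 2 * \<i> / (1 - w)\<^sup>2"
proof (rule DERIV_imp_deriv)
  show "(upper_of_w has_field_derivative 2 * \<i> / (1 - w)\<^sup>2) (at w)"
    unfolding upper_of_w_def[abs_def] using assms
    by (auto intro!: derivative_eq_intros simp: power2_eq_square divide_simps) (simp add: algebra_simps)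
qed

lemma eventually_unit_ball: "\<forall>\<^sub>F u in nhds 0. u \<in> ball (0::complex) 1"
  by (rule eventually_nhds_in_open) auto

lemma fps_expansion_sums:
  assumes "f holomorphic_on ball 0 R" "norm z < R"
  shows "(\<lambda>n. fps_nth (fps_expansion f 0) n * z ^ n) sums f z"
  using holomorphic_power_series[OF assms(1), of z] assms(2)
  by (simp add: fps_expansion_def)

text \<open>A residue computation: in the coordinate \<open>w\<close> the differential
  \<open>dz / (z + \<i>)^2\<close> becomes \<open>dw / (2 * \<i>)\<close>, and integrating
  \<open>disc_plus r h w / w ^ Suc n\<close> over the circle extracts
  \<open>plus_coeff r h n\<close>. The radius is whatever \<open>SOME\<close> returns, so only its
  defining inequalities are used.\<close>

lemma bracket_omega_sums:
  assumes r: "r > 0" and h: "h holomorphic_on upper_hp" and g: "g \<in> minus_D_omega r"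
  shows "(\<lambda>n. of_real (fact n / pochhammer r n) * plus_coeff r h n * minus_coeff r g n)
           sums bracket_omega r h g"
proof -
  from g obtain R F where R: "R > 1" and F: "F holomorphic_on ball 0 R"
    and FD: "\<And>u. u \<in> ball 0 1 \<Longrightarrow> F u = disc_minus r g u"
    unfolding minus_D_omega_def disc_minus_def by auto
  have dF: "minus_coeff r g n = fps_nth (fps_expansion F 0) n" for n
  proof -
    have "\<forall>\<^sub>F u in nhds 0. disc_minus r g u = F u"
      by (rule eventually_mono[OF eventually_unit_ball]) (auto simp: FD)
    from fps_expansion_cong[OF this] show ?thesis by (simp add: minus_coeff_def)
  qed
  define s where "s = sigma_coeff r g"
  have s_eq: "s n = of_real (fact n / pochhammer r n) * minus_coeff r g n" for n
    by (simp add: s_def sigma_coeff_eq)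
  \<comment> \<open>The factor \<open>n! / (r)_n\<close> costs one power of \<open>n\<close>, which
    does not lower the radius of convergence: the terms at \<open>t\<close> are compared with
    bounded ones at \<open>t'\<close> between \<open>t\<close> and \<open>R\<close>.\<close>
  have crad: "ereal R \<le> conv_radius s"
  proof (rule conv_radius_geI_ex')
    fix t :: real assume t: "0 < t" "ereal t < ereal R"
    define t' where "t' = (t + R) / 2"
    have t': "0 < t'" "t < t'" "t' < R" using t by (auto simp: t'_def)
    have "summable (\<lambda>n. fps_nth (fps_expansion F 0) n * of_real t' ^ n)"
      using fps_expansion_sums[OF F, of "of_real t'"] t' by (auto simp: sums_iff)
    then have "(\<lambda>n. fps_nth (fps_expansion F 0) n * of_real t' ^ n) \<longlonglongrightarrow> 0"
      by (rule summable_LIMSEQ_zero)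
    then have "Bseq (\<lambda>n. fps_nth (fps_expansion F 0) n * of_real t' ^ n)"
      by (intro convergent_imp_Bseq) (auto simp: convergent_def)
    then obtain K where K: "K > 0" "\<And>n. norm (fps_nth (fps_expansion F 0) n * of_real t' ^ n) \<le> K"
      by (auto simp: Bseq_def)
    show "summable (\<lambda>n. s n * of_real t ^ n)"
    proof (rule summable_comparison_test')
      define q where "q = t / t'"
      have q: "0 < q" "q < 1" using t t' by (auto simp: q_def)
      have "summable (\<lambda>n. diffs (\<lambda>_. 1) n * q ^ n)"
        using q by (intro termdiff_converges[of _ 1]) (auto intro: summable_geometric)
      then have "summable (\<lambda>n. (1 + 1 / r) * K * ((real n + 1) * q ^ n))"
        by (intro summable_mult) (simp add: diffs_def add_ac)
      then show "summable (\<lambda>n. (1 + 1 / r) * K * (real n + 1) * q ^ n)"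
        by (simp add: mult_ac)
      fix n :: nat
      have pp: "fact n / pochhammer r n \<ge> 0"
        using pochhammer_pos[OF r, of n] by simp
      have "norm (s n * of_real t ^ n) = (fact n / pochhammer r n) *
          (norm (fps_nth (fps_expansion F 0) n * of_real t' ^ n) * q ^ n)"
        using t t' pp pochhammer_pos[OF r, of n] by (simp add: s_eq dF norm_mult norm_power q_def norm_divide power_divide abs_mult)
      also have "\<dots> \<le> ((1 + 1 / r) * (real n + 1)) * (K * q ^ n)"
        using q pp r K by (intro mult_mono fact_over_pochhammer_le) auto
      finally show "norm (s n * of_real t ^ n) \<le> (1 + 1 / r) * K * (real n + 1) * q ^ n"
        by (simp add: mult_ac)
    qed
  qed
  define P where "P = (\<lambda>c::real. 0 < c \<and> c < 1 \<and> ereal (1 / c) < conv_radius s)"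
  define c where "c = (SOME c. P c)"
  \<comment> \<open>\<open>SOME\<close> is only informative if an admissible radius exists; the
    reciprocal of the midpoint of 1 and \<open>R\<close> is one.\<close>
  have "P (1 / ((1 + R) / 2))"
    unfolding P_def
  proof (intro conjI)
    show "0 < 1 / ((1 + R) / 2)" "1 / ((1 + R) / 2) < 1" using R by auto
    have "ereal (1 / (1 / ((1 + R) / 2))) < ereal R" using R by simp
    then show "ereal (1 / (1 / ((1 + R) / 2))) < conv_radius s"
      using crad by (rule less_le_trans)
  qed
  then have "P c" unfolding c_def by (rule someI)
  then have c: "0 < c" "c < 1" and cr: "ereal (1 / c) < conv_radius s"
    unfolding P_def by auto
  have sph: "path_image (circlepath 0 c) = sphere 0 c" using c by simp
  define H where "H = disc_plus r h"
  let ?S = "\<lambda>w. \<Sum>n. s n * (1 / w) ^ Suc n"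
  let ?L = "\<lambda>w. H w * ?S w / (2 * \<i>)" and ?T = "\<lambda>n w. H w * (s n * (1 / w) ^ Suc n) / (2 * \<i>)"
  have H: "H holomorphic_on ball 0 1" unfolding H_def by (rule disc_plus_holomorphic[OF h])
  define g' where "g' = (\<lambda>z. plus_wt r h z * sigma_minus r g z / (z + \<i>) ^ 2)"
  have "bracket_omega r h g = 1 / of_real pi * contour_integral (upper_of_w \<circ> circlepath 0 c) g'"
    by (simp add: bracket_omega_def Let_def c_def P_def s_def g'_def)
  also have "contour_integral (upper_of_w \<circ> circlepath 0 c) g' =
     contour_integral (circlepath 0 c) (\<lambda>w. deriv upper_of_w w * g' (upper_of_w w))"
    by (rule contour_integral_comp_analyticW[of _ "ball 0 1"])
       (use c in \<open>auto intro!: analytic_on_holomorphic[THEN iffD2] exI[of _ "- {1}"] upper_of_w_holomorphic\<close>)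
  also have "\<dots> = contour_integral (circlepath 0 c) (\<lambda>w. ?L w)"
  proof (rule contour_integral_cong[OF refl])
    fix w assume "w \<in> path_image (circlepath 0 c)"
    then have nw: "norm w = c" using c by simp
    then have w: "w \<noteq> 1" "1 - w \<noteq> 0" "w \<noteq> 0" using c by auto
    have e: "(upper_of_w w + \<i>) / (upper_of_w w - \<i>) = 1 / w"
      using w by (simp add: upper_of_w_plus_i upper_of_w_minus_i)
    have sg: "sigma_minus r g (upper_of_w w) = ?S w"
      unfolding sigma_minus_def e s_def ..
    have "deriv upper_of_w w * g' (upper_of_w w) =
      2 * \<i> / (1 - w)\<^sup>2 * (H w * ?S w / (2 * \<i> / (1 - w))\<^sup>2)"
      unfolding g'_def sg deriv_upper_of_w[OF w(1)] upper_of_w_plus_i[OF w(1)]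
      by (simp add: H_def disc_plus_def)
    also have "\<dots> = ?L w"
    proof -
      have "2 * \<i> / a\<^sup>2 * (X / (2 * \<i> / a)\<^sup>2) = X / (2 * \<i>)" if "a \<noteq> 0" for a X :: complex
        using that by (simp add: field_simps power2_eq_square)
      from this[OF w(2)] show ?thesis .
    qed
    finally show "deriv upper_of_w w * g' (upper_of_w w) = \<dots>" .
  qed
  finally have br: "bracket_omega r h g = 1 / of_real pi *
     contour_integral (circlepath 0 c) (\<lambda>w. ?L w)" .
  have cb: "cball 0 c \<subseteq> ball (0::complex) 1" using c by auto
  have Hc: "continuous_on (cball 0 c) H"
    using H cb by (meson holomorphic_on_imp_continuous_on continuous_on_subset)
  have Hh: "H holomorphic_on ball 0 c"
    by (rule holomorphic_on_subset[OF H]) (use c in auto)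
  have Hn: "((\<lambda>u. H u / (u - 0) ^ Suc n) has_contour_integral
      2 * of_real pi * \<i> / fact n * (deriv ^^ n) H 0) (circlepath 0 c)" for n
    using Cauchy_has_contour_integral_higher_derivative_circlepath[OF Hc Hh, of 0 n] c by simp
  have trm: "((\<lambda>w. ?T n w) has_contour_integral
      of_real pi * (s n * plus_coeff r h n)) (circlepath 0 c)" for n
  proof -
    have "((\<lambda>u. s n / (2 * \<i>) * (H u / (u - 0) ^ Suc n)) has_contour_integral
      s n / (2 * \<i>) * (2 * of_real pi * \<i> / fact n * (deriv ^^ n) H 0)) (circlepath 0 c)"
      by (intro has_contour_integral_lmul Hn)
    then show ?thesis
      by (simp add: plus_coeff_def fps_expansion_def H_def power_one_over field_simps)
  qed
  have "bounded (H ` cball 0 c)"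
    by (rule compact_imp_bounded[OF compact_continuous_image[OF Hc compact_cball]])
  then obtain B where "\<forall>x\<in>H ` cball 0 c. norm x \<le> B"
    unfolding bounded_iff by blast
  then have B: "\<And>w. w \<in> cball 0 c \<Longrightarrow> norm (H w) \<le> B" by blast
  \<comment> \<open>Uniform convergence on the circle permits integration term by term.\<close>
  have ul: "uniform_limit (sphere 0 c) (\<lambda>N w. \<Sum>n<N. ?T n w)
      (\<lambda>w. \<Sum>n. ?T n w) sequentially"
  proof (rule Weierstrass_m_test)
    have "summable (\<lambda>n. norm (s n * of_real (1 / c) ^ n))"
      by (rule abs_summable_in_conv_radius) (use c cr in \<open>simp add: norm_divide\<close>)
    then have "summable (\<lambda>n. B / (2 * c) * norm (s n * of_real (1 / c) ^ n))"
      by (rule summable_mult)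
    then show "summable (\<lambda>n. B / (2 * c) * (norm (s n) * (1 / c) ^ n))"
      using c by (simp add: norm_mult norm_power norm_divide)
    fix n and w :: complex assume "w \<in> sphere 0 c"
    then have w: "norm w = c" by simp
    have "norm (?T n w) = norm (H w) * (norm (s n) * (1 / c) ^ n / (2 * c))"
      using w by (simp add: norm_mult norm_divide norm_power)
    also have "\<dots> \<le> B * (norm (s n) * (1 / c) ^ n / (2 * c))"
      using w c by (intro mult_right_mono B) auto
    finally show "norm (?T n w) \<le> B / (2 * c) * (norm (s n) * (1 / c) ^ n)"
      by simp
  qed
  have sumtrm: "((\<lambda>w. \<Sum>n<N. ?T n w) has_contour_integral
      (\<Sum>n<N. of_real pi * (s n * plus_coeff r h n))) (circlepath 0 c)" for N
    by (intro has_contour_integral_sum trm) auto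
  have "(\<lambda>N. contour_integral (circlepath 0 c) (\<lambda>w. \<Sum>n<N. ?T n w))
      \<longlonglongrightarrow> contour_integral (circlepath 0 c) (\<lambda>w. \<Sum>n. ?T n w)"
    by (rule contour_integral_uniform_limit_circlepath[OF _ ul])
       (use c has_contour_integral_integrable[OF sumtrm] in \<open>auto intro!: always_eventually\<close>)
  then have "(\<lambda>n. of_real pi * (s n * plus_coeff r h n)) sums
     contour_integral (circlepath 0 c) (\<lambda>w. \<Sum>n. ?T n w)"
    unfolding sums_def contour_integral_unique[OF sumtrm] .
  also have "contour_integral (circlepath 0 c) (\<lambda>w. \<Sum>n. ?T n w) =
     contour_integral (circlepath 0 c) (\<lambda>w. ?L w)"
  proof (rule contour_integral_cong[OF refl])
    fix w assume "w \<in> path_image (circlepath 0 c)"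
    then have nw: "norm w = c" using c by simp
    have "summable (\<lambda>n. s n * (1 / w) ^ n)"
      by (rule summable_in_conv_radius) (use nw cr in \<open>simp add: norm_divide\<close>)
    then have "summable (\<lambda>n. (1 / w) * (s n * (1 / w) ^ n))" by (rule summable_mult)
    then have sm: "summable (\<lambda>n. s n * (1 / w) ^ Suc n)" by (simp add: mult_ac)
    show "(\<Sum>n. ?T n w) = ?L w"
      using sums_divide[OF sums_mult[OF summable_sums[OF sm]], of "H w" "2 * \<i>"]
      by (simp add: sums_iff)
  qed
  finally have "(\<lambda>n. 1 / of_real pi * (of_real pi * (s n * plus_coeff r h n))) sums bracket_omega r h g"
    unfolding br by (rule sums_mult)
  then show ?thesis by (simp add: s_eq mult_ac)
qed

section \<open>Smooth functions on the closed disc and the seminorms\<close>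

definition smooth_disc :: "(nat \<Rightarrow> complex \<Rightarrow> complex) \<Rightarrow> bool" where
  "smooth_disc G \<longleftrightarrow> (\<forall>k. \<forall>u\<in>cball 0 1.
     (G k has_field_derivative G (Suc k) u) (at u within cball 0 1))"

text \<open>On the circle $u = e^{-2i\theta}$ the derivative $d/d\theta$ is $-2iu\,d/du$; a smooth function is
  represented by the sequence of its derivatives in \<open>u\<close>.\<close>
definition rot_deriv :: "(nat \<Rightarrow> complex \<Rightarrow> complex) \<Rightarrow> nat \<Rightarrow> complex \<Rightarrow> complex" where
  "rot_deriv G k u = - 2 * \<i> * (u * G (Suc k) u + of_nat k * G k u)"

lemma smooth_discD:
  "smooth_disc G \<Longrightarrow> u \<in> cball 0 1 \<Longrightarrow>
    (G k has_field_derivative G (Suc k) u) (at u within cball 0 1)"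
  by (auto simp: smooth_disc_def)

text \<open>\<open>rot_deriv G k\<close> is the k-th derivative of
  \<open>- 2 * \<i> * u * G (Suc 0) u\<close>; by the Leibniz rule this brings in the extra term
  with \<open>of_nat k\<close>.\<close>

lemma smooth_disc_rot_deriv:
  assumes "smooth_disc G"
  shows "smooth_disc (rot_deriv G)"
  unfolding smooth_disc_def
proof (intro allI ballI)
  fix k and u :: complex assume u: "u \<in> cball 0 1"
  show "(rot_deriv G k has_field_derivative rot_deriv G (Suc k) u) (at u within cball 0 1)"
    unfolding rot_deriv_def[abs_def]
    by (auto intro!: derivative_eq_intros smooth_discD[OF assms u] simp: algebra_simps)
qed

lemma smooth_disc_rot_deriv_funpow: "smooth_disc G \<Longrightarrow> smooth_disc ((rot_deriv ^^ k) G)"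
  by (induction k) (auto intro: smooth_disc_rot_deriv)

lemma smooth_disc_continuous: "smooth_disc G \<Longrightarrow> continuous_on (cball 0 1) (G k)"
  by (meson smooth_discD DERIV_continuous_on)

lemma smooth_disc_holomorphic:
  assumes "smooth_disc G"
  shows "G k holomorphic_on ball 0 1"
proof (rule holomorphic_onI)
  fix u :: complex assume u: "u \<in> ball 0 1"
  have "(G k has_field_derivative G (Suc k) u) (at u within ball 0 1)"
    by (rule DERIV_subset[OF smooth_discD[OF assms]]) (use u in auto)
  then show "G k field_differentiable at u within ball 0 1"
    by (auto simp: field_differentiable_def)
qed

lemma smooth_disc_deriv:
  assumes "smooth_disc G" "u \<in> ball 0 1"
  shows "(G k has_field_derivative G (Suc k) u) (at u)"
proof -
  have "(G k has_field_derivative G (Suc k) u) (at u within ball 0 1)"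
    by (rule DERIV_subset[OF smooth_discD[OF assms(1)]]) (use assms in auto)
  then show ?thesis using assms(2) at_within_open[of u "ball 0 1"] by simp
qed

lemma smooth_disc_diff:
  assumes "smooth_disc F" "smooth_disc G"
  shows "smooth_disc (\<lambda>k u. F k u - G k u)"
  unfolding smooth_disc_def
  by (auto intro!: derivative_eq_intros smooth_discD[OF assms(1)] smooth_discD[OF assms(2)])

text \<open>The Euler operator \<open>u * d/du\<close> acts on \<open>u ^ n\<close> as
  multiplication by \<open>n\<close>. This is how smoothness in the angle becomes decay in
  \<open>n\<close>.\<close>

lemma fps_expansion_rot_deriv:
  assumes "smooth_disc G"
  shows "fps_nth (fps_expansion (rot_deriv G 0) 0) n =
    (- 2 * \<i> * of_nat n) * fps_nth (fps_expansion (G 0) 0) n"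
proof -
  have G: "G 0 has_fps_expansion fps_expansion (G 0) 0"
    by (rule has_fps_expansion_fps_expansion[of "ball 0 1"])
       (auto intro: smooth_disc_holomorphic assms)
  have "(\<lambda>u. - 2 * \<i> * (u * deriv (G 0) u)) has_fps_expansion
      fps_const (- 2 * \<i>) * (fps_X * fps_deriv (fps_expansion (G 0) 0))"
    by (intro has_fps_expansion_mult has_fps_expansion_const has_fps_expansion_fps_X
        has_fps_expansion_deriv G)
  moreover have "\<forall>\<^sub>F u in nhds 0. - 2 * \<i> * (u * deriv (G 0) u) = rot_deriv G 0 u"
    by (rule eventually_mono[OF eventually_unit_ball])
       (use DERIV_imp_deriv[OF smooth_disc_deriv[OF assms, of _ 0]] in \<open>simp add: rot_deriv_def\<close>)
  ultimately have "rot_deriv G 0 has_fps_expansion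
      fps_const (- 2 * \<i>) * (fps_X * fps_deriv (fps_expansion (G 0) 0))"
    using has_fps_expansion_cong by fastforce
  then have "fps_expansion (rot_deriv G 0) 0 =
      fps_const (- 2 * \<i>) * (fps_X * fps_deriv (fps_expansion (G 0) 0))"
    by (rule fps_expansion_eqI)
  then show ?thesis by (cases n) (auto simp: mult.assoc)
qed

lemma fps_expansion_rot_deriv_funpow:
  assumes "smooth_disc G"
  shows "fps_nth (fps_expansion ((rot_deriv ^^ k) G 0) 0) n =
    (- 2 * \<i> * of_nat n) ^ k * fps_nth (fps_expansion (G 0) 0) n"
proof (induction k)
  case (Suc k)
  have "fps_nth (fps_expansion ((rot_deriv ^^ Suc k) G 0) 0) n =
    (- 2 * \<i> * of_nat n) * fps_nth (fps_expansion ((rot_deriv ^^ k) G 0) 0) n"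
    using fps_expansion_rot_deriv[OF smooth_disc_rot_deriv_funpow[OF assms, of k], of n] by simp
  also have "\<dots> = (- 2 * \<i> * of_nat n) ^ Suc k * fps_nth (fps_expansion (G 0) 0) n"
    unfolding Suc.IH by simp
  finally show ?case .
qed simp

lemma minus_boundary_eq:
  assumes G: "smooth_disc G" and eq: "\<And>u. u \<in> ball 0 1 \<Longrightarrow> G 0 u = disc_minus r f u"
  shows "minus_boundary r f \<theta> = G 0 (cis (- 2 * \<theta>))"
  unfolding minus_boundary_def
proof (rule tendsto_Lim)
  show "at (cis (- 2 * \<theta>)) within ball 0 1 \<noteq> bot"
    by (simp add: trivial_limit_within islimpt_ball)
  have "(G 0 \<longlongrightarrow> G 0 (cis (- 2 * \<theta>))) (at (cis (- 2 * \<theta>)) within cball 0 1)"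
    using smooth_disc_continuous[OF G, of 0] by (simp add: continuous_on_def)
  then have "(G 0 \<longlongrightarrow> G 0 (cis (- 2 * \<theta>))) (at (cis (- 2 * \<theta>)) within ball 0 1)"
    by (rule tendsto_within_subset) auto
  then show "((\<lambda>u. minus_wt r f (lower_of_u u)) \<longlongrightarrow> G 0 (cis (- 2 * \<theta>)))
      (at (cis (- 2 * \<theta>)) within ball 0 1)"
    by (rule Lim_transform_eventually)
       (auto simp: eventually_at_filter eq disc_minus_def intro!: always_eventually)
qed

text \<open>At a point of the circle \<open>G 0\<close> only has a derivative within the closed
  disc. This is enough for the chain rule, as the path never leaves the disc.\<close>

lemma smooth_disc_circle_derivative:
  assumes "smooth_disc G"
  shows "((\<lambda>\<theta>. G 0 (cis (- 2 * \<theta>))) has_vector_derivative rot_deriv G 0 (cis (- 2 * \<theta>))) (at \<theta>)"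
proof -
  let ?c = "\<lambda>\<theta>. cis (- 2 * \<theta>)"
  have c: "(?c has_vector_derivative (- 2 * \<i> * ?c \<theta>)) (at \<theta> within UNIV)"
  proof -
    have "((\<lambda>z. exp (\<i> * (- 2 * z))) has_field_derivative
        (- 2 * \<i> * exp (\<i> * (- 2 * of_real \<theta>)))) (at (of_real \<theta>))"
      by (auto intro!: derivative_eq_intros)
    from has_vector_derivative_real_field[OF this, of UNIV] show ?thesis
      by (simp add: cis_conv_exp)
  qed
  have "(G 0 has_field_derivative G (Suc 0) (?c \<theta>)) (at (?c \<theta>) within cball 0 1)"
    by (rule smooth_discD[OF assms]) simp
  then have "(G 0 has_field_derivative G (Suc 0) (?c \<theta>)) (at (?c \<theta>) within ?c ` UNIV)"
    by (rule DERIV_subset) auto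
  from field_vector_diff_chain_within[OF c this]
  show ?thesis by (simp add: o_def rot_deriv_def mult_ac)
qed

lemma minus_boundary_derivatives:
  assumes G: "smooth_disc G" and eq: "\<And>u. u \<in> ball 0 1 \<Longrightarrow> G 0 u = disc_minus r f u"
  shows "((\<lambda>g \<theta>. vector_derivative g (at \<theta>)) ^^ k) (minus_boundary r f) =
      (\<lambda>\<theta>. (rot_deriv ^^ k) G 0 (cis (- 2 * \<theta>)))"
proof (induction k)
  case 0
  show ?case using minus_boundary_eq[OF assms] by auto
next
  case (Suc k)
  show ?case
    using smooth_disc_circle_derivative[OF smooth_disc_rot_deriv_funpow[OF G, of k]]
    by (auto simp: Suc.IH vector_derivative_at)
qed

lemma unit_circle_cis:
  assumes "norm (u::complex) = 1"
  obtains \<theta> where "u = cis (- 2 * \<theta>)"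
proof
  have "u \<noteq> 0" using assms by auto
  then show "u = cis (- 2 * (- Arg u / 2))"
    using assms cis_Arg[of u] by (simp add: sgn_eq)
qed

text \<open>Both halves rest on the supremum being finite, which compactness of the closed disc
  provides: a real \<open>SUP\<close> over an unbounded set would carry no information.\<close>

lemma
  assumes G: "smooth_disc G" and eq: "\<And>u. u \<in> ball 0 1 \<Longrightarrow> G 0 u = disc_minus r f u"
  shows minus_seminorm_upper: "norm u = 1 \<Longrightarrow> norm ((rot_deriv ^^ k) G 0 u) \<le> minus_seminorm r k f"
    and minus_seminorm_least: "(\<And>u. norm u = 1 \<Longrightarrow> norm ((rot_deriv ^^ k) G 0 u) \<le> B)
       \<Longrightarrow> minus_seminorm r k f \<le> B"
proof -
  have eq': "minus_seminorm r k f = (SUP \<theta>. norm ((rot_deriv ^^ k) G 0 (cis (- 2 * \<theta>))))"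
    by (simp only: minus_seminorm_def minus_boundary_derivatives[OF assms])
  have "bounded ((rot_deriv ^^ k) G 0 ` cball 0 1)"
    by (intro compact_imp_bounded compact_continuous_image smooth_disc_continuous
        smooth_disc_rot_deriv_funpow G compact_cball)
  then obtain B where "\<forall>x\<in>(rot_deriv ^^ k) G 0 ` cball 0 1. norm x \<le> B"
    unfolding bounded_iff by blast
  then have bdd: "bdd_above (range (\<lambda>\<theta>. norm ((rot_deriv ^^ k) G 0 (cis (- 2 * \<theta>)))))"
    by (intro bdd_aboveI2[of _ _ B]) simp
  show "norm ((rot_deriv ^^ k) G 0 u) \<le> minus_seminorm r k f" if u: "norm u = 1" for u
  proof -
    from unit_circle_cis[OF u] obtain \<theta> where "u = cis (- 2 * \<theta>)" .
    then show ?thesis unfolding eq' using cSUP_upper[OF UNIV_I bdd, of \<theta>] by simp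
  qed
  show "minus_seminorm r k f \<le> B" if "\<And>u. norm u = 1 \<Longrightarrow> norm ((rot_deriv ^^ k) G 0 u) \<le> B" for B
    unfolding eq' by (rule cSUP_least) (auto intro: that)
qed

text \<open>Cauchy's inequality on the unit circle itself, applied to the k-th angular derivative;
  it is available there because that derivative is continuous up to the boundary.\<close>

lemma minus_coeff_seminorm_bound:
  assumes G: "smooth_disc G" and eq: "\<And>u. u \<in> ball 0 1 \<Longrightarrow> G 0 u = disc_minus r f u"
  shows "(2 * real n) ^ k * norm (minus_coeff r f n) \<le> minus_seminorm r k f"
proof -
  let ?H = "(rot_deriv ^^ k) G"
  have H: "smooth_disc ?H" by (rule smooth_disc_rot_deriv_funpow[OF G])
  have "\<forall>\<^sub>F u in nhds 0. G 0 u = disc_minus r f u"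
    by (rule eventually_mono[OF eventually_unit_ball]) (auto simp: eq)
  then have c: "minus_coeff r f n = fps_nth (fps_expansion (G 0) 0) n"
    by (simp add: minus_coeff_def fps_expansion_cong)
  have "norm ((deriv ^^ n) (?H 0) 0) \<le> fact n * minus_seminorm r k f / 1 ^ n"
    by (rule Cauchy_inequality[OF smooth_disc_holomorphic[OF H] smooth_disc_continuous[OF H]])
       (auto intro: minus_seminorm_upper[OF assms])
  then have "norm (fps_nth (fps_expansion (?H 0) 0) n) \<le> minus_seminorm r k f"
    by (simp add: fps_expansion_def norm_divide field_simps)
  then show ?thesis
    by (simp add: fps_expansion_rot_deriv_funpow[OF G] c norm_mult norm_power)
qed

lemma minus_D_inftyE:
  assumes "f \<in> minus_D_infty r"
  obtains G where "smooth_disc G" "\<And>u. u \<in> ball 0 1 \<Longrightarrow> G 0 u = disc_minus r f u"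
  using assms by (auto simp: minus_D_infty_def smooth_disc_def disc_minus_def)

lemma minus_D_inftyI:
  assumes "f holomorphic_on lower_hp" "smooth_disc G" "\<And>u. u \<in> ball 0 1 \<Longrightarrow> G 0 u = disc_minus r f u"
  shows "f \<in> minus_D_infty r"
  unfolding minus_D_infty_def
  using assms by (auto simp: smooth_disc_def disc_minus_def intro!: exI[of _ G])

lemma minus_D_omega_subset: "minus_D_omega r \<subseteq> minus_D_infty r"
proof
  fix f assume f: "f \<in> minus_D_omega r"
  then obtain R F where R: "R > 1" and F: "F holomorphic_on ball 0 R"
    and FD: "\<And>u. u \<in> ball 0 1 \<Longrightarrow> F u = disc_minus r f u"
    unfolding minus_D_omega_def disc_minus_def by auto
  have "smooth_disc (\<lambda>k. (deriv ^^ k) F)"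
    unfolding smooth_disc_def
  proof (intro allI ballI)
    fix k and u :: complex assume "u \<in> cball 0 1"
    then have u: "u \<in> ball 0 R" using R by auto
    have "(deriv ^^ k) F holomorphic_on ball 0 R"
      by (intro holomorphic_higher_deriv F) auto
    then have "((deriv ^^ k) F has_field_derivative deriv ((deriv ^^ k) F) u) (at u)"
      by (rule holomorphic_derivI) (use u in auto)
    then show "((deriv ^^ k) F has_field_derivative (deriv ^^ Suc k) F u) (at u within cball 0 1)"
      by (auto intro: has_field_derivative_at_within)
  qed
  then show "f \<in> minus_D_infty r"
    by (rule minus_D_inftyI[rotated]) (use f FD in \<open>auto simp: minus_D_omega_def\<close>)
qed

lemma disc_minus_diff: "disc_minus r (\<lambda>t. g t - f t) u = disc_minus r g u - disc_minus r f u"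
  by (simp add: disc_minus_def minus_wt_def algebra_simps)

lemma minus_D_infty_diffE:
  assumes "f \<in> minus_D_infty r" "g \<in> minus_D_infty r"
  obtains G where "smooth_disc G" "\<And>u. u \<in> ball 0 1 \<Longrightarrow> G 0 u = disc_minus r (\<lambda>t. g t - f t) u"
proof -
  obtain F where F: "smooth_disc F" "\<And>u. u \<in> ball 0 1 \<Longrightarrow> F 0 u = disc_minus r f u"
    using minus_D_inftyE[OF assms(1)] by blast
  obtain G where G: "smooth_disc G" "\<And>u. u \<in> ball 0 1 \<Longrightarrow> G 0 u = disc_minus r g u"
    using minus_D_inftyE[OF assms(2)] by blast
  show thesis
    by (rule that[OF smooth_disc_diff[OF G(1) F(1)]]) (simp add: F G disc_minus_diff)
qed

lemma minus_coeff_diff: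
  assumes "f holomorphic_on lower_hp" "g holomorphic_on lower_hp"
  shows "minus_coeff r (\<lambda>t. g t - f t) n = minus_coeff r g n - minus_coeff r f n"
proof -
  have F: "disc_minus r f has_fps_expansion fps_expansion (disc_minus r f) 0"
    by (rule has_fps_expansion_fps_expansion[of "ball 0 1"])
       (auto intro: disc_minus_holomorphic assms)
  have G: "disc_minus r g has_fps_expansion fps_expansion (disc_minus r g) 0"
    by (rule has_fps_expansion_fps_expansion[of "ball 0 1"])
       (auto intro: disc_minus_holomorphic assms)
  have "(\<lambda>u. disc_minus r g u - disc_minus r f u) has_fps_expansion
     fps_expansion (disc_minus r g) 0 - fps_expansion (disc_minus r f) 0"
    by (rule has_fps_expansion_diff[OF G F])
  then show ?thesis
    by (simp add: minus_coeff_def fps_expansion_eqI disc_minus_diff[abs_def])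
qed

text \<open>The basic neighbourhoods form a filter base: any two of them contain the one with the
  larger order and the smaller radius.\<close>

lemma eventually_minus_nhds_omega:
  "eventually P (minus_nhds_omega r f) \<longleftrightarrow>
     (\<exists>N. \<exists>e>0. \<forall>g\<in>minus_D_omega r. (\<forall>k\<le>N. minus_seminorm r k (\<lambda>t. g t - f t) < e) \<longrightarrow> P g)"
proof -
  let ?F = "\<lambda>(N, e). principal {g \<in> minus_D_omega r. \<forall>k\<le>N. minus_seminorm r k (\<lambda>t. g t - f t) < e}"
  have "eventually P (minus_nhds_omega r f) \<longleftrightarrow>
     (\<exists>b\<in>(UNIV :: nat set) \<times> {0::real<..}. eventually P (?F b))"
    unfolding minus_nhds_omega_def
  proof (rule eventually_INF_base)
    fix a b :: "nat \<times> real" assume ab: "a \<in> UNIV \<times> {0<..}" "b \<in> UNIV \<times> {0<..}"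
    show "\<exists>x\<in>UNIV \<times> {0<..}. ?F x \<le> inf (?F a) (?F b)"
      by (rule bexI[of _ "(max (fst a) (fst b), min (snd a) (snd b))"])
         (use ab in \<open>auto simp: case_prod_unfold\<close>)
  qed auto
  then show ?thesis by (simp add: eventually_principal Bex_def Ball_def) blast
qed

section \<open>Polynomial growth of the coefficients of \<open>h^+\<close>, rapid decay of those of
  \<open>f^-\<close>\<close>

lemma disc_plus_bound:
  assumes "h \<in> plus_D_minus_infty r"
  obtains K M where "K \<ge> 0"
    "\<And>w. norm w < 1 \<Longrightarrow> norm (disc_plus r h w) \<le> K * (1 / (1 - norm w)) ^ M"
proof -
  from assms obtain B K where B: "B > 0"
    and K: "\<And>z. z \<in> upper_hp \<Longrightarrow> norm (plus_wt r h z) \<le> K * (Im z powr (- B) + norm z powr B)"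
    unfolding plus_D_minus_infty_def by blast
  define M where "M = nat \<lceil>B\<rceil>"
  have M: "B \<le> real M" unfolding M_def by linarith
  show thesis
  proof (rule that[of "\<bar>K\<bar> * (2 * 4 ^ M)" M])
    fix w :: complex assume w: "norm w < 1"
    define x where "x = 1 - norm w"
    have x: "0 < x" "x \<le> 1" using w by (auto simp: x_def)
    define z where "z = upper_of_w w"
    have z: "z \<in> upper_hp" "Im z > 0" using upper_of_w_in[OF w] by (auto simp: z_def upper_hp_def)
    have w1: "w \<noteq> 1" using w by auto
    have n1: "norm (1 - w) \<le> 2" using norm_triangle_ineq4[of 1 w] w by simp
    have n2: "norm (1 + w) \<le> 2" using norm_triangle_ineq[of 1 w] w by simp
    have n3: "x \<le> norm (1 - w)" unfolding x_def using norm_triangle_ineq2[of 1 w] by simp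
    \<comment> \<open>The numerator \<open>1 - |w|^2\<close> is at least \<open>x\<close> and
      \<open>|1 - w|^2\<close> is at most 4. Together with \<open>norm z \<le> 4 / x\<close> this
      reduces both growth terms to the same power of \<open>4 / x\<close>.\<close>
    have "x / 4 \<le> Im z"
    proof -
      have "x / 4 \<le> (1 - (norm w)\<^sup>2) / 4"
        unfolding x_def using w by (simp add: power2_eq_square mult_left_le)
      also have "\<dots> \<le> (1 - (norm w)\<^sup>2) / (norm (1 - w))\<^sup>2"
      proof (rule divide_left_mono)
        show "(norm (1 - w))\<^sup>2 \<le> 4" using power_mono[OF n1, of 2] by simp
        show "0 \<le> 1 - (norm w)\<^sup>2" using w by (simp add: power_le_one)
        show "0 < 4 * (norm (1 - w))\<^sup>2" using w1 by simp
      qed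
      also have "\<dots> = Im z" unfolding z_def by (rule Im_upper_of_w[OF w1, symmetric])
      finally show ?thesis .
    qed
    then have i: "Im z powr (- B) \<le> (4 / x) powr B"
    proof -
      have "Im z powr (- B) \<le> (x / 4) powr (- B)"
        using \<open>x / 4 \<le> Im z\<close> x B by (intro powr_mono2') auto
      also have "\<dots> = (4 / x) powr B"
        using x by (simp add: powr_minus_divide powr_divide)
      finally show ?thesis .
    qed
    have "norm z = norm (1 + w) / norm (1 - w)"
      by (simp add: z_def upper_of_w_def norm_mult norm_divide)
    also have "\<dots> \<le> 4 / x"
      using x n2 n3 by (intro frac_le) auto
    finally have ii: "norm z powr B \<le> (4 / x) powr B"
      using B by (intro powr_mono2) auto
    have iii: "(4 / x) powr B \<le> (4 / x) ^ M"
    proof -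
      have "(4 / x) powr B \<le> (4 / x) powr real M" using x M by (intro powr_mono) auto
      also have "\<dots> = (4 / x) ^ M" using x by (simp add: powr_realpow)
      finally show ?thesis .
    qed
    have "norm (disc_plus r h w) \<le> K * (Im z powr (- B) + norm z powr B)"
      using K[OF z(1)] by (simp add: disc_plus_def z_def)
    also have "\<dots> \<le> \<bar>K\<bar> * (Im z powr (- B) + norm z powr B)"
      by (intro mult_right_mono) auto
    also have "\<dots> \<le> \<bar>K\<bar> * ((4 / x) ^ M + (4 / x) ^ M)"
      by (intro mult_left_mono add_mono) (use i ii iii in auto)
    also have "\<dots> = \<bar>K\<bar> * (2 * 4 ^ M) * (1 / (1 - norm w)) ^ M"
      by (simp add: power_divide x_def)
    finally show "norm (disc_plus r h w) \<le> \<bar>K\<bar> * (2 * 4 ^ M) * (1 / (1 - norm w)) ^ M" .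
  qed auto
qed

lemma plus_coeff_bound:
  assumes "h \<in> plus_D_minus_infty r"
  obtains K M where "K \<ge> 0" "\<And>n. norm (plus_coeff r h n) \<le> K * (real n + 1) ^ M"
proof -
  obtain K M where K: "K \<ge> 0"
    and b: "\<And>w. norm w < 1 \<Longrightarrow> norm (disc_plus r h w) \<le> K * (1 / (1 - norm w)) ^ M"
    using disc_plus_bound[OF assms] by blast
  have hol: "disc_plus r h holomorphic_on ball 0 1"
    using assms by (intro disc_plus_holomorphic) (auto simp: plus_D_minus_infty_def)
  show thesis
  proof (rule that[of "K * 2 ^ M * exp 1" M])
    fix n :: nat
    \<comment> \<open>The radius of the Cauchy estimate moves out with \<open>n\<close>: as
      \<open>1 / (1 - \<rho>) = n + 2\<close>, the maximum on the circle stays polynomial in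
      \<open>n\<close>, while \<open>(1 / \<rho>) ^ n\<close> stays below
      \<open>exp 1\<close>.\<close>
    define \<rho> where "\<rho> = (real n + 1) / (real n + 2)"
    have \<rho>: "0 < \<rho>" "\<rho> < 1" by (auto simp: \<rho>_def)
    have \<rho>1: "1 / (1 - \<rho>) = real n + 2" by (simp add: \<rho>_def field_simps)
    have \<rho>2: "1 / \<rho> = 1 + 1 / real (Suc n)" by (simp add: \<rho>_def field_simps)
    have cb: "cball 0 \<rho> \<subseteq> ball (0::complex) 1" using \<rho> by auto
    have "norm ((deriv ^^ n) (disc_plus r h) 0) \<le> fact n * (K * (real n + 2) ^ M) / \<rho> ^ n"
    proof (rule Cauchy_inequality)
      show "disc_plus r h holomorphic_on ball 0 \<rho>"
        by (rule holomorphic_on_subset[OF hol]) (use \<rho> in auto)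
      show "continuous_on (cball 0 \<rho>) (disc_plus r h)"
        using hol cb by (meson holomorphic_on_imp_continuous_on continuous_on_subset)
      fix x :: complex assume "norm (0 - x) = \<rho>"
      then show "norm (disc_plus r h x) \<le> K * (real n + 2) ^ M"
        using b[of x] \<rho> \<rho>1 by simp
    qed (use \<rho> in auto)
    then have "norm (plus_coeff r h n) \<le> K * (real n + 2) ^ M * (1 / \<rho>) ^ n"
      by (simp add: plus_coeff_def fps_expansion_def norm_divide power_one_over field_simps)
    also have "\<dots> \<le> K * (2 ^ M * (real n + 1) ^ M) * exp 1"
    proof (intro mult_mono mult_left_mono)
      have "(real n + 2) ^ M \<le> (2 * (real n + 1)) ^ M" by (intro power_mono) auto
      then show "(real n + 2) ^ M \<le> 2 ^ M * (real n + 1) ^ M" by (simp only: power_mult_distrib)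
      have "(1 / \<rho>) ^ n \<le> (1 / \<rho>) ^ Suc n" using \<rho> by (intro power_increasing) auto
      also have "\<dots> \<le> exp 1"
        unfolding \<rho>2 by (rule exp_ge_one_plus_x_over_n_power_n) auto
      finally show "(1 / \<rho>) ^ n \<le> exp 1" .
    qed (use K \<rho> in auto)
    finally show "norm (plus_coeff r h n) \<le> K * 2 ^ M * exp 1 * (real n + 1) ^ M"
      by (simp add: mult_ac)
  qed (use K in auto)
qed

text \<open>For \<open>n \<ge> 1\<close> one has \<open>n + 1 \<le> 2 * n\<close>. At
  \<open>n = 0\<close> the power of \<open>2 * n\<close> may vanish, and the seminorm of order 0
  takes over.\<close>

lemma minus_coeff_decay:
  assumes G: "smooth_disc G" and eq: "\<And>u. u \<in> ball 0 1 \<Longrightarrow> G 0 u = disc_minus r f u"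
  shows "(real n + 1) ^ k * norm (minus_coeff r f n) \<le> minus_seminorm r 0 f + minus_seminorm r k f"
proof -
  have 0: "0 \<le> minus_seminorm r j f" for j
    by (rule order_trans[OF norm_ge_zero minus_seminorm_upper[OF assms, of 1 j]]) simp_all
  show ?thesis
  proof (cases "n = 0")
    case True
    then show ?thesis
      using minus_coeff_seminorm_bound[OF assms, of n 0] 0[of k] by simp
  next
    case False
    then have "(real n + 1) ^ k \<le> (2 * real n) ^ k" by (intro power_mono) auto
    then have "(real n + 1) ^ k * norm (minus_coeff r f n) \<le> (2 * real n) ^ k * norm (minus_coeff r f n)"
      by (rule mult_right_mono) auto
    then show ?thesis
      using minus_coeff_seminorm_bound[OF assms, of n k] 0[of 0] by simp
  qed
qed

section \<open>Continuity of the form and its extension to \<open>minus_D_infty\<close>\<close>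

lemma summable_inverse_Suc_squares: "summable (\<lambda>n. 1 / (real n + 1) ^ 2)"
  using summable_Suc_iff[of "\<lambda>n. inverse (real n ^ 2)"] inverse_power_summable[of 2, where 'a = real]
  by (simp add: field_simps)

text \<open>Entry \<open>k\<close> is the k-th derivative of \<open>u\<close> \<mapsto>
  \<open>G 0 (l * u)\<close>; hence the power of \<open>l\<close>.\<close>

definition dilate_disc :: "real \<Rightarrow> (nat \<Rightarrow> complex \<Rightarrow> complex) \<Rightarrow> nat \<Rightarrow> complex \<Rightarrow> complex" where
  "dilate_disc l G k u = of_real l ^ k * G k (of_real l * u)"

lemma rot_deriv_dilate: "rot_deriv (dilate_disc l G) = dilate_disc l (rot_deriv G)"
  by (auto simp: rot_deriv_def dilate_disc_def fun_eq_iff algebra_simps)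

lemma rot_deriv_funpow_dilate: "(rot_deriv ^^ k) (dilate_disc l G) = dilate_disc l ((rot_deriv ^^ k) G)"
  by (induction k) (auto simp: rot_deriv_dilate)

lemma rot_deriv_funpow_diff:
  "(rot_deriv ^^ k) (\<lambda>j u. F j u - G j u) = (\<lambda>j u. (rot_deriv ^^ k) F j u - (rot_deriv ^^ k) G j u)"
proof (induction k)
  case (Suc k)
  have "rot_deriv (\<lambda>j u. F j u - G j u) = (\<lambda>j u. rot_deriv F j u - rot_deriv G j u)" for F G
    by (auto simp: rot_deriv_def fun_eq_iff algebra_simps)
  then show ?case by (simp add: Suc.IH)
qed simp

lemma smooth_disc_dilate:
  assumes G: "smooth_disc G" and l: "0 < l" "l \<le> 1"
  shows "smooth_disc (dilate_disc l G)"
  unfolding smooth_disc_def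
proof (intro allI ballI)
  fix k and u :: complex assume u: "u \<in> cball 0 1"
  have lu: "of_real l * x \<in> cball 0 1" if "x \<in> cball 0 1" for x :: complex
    using that l by (auto simp: norm_mult intro: mult_le_one)
  have "((\<lambda>x. of_real l * x) has_field_derivative of_real l) (at u within cball 0 1)"
    by (auto intro!: derivative_eq_intros)
  moreover have "(G k has_field_derivative G (Suc k) (of_real l * u))
      (at (of_real l * u) within (\<lambda>x. of_real l * x) ` cball 0 1)"
    by (rule DERIV_subset[OF smooth_discD[OF G lu[OF u]]]) (use lu in auto)
  ultimately have "(G k \<circ> (\<lambda>x. of_real l * x) has_field_derivative
      G (Suc k) (of_real l * u) * of_real l) (at u within cball 0 1)"
    by (rule DERIV_image_chain[rotated])
  from DERIV_cmult[OF this, of "of_real l ^ k"]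
  show "(dilate_disc l G k has_field_derivative dilate_disc l G (Suc k) u) (at u within cball 0 1)"
    by (simp add: dilate_disc_def[abs_def] o_def mult_ac)
qed

lemma norm_lower_to_disc:
  assumes "t \<in> lower_hp"
  shows "norm ((t + \<i>) / (t - \<i>)) < 1" "lower_of_u ((t + \<i>) / (t - \<i>)) = t"
proof -
  have t: "Im t < 0" using assms by (simp add: lower_hp_def)
  then have ne: "t - \<i> \<noteq> 0" by auto
  have "(norm (t + \<i>))\<^sup>2 < (norm (t - \<i>))\<^sup>2"
    using t unfolding cmod_power2 by (simp add: power2_eq_square algebra_simps)
  then have "norm (t + \<i>) < norm (t - \<i>)" by (rule power2_less_imp_less) auto
  then show "norm ((t + \<i>) / (t - \<i>)) < 1" using ne by (simp add: norm_divide)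
  have "1 + (t + \<i>) / (t - \<i>) = 2 * t / (t - \<i>)" "1 - (t + \<i>) / (t - \<i>) = - 2 * \<i> / (t - \<i>)"
    using ne by (auto simp: field_simps)
  then show "lower_of_u ((t + \<i>) / (t - \<i>)) = t"
    using ne by (simp add: lower_of_u_def)
qed

lemma lower_hp_weight_nonzero: "t \<in> lower_hp \<Longrightarrow> \<i> - t \<noteq> 0"
  by (auto simp: lower_hp_def)

lemma lower_of_u_inverse:
  assumes "norm u < 1"
  shows "(lower_of_u u + \<i>) / (lower_of_u u - \<i>) = u"
proof -
  have "1 - u \<noteq> 0" using assms by auto
  then have "lower_of_u u + \<i> = - 2 * \<i> * u / (1 - u)" "lower_of_u u - \<i> = - 2 * \<i> / (1 - u)"
    by (auto simp: lower_of_u_def field_simps)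
  then show ?thesis using \<open>1 - u \<noteq> 0\<close> by simp
qed

text \<open>The dilations $f^-(\lambda u)$, $\lambda \to 1$, show that the limit defining the bracket is not vacuous.\<close>
lemma minus_nhds_omega_neq_bot:
  assumes f: "f \<in> minus_D_infty r"
  shows "minus_nhds_omega r f \<noteq> bot"
proof -
  obtain G where G: "smooth_disc G" and eq: "\<And>u. u \<in> ball 0 1 \<Longrightarrow> G 0 u = disc_minus r f u"
    using minus_D_inftyE[OF f] by blast
  have "\<exists>g\<in>minus_D_omega r. \<forall>k\<le>N. minus_seminorm r k (\<lambda>t. g t - f t) < e" if e: "e > 0" for N e
  proof -
    have "\<exists>d>0. \<forall>l. 1 - d < l \<and> 0 < l \<and> l < 1 \<longrightarrow>
       (\<forall>u. norm u = 1 \<longrightarrow> norm ((rot_deriv ^^ k) G 0 (of_real l * u) - (rot_deriv ^^ k) G 0 u) < e / 2)" for k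
    proof -
      have "uniformly_continuous_on (cball 0 1) ((rot_deriv ^^ k) G 0)"
        by (intro compact_uniformly_continuous smooth_disc_continuous
            smooth_disc_rot_deriv_funpow G compact_cball)
      then obtain d where d: "d > 0"
        "\<And>x y. x \<in> cball 0 1 \<Longrightarrow> y \<in> cball 0 1 \<Longrightarrow> dist y x < d
          \<Longrightarrow> dist ((rot_deriv ^^ k) G 0 y) ((rot_deriv ^^ k) G 0 x) < e / 2"
        unfolding uniformly_continuous_on_def using e half_gt_zero by metis
      show ?thesis
      proof (intro exI[of _ d] conjI allI impI d)
        fix l and u :: complex
        assume l: "1 - d < l \<and> 0 < l \<and> l < 1" and u: "norm u = 1"
        have "of_real l * u - u = of_real (l - 1) * u" by (simp add: algebra_simps)
        then have "norm (of_real l * u - u) = 1 - l"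
          using l u by (simp only: norm_mult norm_of_real) simp
        then show "norm ((rot_deriv ^^ k) G 0 (of_real l * u) - (rot_deriv ^^ k) G 0 u) < e / 2"
          using d(2)[of u "of_real l * u"] l u by (simp add: dist_norm norm_mult)
      qed
    qed
    then obtain d where d: "\<And>k. d k > 0"
      "\<And>k l u. 1 - d k < l \<Longrightarrow> 0 < l \<Longrightarrow> l < 1 \<Longrightarrow> norm u = 1 \<Longrightarrow>
         norm ((rot_deriv ^^ k) G 0 (of_real l * u) - (rot_deriv ^^ k) G 0 u) < e / 2"
      by metis
    \<comment> \<open>A neighbourhood constrains only the finitely many orders up to
      \<open>N\<close>, so a common \<open>m\<close> exists. Inserting 1 keeps
      \<open>l = 1 - m / 2\<close> positive.\<close>
    define m where "m = Min (insert 1 (d ` {..N}))"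
    have m: "m > 0" "m \<le> 1" "\<And>k. k \<le> N \<Longrightarrow> m \<le> d k"
    proof -
      show "m > 0" "m \<le> 1" unfolding m_def using d(1) by (auto intro: Min_le)
      show "m \<le> d k" if "k \<le> N" for k unfolding m_def using that by (intro Min_le) auto
    qed
    define l where "l = 1 - m / 2"
    have l: "0 < l" "l < 1" "\<And>k. k \<le> N \<Longrightarrow> 1 - d k < l"
    proof -
      show "0 < l" "l < 1" using m(1,2) by (auto simp: l_def)
      show "1 - d k < l" if "k \<le> N" for k using m(3)[OF that] m(1) by (simp add: l_def)
    qed
    \<comment> \<open>The weight is divided out so that \<open>g^-\<close> is
      \<open>G 0 (l * u)\<close> in the disc coordinate, which is holomorphic for
      \<open>|u| < 1 / l\<close> and thus beyond the closed disc.\<close>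
    define g where "g = (\<lambda>t. (\<i> - t) powr (- of_real r) * G 0 (of_real l * ((t + \<i>) / (t - \<i>))))"
    have lin: "of_real l * u \<in> ball 0 1" if "norm u < 1 / l" for u :: complex
      using that l by (simp add: norm_mult field_simps)
    have one: "1 < 1 / l" using l by simp
    have disc: "disc_minus r g u = G 0 (of_real l * u)" if u: "u \<in> ball 0 1" for u
    proof -
      have "\<i> - lower_of_u u \<noteq> 0"
        using lower_of_u_in[of u] u by (intro lower_hp_weight_nonzero) auto
      moreover have "(lower_of_u u + \<i>) / (lower_of_u u - \<i>) = u"
        using u by (intro lower_of_u_inverse) simp
      ultimately show ?thesis
        unfolding disc_minus_def minus_wt_def g_def by (simp add: powr_minus)
    qed
    have hol: "g holomorphic_on lower_hp"
    proof -
      have "(G 0 \<circ> (\<lambda>t. of_real l * ((t + \<i>) / (t - \<i>)))) holomorphic_on lower_hp"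
      proof (rule holomorphic_on_compose_gen[OF _ smooth_disc_holomorphic[OF G]])
        show "(\<lambda>t. of_real l * ((t + \<i>) / (t - \<i>))) holomorphic_on lower_hp"
          by (intro holomorphic_intros) (auto simp: lower_hp_def)
        show "(\<lambda>t. of_real l * ((t + \<i>) / (t - \<i>))) ` lower_hp \<subseteq> ball 0 1"
          using norm_lower_to_disc(1) one by (intro image_subsetI lin) fastforce
      qed
      then show ?thesis
        unfolding g_def by (intro holomorphic_intros)
          (auto simp: o_def lower_hp_def complex_nonpos_Reals_iff)
    qed
    have "(G 0 \<circ> (\<lambda>u. of_real l * u)) holomorphic_on ball 0 (1 / l)"
      by (rule holomorphic_on_compose_gen[OF _ smooth_disc_holomorphic[OF G]])
         (use lin in \<open>auto intro!: holomorphic_intros\<close>)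
    then have gom: "g \<in> minus_D_omega r"
      using hol one disc
      by (auto simp: minus_D_omega_def o_def disc_minus_def
          intro!: exI[of _ "1 / l"] exI[of _ "\<lambda>u. G 0 (of_real l * u)"])
    define D where "D = (\<lambda>j u. dilate_disc l G j u - G j u)"
    have D: "smooth_disc D"
      unfolding D_def using l by (intro smooth_disc_diff smooth_disc_dilate G) auto
    have D0: "D 0 u = disc_minus r (\<lambda>t. g t - f t) u" if "u \<in> ball 0 1" for u
      using that by (simp add: D_def disc_minus_diff disc eq dilate_disc_def)
    have "minus_seminorm r k (\<lambda>t. g t - f t) < e" if "k \<le> N" for k
    proof -
      have "minus_seminorm r k (\<lambda>t. g t - f t) \<le> e / 2"
      proof (rule minus_seminorm_least[OF D D0])
        fix u :: complex assume "norm u = 1"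
        then have "norm ((rot_deriv ^^ k) G 0 (of_real l * u) - (rot_deriv ^^ k) G 0 u) < e / 2"
          using d(2)[of k l u] l that by simp
        moreover have "(rot_deriv ^^ k) D 0 u = (rot_deriv ^^ k) G 0 (of_real l * u) - (rot_deriv ^^ k) G 0 u"
          unfolding D_def rot_deriv_funpow_diff rot_deriv_funpow_dilate by (simp add: dilate_disc_def)
        ultimately show "norm ((rot_deriv ^^ k) D 0 u) \<le> e / 2" by simp
      qed
      then show ?thesis using e by simp
    qed
    with gom show ?thesis by blast
  qed
  then have "\<not> eventually (\<lambda>_. False) (minus_nhds_omega r f)"
    unfolding eventually_minus_nhds_omega by blast
  then show ?thesis by (simp add: eventually_False)
qed

text \<open>As a function of \<open>f\<close> the series is Lipschitz for the seminorms of orders 0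
  and \<open>k\<close>, and on \<open>minus_D_omega\<close> it agrees with
  \<open>bracket_omega\<close>; so it is the limit by which the extension is defined.\<close>

theorem bracket_sums:
  assumes r: "r > 0" and h: "h \<in> plus_D_minus_infty r" and f: "f \<in> minus_D_infty r"
  shows "(\<lambda>n. of_real (fact n / pochhammer r n) * plus_coeff r h n * minus_coeff r f n)
           sums bracket r h f"
proof -
  obtain K M where K: "K \<ge> 0" and c: "\<And>n. norm (plus_coeff r h n) \<le> K * (real n + 1) ^ M"
    using plus_coeff_bound[OF h] by blast
  define A where "A n = of_real (fact n / pochhammer r n) * plus_coeff r h n" for n
  define C where "C = (1 + 1 / r) * K"
  have C: "C \<ge> 0" using K r by (simp add: C_def)
  have A: "norm (A n) \<le> C * (real n + 1) ^ Suc M" for n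
  proof -
    have pp: "fact n / pochhammer r n \<ge> 0"
      using pochhammer_pos[OF r, of n] by simp
    have "norm (A n) = fact n / pochhammer r n * norm (plus_coeff r h n)"
      using pp by (simp only: A_def norm_mult norm_of_real abs_of_nonneg)
    also have "\<dots> \<le> ((1 + 1 / r) * (real n + 1)) * (K * (real n + 1) ^ M)"
      using r by (intro mult_mono c fact_over_pochhammer_le) auto
    finally show ?thesis by (simp add: C_def mult_ac)
  qed
  \<comment> \<open>\<open>A n\<close> grows at most like \<open>(n + 1) ^ Suc M\<close>; the two
    further powers leave the summable \<open>1 / (n + 1) ^ 2\<close>.\<close>
  define k where "k = Suc M + 2"
  define Z where "Z = (\<Sum>n. 1 / (real n + 1) ^ 2)"
  have Z: "Z \<ge> 0" unfolding Z_def by (rule suminf_nonneg[OF summable_inverse_Suc_squares]) auto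
  have trm: "norm (A n * minus_coeff r F n) \<le>
      C * (minus_seminorm r 0 F + minus_seminorm r k F) * (1 / (real n + 1) ^ 2)"
    if "smooth_disc G" "\<And>u. u \<in> ball 0 1 \<Longrightarrow> G 0 u = disc_minus r F u" for G F n
  proof -
    have "norm (A n * minus_coeff r F n) \<le> (C * (real n + 1) ^ Suc M) * norm (minus_coeff r F n)"
      unfolding norm_mult by (intro mult_right_mono A) auto
    also have "\<dots> = C * ((real n + 1) ^ k * norm (minus_coeff r F n)) * (1 / (real n + 1) ^ 2)"
    proof -
      have "(real n + 1) ^ Suc M = (real n + 1) ^ k * (1 / (real n + 1) ^ 2)"
        unfolding k_def power_add by simp
      then show ?thesis by (simp only: mult_ac)
    qed
    also have "\<dots> \<le> C * (minus_seminorm r 0 F + minus_seminorm r k F) * (1 / (real n + 1) ^ 2)"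
      using C by (intro mult_right_mono mult_left_mono minus_coeff_decay[OF that]) auto
    finally show ?thesis .
  qed
  have summ: "summable (\<lambda>n. A n * minus_coeff r F n)" if F: "F \<in> minus_D_infty r" for F
  proof -
    obtain G where G: "smooth_disc G" "\<And>u. u \<in> ball 0 1 \<Longrightarrow> G 0 u = disc_minus r F u"
      using minus_D_inftyE[OF F] by blast
    show ?thesis
      by (rule summable_comparison_test'[OF _ trm[OF G]])
         (intro summable_mult summable_inverse_Suc_squares)
  qed
  define L where "L = (\<Sum>n. A n * minus_coeff r f n)"
  have "(bracket_omega r h \<longlongrightarrow> L) (minus_nhds_omega r f)"
  proof (rule tendstoI)
    fix e :: real assume e: "e > 0"
    \<comment> \<open>The 2 accounts for the two seminorms, and the summand 1 avoids division by
      zero if \<open>C * Z = 0\<close>.\<close>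
    define d where "d = e / (2 * (C * Z + 1))"
    have CZ: "C * Z \<ge> 0" using C Z by simp
    then have d: "d > 0" using e by (simp add: d_def)
    show "\<forall>\<^sub>F g in minus_nhds_omega r f. dist (bracket_omega r h g) L < e"
      unfolding eventually_minus_nhds_omega
    proof (intro exI[of _ k] exI[of _ d] conjI d ballI impI)
      fix g assume g: "g \<in> minus_D_omega r"
        and small: "\<forall>j\<le>k. minus_seminorm r j (\<lambda>t. g t - f t) < d"
      have g': "g \<in> minus_D_infty r" using g minus_D_omega_subset by auto
      obtain G where G: "smooth_disc G" "\<And>u. u \<in> ball 0 1 \<Longrightarrow> G 0 u = disc_minus r (\<lambda>t. g t - f t) u"
        using minus_D_infty_diffE[OF f g'] by blast
      have hol: "f holomorphic_on lower_hp" "g holomorphic_on lower_hp"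
        using f g' by (auto simp: minus_D_infty_def)
      have hh: "h holomorphic_on upper_hp" using h by (simp add: plus_D_minus_infty_def)
      have "bracket_omega r h g = (\<Sum>n. A n * minus_coeff r g n)"
        using bracket_omega_sums[OF r hh g] by (simp add: A_def sums_iff)
      then have "bracket_omega r h g - L = (\<Sum>n. A n * minus_coeff r g n - A n * minus_coeff r f n)"
        unfolding L_def by (simp add: suminf_diff summ g' f)
      also have "\<dots> = (\<Sum>n. A n * minus_coeff r (\<lambda>t. g t - f t) n)"
        by (simp add: minus_coeff_diff[OF hol] algebra_simps)
      finally have "norm (bracket_omega r h g - L) = norm (\<Sum>n. A n * minus_coeff r (\<lambda>t. g t - f t) n)"
        by simp
      also have "\<dots> \<le> (\<Sum>n. C * (minus_seminorm r 0 (\<lambda>t. g t - f t) + minus_seminorm r k (\<lambda>t. g t - f t))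
           * (1 / (real n + 1) ^ 2))"
        by (intro norm_suminf_le trm[OF G] summable_mult summable_inverse_Suc_squares)
      also have "\<dots> = C * Z * (minus_seminorm r 0 (\<lambda>t. g t - f t) + minus_seminorm r k (\<lambda>t. g t - f t))"
        unfolding Z_def by (subst suminf_mult[OF summable_inverse_Suc_squares]) simp
      also have "\<dots> \<le> C * Z * (d + d)"
        using small CZ by (intro mult_left_mono add_mono) (auto intro: less_imp_le)
      also have "\<dots> < (C * Z + 1) * (d + d)" using d by simp
      also have "\<dots> = e"
      proof -
        have "y * (e / (2 * y) + e / (2 * y)) = e" if "y \<noteq> 0" for y
          using that by (simp add: field_simps)
        from this[of "C * Z + 1"] show ?thesis using CZ unfolding d_def by simp
      qed
      finally show "dist (bracket_omega r h g) L < e" by (simp add: dist_norm)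
    qed
  qed
  then have "bracket r h f = L"
    using h f by (simp add: bracket_def tendsto_Lim[OF minus_nhds_omega_neq_bot[OF f]])
  then show ?thesis
    using summable_sums[OF summ[OF f]] by (simp add: A_def L_def)
qed

section \<open>Power series with rapidly decaying coefficients\<close>

lemma power_series_boundary_derivative:
  fixes d :: "nat \<Rightarrow> complex"
  assumes d: "\<And>k. summable (\<lambda>n. (real n + 1) ^ k * norm (d n))" and u: "u \<in> cball 0 1"
  shows "((\<lambda>u. \<Sum>n. d n * u ^ n) has_field_derivative (\<Sum>n. diffs d n * u ^ n)) (at u within cball 0 1)"
proof -
  let ?S = "cball 0 1 :: complex set"
  have bound: "norm (d n * (of_nat n * x ^ (n - 1))) \<le> (real n + 1) ^ 1 * norm (d n)" if "x \<in> ?S" for n x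
  proof -
    have "norm x ^ (n - 1) \<le> 1" using that by (intro power_le_one) auto
    then have "norm (d n) * (real n * norm x ^ (n - 1)) \<le> norm (d n) * ((real n + 1) * 1)"
      by (intro mult_left_mono mult_mono) auto
    then show ?thesis by (simp add: norm_mult norm_power mult_ac)
  qed
  \<comment> \<open>The differentiated series converges uniformly on the closed disc, so
    differentiation term by term is also valid at boundary points, relative to the disc.\<close>
  have ul: "uniform_limit ?S (\<lambda>N x. \<Sum>n<N. d n * (of_nat n * x ^ (n - 1)))
      (\<lambda>x. \<Sum>n. d n * (of_nat n * x ^ (n - 1))) sequentially"
    by (rule Weierstrass_m_test[OF bound d[of 1]])
  have "\<exists>g. \<forall>x\<in>?S. (\<lambda>n. d n * x ^ n) sums g x \<and>
      (g has_field_derivative (\<Sum>n. d n * (of_nat n * x ^ (n - 1)))) (at x within ?S)"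
    by (rule has_field_derivative_series[OF convex_cball _ ul, where ?x0.0 = 0])
       (auto intro!: derivative_eq_intros)
  then obtain g where g: "\<And>x. x \<in> ?S \<Longrightarrow> (\<lambda>n. d n * x ^ n) sums g x"
    "\<And>x. x \<in> ?S \<Longrightarrow> (g has_field_derivative (\<Sum>n. d n * (of_nat n * x ^ (n - 1)))) (at x within ?S)"
    by blast
  have "summable (\<lambda>n. norm (d n * (of_nat n * u ^ (n - 1))))"
    by (rule summable_comparison_test'[OF d[of 1]]) (use bound[OF u] in simp)
  then have "summable (\<lambda>n. d n * (of_nat n * u ^ (n - 1)))" by (rule summable_norm_cancel)
  from suminf_split_head[OF this]
  have e: "(\<Sum>n. d n * (of_nat n * u ^ (n - 1))) = (\<Sum>n. diffs d n * u ^ n)"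
    by (simp add: diffs_def mult_ac)
  have "((\<lambda>u. \<Sum>n. d n * u ^ n) has_field_derivative (\<Sum>n. d n * (of_nat n * u ^ (n - 1)))) (at u within ?S)"
    by (rule has_field_derivative_transform_within[OF g(2)[OF u] zero_less_one u]) (use g(1) in \<open>auto simp: sums_iff\<close>)
  then show ?thesis unfolding e .
qed

text \<open>\<open>diffs d n\<close> is \<open>(n + 1) * d (n + 1)\<close>, so a derivative costs
  one power of the weight. As all powers are assumed, the hypothesis reproduces itself and
  derivatives of every order follow.\<close>

lemma summable_diffs_weighted:
  fixes d :: "nat \<Rightarrow> complex"
  assumes d: "\<And>k. summable (\<lambda>n. (real n + 1) ^ k * norm (d n))"
  shows "summable (\<lambda>n. (real n + 1) ^ k * norm (diffs d n))"
proof (rule summable_comparison_test')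
  show "summable (\<lambda>n. (real (Suc n) + 1) ^ Suc k * norm (d (Suc n)))"
    using d[of "Suc k"] by (subst summable_Suc_iff)
  fix n
  have "(real n + 1) ^ k * norm (diffs d n) = (real n + 1) ^ Suc k * norm (d (Suc n))"
    by (simp add: diffs_def norm_mult add_ac)
       (metis (no_types) add.commute norm_of_nat of_nat_Suc)
  also have "\<dots> \<le> (real (Suc n) + 1) ^ Suc k * norm (d (Suc n))"
    by (intro mult_right_mono power_mono) auto
  finally show "norm ((real n + 1) ^ k * norm (diffs d n)) \<le> (real (Suc n) + 1) ^ Suc k * norm (d (Suc n))"
    by simp
qed

lemma smooth_disc_power_series:
  fixes d :: "nat \<Rightarrow> complex"
  assumes d: "\<And>k. summable (\<lambda>n. (real n + 1) ^ k * norm (d n))"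
  shows "smooth_disc (\<lambda>k u. \<Sum>n. (diffs ^^ k) d n * u ^ n)"
proof -
  have "summable (\<lambda>n. (real n + 1) ^ j * norm ((diffs ^^ k) d n))" for j k
    by (induction k arbitrary: j) (auto intro: d summable_diffs_weighted)
  from power_series_boundary_derivative[OF this] show ?thesis
    by (auto simp: smooth_disc_def)
qed

lemma disc_minus_imp_holomorphic:
  assumes "disc_minus r f holomorphic_on ball 0 1"
  shows "f holomorphic_on lower_hp"
proof -
  have "(disc_minus r f \<circ> (\<lambda>t. (t + \<i>) / (t - \<i>))) holomorphic_on lower_hp"
  proof (rule holomorphic_on_compose_gen[OF _ assms])
    show "(\<lambda>t. (t + \<i>) / (t - \<i>)) holomorphic_on lower_hp"
      by (intro holomorphic_intros) (auto simp: lower_hp_def)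
  qed (use norm_lower_to_disc(1) in auto)
  then have *: "(\<lambda>t. disc_minus r f ((t + \<i>) / (t - \<i>))) holomorphic_on lower_hp"
    by (simp add: o_def)
  have "(\<lambda>t. (\<i> - t) powr (- of_real r) * disc_minus r f ((t + \<i>) / (t - \<i>))) holomorphic_on lower_hp"
    by (intro holomorphic_on_mult[OF _ *] holomorphic_intros)
       (auto simp: lower_hp_def complex_nonpos_Reals_iff)
  then show ?thesis
  proof (rule holomorphic_transform)
    fix t assume "t \<in> lower_hp"
    then show "(\<i> - t) powr (- of_real r) * disc_minus r f ((t + \<i>) / (t - \<i>)) = f t"
      using norm_lower_to_disc(2)[of t] lower_hp_weight_nonzero[of t]
      by (simp add: disc_minus_def minus_wt_def powr_minus)
  qed
qed

text \<open>The membership criterion for superpositions of kernels, where the coefficients are what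
  can be estimated.\<close>

lemma minus_D_infty_power_series:
  fixes d :: "nat \<Rightarrow> complex"
  assumes d: "\<And>k. summable (\<lambda>n. (real n + 1) ^ k * norm (d n))"
    and s: "\<And>u. u \<in> ball 0 1 \<Longrightarrow> (\<lambda>n. d n * u ^ n) sums disc_minus r f u"
  shows "f \<in> minus_D_infty r" "minus_coeff r f n = d n"
proof -
  let ?G = "\<lambda>k u. \<Sum>n. (diffs ^^ k) d n * u ^ n"
  have G: "smooth_disc ?G" by (rule smooth_disc_power_series[OF d])
  have eq: "?G 0 u = disc_minus r f u" if "u \<in> ball 0 1" for u
    using s[OF that] by (simp add: sums_iff)
  have "disc_minus r f holomorphic_on ball 0 1"
    by (rule holomorphic_transform[OF smooth_disc_holomorphic[OF G, of 0]]) (rule eq)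
  then show "f \<in> minus_D_infty r"
    by (intro minus_D_inftyI[OF disc_minus_imp_holomorphic G eq])
  have "\<forall>\<^sub>F u in nhds 0. (\<lambda>n. fps_nth (Abs_fps d) n * u ^ n) sums disc_minus r f u"
    by (rule eventually_mono[OF eventually_unit_ball]) (simp add: s)
  then have "disc_minus r f has_fps_expansion Abs_fps d"
    by (rule has_fps_expansionI)
  then show "minus_coeff r f n = d n"
    by (simp add: minus_coeff_def fps_expansion_eqI)
qed

section \<open>Feynman's parametric integral\<close>

lemma one_minus_powr_sums:
  fixes z :: complex and r :: real
  assumes "norm z < 1"
  shows "(\<lambda>n. of_real (pochhammer r n / fact n) * z ^ n) sums ((1 - z) powr (- of_real r))"
proof -
  have "(\<lambda>n. ((- of_real r :: complex) gchoose n) * (- z) ^ n) sums (1 + (- z)) powr (- of_real r)"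
    by (rule gen_binomial_complex) (use assms in simp)
  moreover have "((- of_real r :: complex) gchoose n) * (- z) ^ n = of_real (pochhammer r n / fact n) * z ^ n" for n
  proof -
    have "((- of_real r :: complex) gchoose n) * (- z) ^ n =
      ((- 1) ^ n * (- 1) ^ n) * (pochhammer (of_real r) n / fact n * z ^ n)"
      by (simp add: gbinomial_pochhammer power_minus[of z] mult_ac)
    also have "(- 1) ^ n * (- 1 :: complex) ^ n = 1" by (simp flip: power_mult_distrib)
    finally show ?thesis by (simp flip: pochhammer_of_real)
  qed
  ultimately show ?thesis by simp
qed

lemma summable_pochhammer_power:
  fixes r q :: real
  assumes "0 \<le> q" "q < 1"
  shows "summable (\<lambda>n. \<bar>pochhammer r n / fact n\<bar> * q ^ n)"
proof -
  define q' where "q' = (q + 1) / 2"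
  have q': "q < q'" "q' < 1" "0 < q'" using assms by (auto simp: q'_def)
  have "summable (\<lambda>n. of_real (pochhammer r n / fact n) * (of_real q' :: complex) ^ n)"
    using one_minus_powr_sums[of "of_real q'" r] q' by (auto simp: sums_iff)
  from powser_insidea[OF this, of "of_real q"] show ?thesis
    using assms q' by (simp add: norm_mult norm_power norm_divide)
qed

text \<open>A gauge integral of a nonnegative function is absolutely convergent and hence a Lebesgue
  integral. It serves the Beta integral, whose integrand may be unbounded, and exponentials on a
  half-line.\<close>

lemma nonneg_has_integral_imp_lborel:
  fixes f :: "real \<Rightarrow> real"
  assumes I: "(f has_integral I) S" and nn: "\<And>x. x \<in> S \<Longrightarrow> f x \<ge> 0"
    and m: "(\<lambda>x. indicator S x * f x) \<in> borel_measurable borel"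
  shows "integrable lborel (\<lambda>x. indicator S x * f x)" "(\<integral>x. indicator S x * f x \<partial>lborel) = I"
proof -
  have "f absolutely_integrable_on S"
    using I nn by (intro nonnegative_absolutely_integrable_1) (auto simp: has_integral_integrable_integral)
  then have "integrable lebesgue (\<lambda>x. indicator S x * f x)"
    by (simp add: set_integrable_def)
  then show int: "integrable lborel (\<lambda>x. indicator S x * f x)"
    by (subst (asm) integrable_completion) (use m in auto)
  have "set_integrable lborel S f"
    using int by (simp add: set_integrable_def)
  from set_borel_integral_eq_integral(2)[OF this] show "(\<integral>x. indicator S x * f x \<partial>lborel) = I"
    using I by (simp add: set_lebesgue_integral_def has_integral_integrable_integral)
qed

text \<open>The exponent belonging to \<open>b\<close> sits on \<open>u\<close> because
  \<open>u\<close> is the share of \<open>B\<close> in the segment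
  \<open>(1 - u) * A + u * B\<close>.\<close>

definition beta_weight :: "real \<Rightarrow> real \<Rightarrow> real \<Rightarrow> real" where
  "beta_weight a b u = indicator {0..1} u * (u powr (b - 1) * (1 - u) powr (a - 1))"

lemma beta_weight_nonneg [simp]: "beta_weight a b u \<ge> 0"
  by (simp add: beta_weight_def)

lemma beta_weight_measurable [measurable]: "beta_weight a b \<in> borel_measurable borel"
  unfolding beta_weight_def[abs_def] by measurable

lemma beta_weight_integral:
  assumes "a > 0" "b > 0"
  shows "integrable lborel (beta_weight a b)" "(\<integral>u. beta_weight a b u \<partial>lborel) = Beta b a"
proof -
  have "(\<lambda>u. indicator {0..1} u * (u powr (b - 1) * (1 - u) powr (a - 1))) \<in> borel_measurable borel"
    by measurable
  from nonneg_has_integral_imp_lborel[OF has_integral_Beta_real[OF assms(2,1)] _ this]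
  show "integrable lborel (beta_weight a b)" "(\<integral>u. beta_weight a b u \<partial>lborel) = Beta b a"
    by (simp_all add: beta_weight_def[abs_def])
qed

lemma beta_weight_shift:
  "beta_weight a b u * (u ^ m * (1 - u) ^ n) = beta_weight (a + real n) (b + real m) u"
proof (cases "u \<in> {0..1}")
  case True
  \<comment> \<open>At \<open>x = 0\<close> both sides are 0 by the convention
    \<open>0 powr s = 0\<close>, even for \<open>k = 0\<close>.\<close>
  have *: "x powr (c - 1) * x ^ k = x powr (c + real k - 1)" if "x \<ge> 0" for x c :: real and k
  proof (cases "x = 0")
    case False
    then have "x powr (c - 1) * x ^ k = x powr (c - 1) * x powr (real k)"
      using that by (simp add: powr_realpow)
    then show ?thesis by (simp flip: powr_add add: algebra_simps)
  qed simp
  show ?thesis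
    using True *[of u b m] *[of "1 - u" a n] by (simp add: beta_weight_def mult_ac)
qed (simp add: beta_weight_def)

lemma Beta_shift:
  assumes "a > 0" "b > (0::real)"
  shows "Beta (b + real m) (a + real n) = Beta b a * (pochhammer b m * pochhammer a n / pochhammer (a + b) (m + n))"
proof -
  have G: "Gamma (x + real k) = pochhammer x k * Gamma x" if "x > 0" for x :: real and k
  proof -
    have "x \<notin> \<int>\<^sub>\<le>\<^sub>0" using that by auto
    moreover have "Gamma x > 0" using that by (rule Gamma_real_pos)
    ultimately show ?thesis using pochhammer_Gamma[of x k] by simp
  qed
  have "Gamma (b + real m + (a + real n)) = pochhammer (a + b) (m + n) * Gamma (a + b)"
    using G[of "a + b" "m + n"] assms by (simp add: algebra_simps)
  then show ?thesis
    unfolding Beta_def using assms by (simp add: G add.commute mult_ac)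
qed

lemma beta_weight_power_integral:
  fixes z1 z2 :: complex
  assumes "a > 0" "b > 0"
  shows "(\<integral>u. of_real (beta_weight a b u) * ((1 - of_real u) * z1 + of_real u * z2) ^ n \<partial>lborel) =
    (\<Sum>k\<le>n. of_real (Beta (b + real k) (a + real (n - k))) * of_nat (n choose k) * z2 ^ k * z1 ^ (n - k))"
proof -
  have "of_real (beta_weight a b u) * ((1 - of_real u) * z1 + of_real u * z2) ^ n =
    (\<Sum>k\<le>n. (of_nat (n choose k) * z2 ^ k * z1 ^ (n - k)) * of_real (beta_weight (a + real (n - k)) (b + real k) u))" for u
  proof -
    have "((1 - of_real u) * z1 + of_real u * z2) ^ n = (of_real u * z2 + (1 - of_real u) * z1) ^ n"
      by (simp add: add.commute)
    also have "\<dots> = (\<Sum>k\<le>n. of_nat (n choose k) * (of_real u * z2) ^ k * ((1 - of_real u) * z1) ^ (n - k))"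
      by (rule binomial_ring)
    finally show ?thesis
      unfolding beta_weight_shift[symmetric] by (simp add: sum_distrib_left power_mult_distrib mult_ac)
  qed
  then have "(\<integral>u. of_real (beta_weight a b u) * ((1 - of_real u) * z1 + of_real u * z2) ^ n \<partial>lborel) =
     (\<Sum>k\<le>n. \<integral>u. (of_nat (n choose k) * z2 ^ k * z1 ^ (n - k)) * of_real (beta_weight (a + real (n - k)) (b + real k) u) \<partial>lborel)"
    by (simp only:) (intro Bochner_Integration.integral_sum integrable_mult_right integrable_of_real
         beta_weight_integral(1); use assms in simp)
  also have "\<dots> = (\<Sum>k\<le>n. of_real (Beta (b + real k) (a + real (n - k))) * of_nat (n choose k) * z2 ^ k * z1 ^ (n - k))"
    using assms by (intro sum.cong refl) (simp add: beta_weight_integral add_pos_nonneg mult_ac)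
  finally show ?thesis .
qed

lemma norm_segment_le:
  fixes z1 z2 :: complex
  assumes "norm z1 \<le> q" "norm z2 \<le> q" "u \<in> {0..1}"
  shows "norm ((1 - of_real u) * z1 + of_real u * z2) \<le> q"
proof -
  have "norm ((1 - of_real u) * z1 + of_real u * z2) \<le> norm (of_real (1 - u) * z1) + norm (of_real u * z2)"
    by (rule order_trans[OF _ norm_triangle_ineq]) simp
  also have "\<dots> = (1 - u) * norm z1 + u * norm z2"
    using assms(3) by (simp only: norm_mult norm_of_real) simp
  also have "\<dots> \<le> (1 - u) * q + u * q"
    using assms by (intro add_mono mult_left_mono) auto
  finally show ?thesis by (simp add: algebra_simps)
qed

abbreviation feynman_kernel :: "real \<Rightarrow> real \<Rightarrow> complex \<Rightarrow> complex \<Rightarrow> real \<Rightarrow> complex" where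
  "feynman_kernel a b A B u \<equiv>
    of_real (beta_weight a b u) * ((1 - of_real u) * A + of_real u * B) powr (- of_real (a + b))"

text \<open>Expanding the power of \<open>1 - Z u\<close> and integrating term by term yields Beta
  values that rearrange into the Cauchy product of the binomial series of the two factors on the
  right.\<close>

lemma feynman_near_one:
  fixes z1 z2 :: complex and a b :: real
  assumes ab: "a > 0" "b > 0" and z: "norm z1 < 1" "norm z2 < 1"
  shows "(\<integral>u. of_real (beta_weight a b u) *
           (1 - ((1 - of_real u) * z1 + of_real u * z2)) powr (- of_real (a + b)) \<partial>lborel) =
    of_real (Beta a b) * (1 - z1) powr (- of_real a) * (1 - z2) powr (- of_real b)"
proof -
  define q where "q = max (norm z1) (norm z2)"
  have q: "0 \<le> q" "q < 1" "norm z1 \<le> q" "norm z2 \<le> q" using z by (auto simp: q_def max_def)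
  define Z where "Z u = (1 - of_real u) * z1 + of_real u * z2" for u :: real
  have Z: "norm (Z u) \<le> q" if "u \<in> {0..1}" for u
    unfolding Z_def by (rule norm_segment_le[OF q(3,4) that])
  define c where "c n = pochhammer (a + b) n / fact n" for n
  have c: "c n > 0" for n using ab by (simp add: c_def pochhammer_pos)
  have csum: "summable (\<lambda>n. c n * q ^ n)"
    using summable_pochhammer_power[OF q(1,2), of "a + b"] abs_of_pos[OF c] by (simp only: c_def)
  define F where "F n u = of_real (beta_weight a b u) * (of_real (c n) * Z u ^ n)" for n u
  have Zm [measurable]: "Z \<in> borel_measurable borel" unfolding Z_def[abs_def] by measurable
  have Fm [measurable]: "F n \<in> borel_measurable borel" for n unfolding F_def[abs_def] by measurable
  have Fle: "norm (F n u) \<le> c n * q ^ n * beta_weight a b u" for n u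
  proof (cases "u \<in> {0..1}")
    case True
    have "norm (F n u) = beta_weight a b u * (c n * norm (Z u) ^ n)"
      using c[of n] by (simp add: F_def norm_mult norm_power)
    also have "\<dots> \<le> beta_weight a b u * (c n * q ^ n)"
      using c[of n] Z[OF True] by (intro mult_left_mono power_mono) auto
    finally show ?thesis by (simp add: mult_ac)
  qed (simp add: F_def beta_weight_def)
  have Fint: "integrable lborel (F n)" for n
    by (rule Bochner_Integration.integrable_bound[of _ "\<lambda>u. c n * q ^ n * beta_weight a b u"])
       (use Fle c[of n] q in \<open>auto simp: abs_mult beta_weight_integral ab\<close>)
  have F1: "summable (\<lambda>n. \<integral>u. norm (F n u) \<partial>lborel)"
  proof (rule summable_comparison_test')
    show "summable (\<lambda>n. c n * q ^ n * Beta b a)" by (intro summable_mult2 csum)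
    fix n
    have "(\<integral>u. norm (F n u) \<partial>lborel) \<le> (\<integral>u. c n * q ^ n * beta_weight a b u \<partial>lborel)"
      by (intro integral_mono integrable_norm Fint integrable_mult_right beta_weight_integral ab Fle)
    then show "norm (\<integral>u. norm (F n u) \<partial>lborel) \<le> c n * q ^ n * Beta b a"
      by (simp add: beta_weight_integral ab)
  qed
  have F2: "summable (\<lambda>n. norm (F n u))" for u
    by (rule summable_comparison_test'[OF summable_mult2[OF csum]]) (use Fle in auto)
  have "(\<lambda>n. \<integral>u. F n u \<partial>lborel) sums (\<integral>u. (\<Sum>n. F n u) \<partial>lborel)"
    by (rule sums_integral[OF Fint _ F1]) (simp add: F2)
  also have "(\<lambda>u. \<Sum>n. F n u) = (\<lambda>u. of_real (beta_weight a b u) * (1 - Z u) powr (- of_real (a + b)))"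
  proof
    fix u
    show "(\<Sum>n. F n u) = of_real (beta_weight a b u) * (1 - Z u) powr (- of_real (a + b))"
    proof (cases "u \<in> {0..1}")
      case True
      then have "norm (Z u) < 1" using Z[OF True] q by simp
      from sums_mult[OF one_minus_powr_sums[OF this, of "a + b"], of "of_real (beta_weight a b u)"]
      show ?thesis by (simp only: F_def c_def sums_iff)
    qed (simp add: F_def beta_weight_def)
  qed
  finally have s1: "(\<lambda>n. \<integral>u. F n u \<partial>lborel) sums
     (\<integral>u. of_real (beta_weight a b u) * (1 - Z u) powr (- of_real (a + b)) \<partial>lborel)" .
  define x y where "x k = of_real (pochhammer b k / fact k) * z2 ^ k"
    and "y k = of_real (pochhammer a k / fact k) * z1 ^ k" for k
  have "(\<integral>u. F n u \<partial>lborel) = of_real (Beta a b) * (\<Sum>k\<le>n. x k * y (n - k))" for n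
  proof -
    have "(\<integral>u. F n u \<partial>lborel) = of_real (c n) * (\<integral>u. of_real (beta_weight a b u) * Z u ^ n \<partial>lborel)"
    proof -
      have "F n u = of_real (c n) * (of_real (beta_weight a b u) * Z u ^ n)" for u
        by (simp add: F_def mult_ac)
      then show ?thesis by (simp only: integral_mult_right_zero)
    qed
    also have "\<dots> = (\<Sum>k\<le>n. of_real (c n) * (of_real (Beta (b + real k) (a + real (n - k))) * of_nat (n choose k) * z2 ^ k * z1 ^ (n - k)))"
      unfolding Z_def beta_weight_power_integral[OF ab] sum_distrib_left ..
    also have "\<dots> = (\<Sum>k\<le>n. of_real (Beta a b) * (x k * y (n - k)))"
    proof (rule sum.cong[OF refl])
      fix k assume "k \<in> {..n}"
      then have k: "k \<le> n" by simp
      have "pochhammer (a + b) n \<noteq> 0" using ab pochhammer_pos[of "a + b" n] by simp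
      moreover have "Beta (b + real k) (a + real (n - k)) =
          Beta a b * (pochhammer b k * pochhammer a (n - k) / pochhammer (a + b) n)"
        using Beta_shift[OF ab, of k "n - k"] k by (simp only: Beta_commute[of b a] le_add_diff_inverse)
      \<comment> \<open>The Pochhammer symbol of \<open>a + b\<close> in \<open>c n\<close> cancels
        the one in the shifted Beta value, and \<open>n!\<close> cancels against the binomial
        coefficient. What is left separates into a factor in \<open>k\<close> and one in
        \<open>n - k\<close>.\<close>
      ultimately have "c n * (Beta (b + real k) (a + real (n - k)) * real (n choose k)) =
          Beta a b * (pochhammer b k / fact k * (pochhammer a (n - k) / fact (n - k)))"
        using k by (simp add: c_def binomial_fact field_simps)
      then have "complex_of_real (c n * (Beta (b + real k) (a + real (n - k)) * real (n choose k))) =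
          of_real (Beta a b * (pochhammer b k / fact k * (pochhammer a (n - k) / fact (n - k))))"
        by (rule arg_cong)
      then have "complex_of_real (c n * (Beta (b + real k) (a + real (n - k)) * real (n choose k))) * (z2 ^ k * z1 ^ (n - k)) =
          of_real (Beta a b * (pochhammer b k / fact k * (pochhammer a (n - k) / fact (n - k)))) * (z2 ^ k * z1 ^ (n - k))"
        by (rule arg_cong)
      then show "of_real (c n) * (of_real (Beta (b + real k) (a + real (n - k))) * of_nat (n choose k) * z2 ^ k * z1 ^ (n - k)) =
          of_real (Beta a b) * (x k * y (n - k))"
        unfolding x_def y_def of_real_mult of_real_of_nat_eq by (simp only: mult_ac)
    qed
    finally show ?thesis by (simp add: sum_distrib_left)
  qed
  then have s1': "(\<lambda>n. of_real (Beta a b) * (\<Sum>k\<le>n. x k * y (n - k))) sums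
     (\<integral>u. of_real (beta_weight a b u) * (1 - Z u) powr (- of_real (a + b)) \<partial>lborel)"
    using s1 by simp
  have ns: "summable (\<lambda>k. norm (x k))" "summable (\<lambda>k. norm (y k))"
    using summable_pochhammer_power[of "norm z2" b] summable_pochhammer_power[of "norm z1" a] z
    by (simp_all add: x_def y_def norm_mult norm_power norm_divide)
  have "(\<lambda>n. of_real (Beta a b) * (\<Sum>k\<le>n. x k * y (n - k))) sums
     (of_real (Beta a b) * ((\<Sum>k. x k) * (\<Sum>k. y k)))"
    by (rule sums_mult[OF Cauchy_product_sums[OF ns]])
  also have "(\<Sum>k. x k) = (1 - z2) powr (- of_real b)"
    using one_minus_powr_sums[OF z(2), of b] by (simp add: x_def sums_iff)
  also have "(\<Sum>k. y k) = (1 - z1) powr (- of_real a)"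
    using one_minus_powr_sums[OF z(1), of a] by (simp add: y_def sums_iff)
  finally show ?thesis
    using sums_unique2[OF s1'] by (simp add: Z_def mult_ac)
qed

lemma powr_of_real_times:
  assumes "N > 0" "z \<noteq> 0"
  shows "(of_real N * z) powr s = of_real N powr s * (z::complex) powr s"
  using assms Ln_times_of_real[of N z]
  by (simp add: powr_def exp_add[symmetric] Ln_of_real algebra_simps)

text \<open>Both sides are homogeneous of degree \<open>- (a + b)\<close> under positive scaling,
  and after division by a large \<open>N\<close> the points \<open>A\<close> and \<open>B\<close>
  lie in the unit disc around 1.\<close>

lemma feynman_right:
  fixes A B :: complex and a b :: real
  assumes ab: "a > 0" "b > 0" and A: "Re A > 0" and B: "Re B > 0"
  shows "(\<integral>u. feynman_kernel a b A B u \<partial>lborel) =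
    of_real (Beta a b) * A powr (- of_real a) * B powr (- of_real b)"
proof -
  \<comment> \<open>\<open>|N - X| < N\<close> means \<open>|X|^2 < 2 * N * Re X\<close>, which
    holds for \<open>X = A\<close> and \<open>X = B\<close> as soon as \<open>N\<close> is at least
    both quotients.\<close>
  define N where "N = max ((norm A)\<^sup>2 / Re A) ((norm B)\<^sup>2 / Re B)"
  have near: "norm (1 - X / of_real N) < 1" if X: "Re X > 0" "(norm X)\<^sup>2 / Re X \<le> N" for X
  proof -
    have X0: "(norm X)\<^sup>2 > 0" using X by auto
    then have N: "N > 0" using X by (smt (verit) divide_pos_pos)
    have le: "(norm X)\<^sup>2 \<le> N * Re X" using X by (simp add: divide_le_eq)
    have "(norm (of_real N - X))\<^sup>2 = N\<^sup>2 - 2 * N * Re X + (norm X)\<^sup>2"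
      unfolding cmod_power2 by (simp add: power2_eq_square algebra_simps)
    also have "\<dots> < N\<^sup>2" using le X0 by linarith
    finally have "norm (of_real N - X) < N"
      using N by (intro power2_less_imp_less[of _ N]) auto
    moreover have "1 - X / of_real N = (of_real N - X) / of_real N" using N by (simp add: field_simps)
    ultimately show ?thesis using N by (simp add: norm_divide)
  qed
  have "(norm A)\<^sup>2 / Re A > 0" using A by (intro divide_pos_pos) auto
  then have N: "N > 0" by (auto simp: N_def max_def)
  define z1 z2 where "z1 = 1 - A / of_real N" and "z2 = 1 - B / of_real N"
  have z: "norm z1 < 1" "norm z2 < 1"
    unfolding z1_def z2_def by (intro near A B; simp add: N_def)+
  have A': "A = of_real N * (1 - z1)" and B': "B = of_real N * (1 - z2)"
    using N by (auto simp: z1_def z2_def)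
  have nz: "1 - z1 \<noteq> 0" "1 - z2 \<noteq> 0" using A' B' A B by auto
  define P where "P = complex_of_real N powr (- of_real (a + b))"
  have P: "P = of_real N powr (- of_real a) * of_real N powr (- of_real b)"
    using N by (simp add: P_def powr_add[symmetric])
  have "feynman_kernel a b A B u =
     P * (of_real (beta_weight a b u) * (1 - ((1 - of_real u) * z1 + of_real u * z2)) powr (- of_real (a + b)))" for u
  proof (cases "u \<in> {0..1}")
    case True
    have "norm ((1 - of_real u) * z1 + of_real u * z2) \<le> max (norm z1) (norm z2)"
      by (rule norm_segment_le) (use True in auto)
    then have "norm ((1 - of_real u) * z1 + of_real u * z2) < 1" using z by simp
    then have "1 - ((1 - of_real u) * z1 + of_real u * z2) \<noteq> 0" by auto
    moreover have "(1 - of_real u) * A + of_real u * B = of_real N * (1 - ((1 - of_real u) * z1 + of_real u * z2))"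
      unfolding A' B' by (simp add: algebra_simps)
    ultimately show ?thesis
      using N by (simp add: powr_of_real_times P_def mult_ac)
  qed (simp add: beta_weight_def)
  then have "(\<integral>u. feynman_kernel a b A B u \<partial>lborel) =
     P * (of_real (Beta a b) * (1 - z1) powr (- of_real a) * (1 - z2) powr (- of_real b))"
    by (simp only: integral_mult_right_zero feynman_near_one[OF ab z])
  also have "\<dots> = of_real (Beta a b) * A powr (- of_real a) * B powr (- of_real b)"
    unfolding A' B' P using N nz by (simp add: powr_of_real_times mult_ac)
  finally show ?thesis .
qed

text \<open>The argument of \<open>z\<close> lies strictly between 0 and \<open>pi\<close>;
  subtracting \<open>pi / 2\<close> keeps it in the principal range, so the logarithm does not
  jump.\<close>

lemma powr_rotate_upper:
  assumes "Im z > 0"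
  shows "(- \<i> * z) powr s = exp (- \<i> * of_real pi / 2 * s) * z powr s"
proof -
  have z: "- \<i> * z \<noteq> 0" "z \<noteq> 0" using assms by auto
  have "Ln (\<i> * (- \<i> * z)) = Ln (- \<i> * z) + \<i> * of_real pi / 2"
    using assms Ln_times_ii[OF z(1)] by simp
  then have "Ln (- \<i> * z) = Ln z - \<i> * of_real pi / 2" by simp
  then have "s * Ln (- \<i> * z) = s * (Ln z - \<i> * of_real pi / 2)" by (rule arg_cong)
  then have L: "s * Ln (- \<i> * z) = - \<i> * of_real pi / 2 * s + s * Ln z" by (simp add: algebra_simps)
  show ?thesis using z by (simp only: powr_def if_False L exp_add)
qed

text \<open>Rotation by \<open>- \<i>\<close> carries the upper half-plane to the right one. The
  phases picked up by the two sides agree since the exponents \<open>a\<close> and \<open>b\<close>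
  add up.\<close>

lemma feynman_upper:
  fixes A B :: complex and a b :: real
  assumes ab: "a > 0" "b > 0" and A: "Im A > 0" and B: "Im B > 0"
  shows "(\<integral>u. feynman_kernel a b A B u \<partial>lborel) =
    of_real (Beta a b) * A powr (- of_real a) * B powr (- of_real b)"
proof -
  define e where "e s = exp (- \<i> * of_real pi / 2 * s)" for s
  have e: "e (x + y) = e x * e y" "e x \<noteq> 0" for x y
    by (auto simp: e_def exp_add[symmetric] algebra_simps add_divide_distrib)
  have "feynman_kernel a b (- \<i> * A) (- \<i> * B) u =
    e (- of_real (a + b)) * (feynman_kernel a b A B u)" for u
  proof (cases "u \<in> {0..1}")
    case True
    have "Im ((1 - of_real u) * A + of_real u * B) > 0"
    proof (cases "u = 0")
      case False
      then have "u * Im B > 0" "(1 - u) * Im A \<ge> 0" using True A B by auto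
      then show ?thesis by simp
    qed (use A in simp)
    from powr_rotate_upper[OF this] show ?thesis
      by (simp add: e_def algebra_simps)
  qed (simp add: beta_weight_def)
  then have "(\<integral>u. feynman_kernel a b (- \<i> * A) (- \<i> * B) u \<partial>lborel) =
    e (- of_real (a + b)) * (\<integral>u. feynman_kernel a b A B u \<partial>lborel)"
    by (simp only: integral_mult_right_zero)
  then have "e (- of_real (a + b)) * (\<integral>u. feynman_kernel a b A B u \<partial>lborel) =
    of_real (Beta a b) * (- \<i> * A) powr (- of_real a) * (- \<i> * B) powr (- of_real b)"
    by (subst feynman_right[OF ab, symmetric]) (use A B in simp_all)
  also have "\<dots> = (e (- of_real a) * e (- of_real b)) * (of_real (Beta a b) * A powr (- of_real a) * B powr (- of_real b))"
    unfolding powr_rotate_upper[OF A] powr_rotate_upper[OF B] e_def by (simp add: mult_ac)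
  also have "e (- of_real a) * e (- of_real b) = e (- of_real (a + b))"
    by (simp flip: e(1))
  finally show ?thesis using e(2) by simp
qed

section \<open>Growth and Fourier coefficients of modular forms\<close>

abbreviation fourier_exp :: "real \<Rightarrow> complex \<Rightarrow> complex" where
  "fourier_exp \<mu> z \<equiv> exp (2 * of_real pi * \<i> * of_real \<mu> * z)"

abbreviation fourier_term :: "(nat \<Rightarrow> complex) \<Rightarrow> real \<Rightarrow> complex \<Rightarrow> nat \<Rightarrow> complex" where
  "fourier_term a \<kappa> z m \<equiv> a m * fourier_exp (real m + \<kappa>) z"

lemma norm_fourier_term:
  "norm (fourier_term a \<kappa> z m) = norm (a m) * exp (- 2 * pi * (real m + \<kappa>) * Im z)"
  by (simp add: norm_mult norm_exp_eq_Re)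

lemma fourier_term_power:
  "fourier_term a \<kappa> z m =
    fourier_exp \<kappa> z * (a m * exp (2 * of_real pi * \<i> * z) ^ m)"
proof -
  have "fourier_exp (real m + \<kappa>) z =
    fourier_exp \<kappa> z * exp (of_nat m * (2 * of_real pi * \<i> * z))"
    by (simp add: exp_add[symmetric] algebra_simps)
  then show ?thesis by (simp add: exp_of_nat_mult)
qed

text \<open>Up to an exponential factor the expansion is a power series in
  \<open>q = exp (2 * pi * \<i> * z)\<close>. Convergence at height \<open>y / 2\<close> takes place
  at a larger \<open>|q|\<close> and so forces absolute convergence at height
  \<open>y\<close>.\<close>

lemma fourier_power_series_summable:
  assumes "\<And>z. z \<in> upper_hp \<Longrightarrow> fourier_term a \<kappa> z sums f z" and y: "y > 0"
  shows "summable (\<lambda>m. norm (a m) * exp (- 2 * pi * y) ^ m)"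
proof -
  have yy: "\<i> * of_real (y / 2) \<in> upper_hp" using y by (simp add: upper_hp_def)
  define E where "E = fourier_exp \<kappa> (\<i> * of_real (y / 2))"
  define q where "q = exp (2 * of_real pi * \<i> * (\<i> * of_real (y / 2)))"
  have "summable (\<lambda>m. E * (a m * q ^ m))"
    using assms(1)[OF yy] unfolding fourier_term_power E_def q_def by (auto simp: sums_iff)
  then have "summable (\<lambda>m. a m * q ^ m)"
    using summable_mult[of "\<lambda>m. E * (a m * q ^ m)" "inverse E"] by (simp add: E_def)
  moreover have "norm (complex_of_real (exp (- 2 * pi * y))) < norm q"
    using y by (simp add: q_def norm_exp_eq_Re)
  ultimately have "summable (\<lambda>m. norm (a m * complex_of_real (exp (- 2 * pi * y)) ^ m))"
    by (rule powser_insidea)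
  then show ?thesis by (simp add: norm_mult norm_power)
qed

lemma fourier_abs_summable:
  assumes "\<And>z. z \<in> upper_hp \<Longrightarrow> fourier_term a \<kappa> z sums f z" and y: "y > 0"
  shows "summable (\<lambda>m. norm (a m) * exp (- 2 * pi * (real m + \<kappa>) * y))"
proof -
  have "summable (\<lambda>m. exp (- 2 * pi * \<kappa> * y) * (norm (a m) * exp (- 2 * pi * y) ^ m))"
    by (rule summable_mult[OF fourier_power_series_summable[OF assms]])
  then show ?thesis
    by (simp add: exp_of_nat_mult[symmetric] exp_add[symmetric] algebra_simps flip: exp_add)
qed

text \<open>Once the coefficients below \<open>m\<close> vanish, \<open>f (\<i> * y)\<close> times
  \<open>exp (2 * pi * (m + \<kappa>) * y)\<close> is a power series in
  \<open>exp (- 2 * pi * y)\<close> with constant term \<open>a m\<close>, so it tends to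
  \<open>a m\<close>. The downward closed predicate \<open>P\<close> covers the negative frequencies
  of bounded forms and the nonpositive ones of cusp forms in one argument.\<close>

lemma fourier_coeff_zero:
  assumes f: "\<And>z. z \<in> upper_hp \<Longrightarrow> fourier_term a \<kappa> z sums f z"
    and lim: "\<And>\<mu>. P \<mu> \<Longrightarrow> ((\<lambda>y. f (\<i> * of_real y) * of_real (exp (2 * pi * \<mu> * y))) \<longlongrightarrow> 0) at_top"
    and P: "P (real m + \<kappa>)" and mono: "\<And>x y. P x \<Longrightarrow> y \<le> x \<Longrightarrow> P y"
  shows "a m = 0"
  using P
proof (induction m rule: less_induct)
  case (less m)
  let ?q = "\<lambda>y. complex_of_real (exp (- 2 * pi * y))"
    and ?E = "\<lambda>y. complex_of_real (exp (2 * pi * (real m + \<kappa>) * y))"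
  define g where "g q = (\<Sum>j. a (j + m) * q ^ j)" for q
  \<comment> \<open>Convergence at one nonzero point makes the tail series continuous at 0.\<close>
  have sm: "summable (\<lambda>j. a (j + m) * (of_real (exp (- 2 * pi))) ^ j)"
  proof -
    have "summable (\<lambda>j. norm (a j) * exp (- 2 * pi * 1) ^ j)"
      by (rule fourier_power_series_summable[OF f]) simp_all
    then have "summable (\<lambda>j. norm (a (j + m)) * exp (- 2 * pi) ^ (j + m))"
      by (intro summable_ignore_initial_segment[where k = m and f = "\<lambda>j. norm (a j) * exp (- 2 * pi) ^ j"]) simp
    from summable_mult[OF this, of "inverse (exp (- 2 * pi) ^ m)"]
    have "summable (\<lambda>j. norm (a (j + m) * (of_real (exp (- 2 * pi))) ^ j))"
      by (simp add: norm_mult norm_power power_add field_simps)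
    then show ?thesis by (rule summable_norm_cancel)
  qed
  have "isCont g 0"
    unfolding g_def by (rule isCont_powser[OF sm]) simp
  then have "(g \<longlongrightarrow> g 0) (at 0)" by (simp add: isCont_def)
  moreover have g0: "g 0 = a m" unfolding g_def using powser_zero[of "\<lambda>j. a (j + m)"] by simp
  moreover have "filterlim (\<lambda>y::real. ?q y) (at 0) at_top"
    unfolding filterlim_at
  proof
    show "((\<lambda>y. ?q y) \<longlongrightarrow> 0) at_top"
    proof -
      have "((\<lambda>y. exp (- 2 * pi * y)) \<longlongrightarrow> (0::real)) at_top"
        by real_asymp
      from tendsto_of_real[OF this, where 'a = complex] show ?thesis by simp
    qed
  qed simp
  ultimately have "((\<lambda>y. g (?q y)) \<longlongrightarrow> a m) at_top"
    using filterlim_compose by fastforce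
  moreover have "\<forall>\<^sub>F y in at_top. f (\<i> * of_real y) * ?E y =
      g (?q y)"
    using eventually_gt_at_top[of 0]
  proof eventually_elim
    case (elim y)
    have "\<i> * of_real y \<in> upper_hp" using elim by (simp add: upper_hp_def)
    from f[OF this] have "(\<lambda>j. fourier_term a \<kappa> (\<i> * of_real y) (j + m)) sums
        (f (\<i> * of_real y) - (\<Sum>j<m. fourier_term a \<kappa> (\<i> * of_real y) j))"
      by (rule sums_split_initial_segment)
    also have "(\<Sum>j<m. fourier_term a \<kappa> (\<i> * of_real y) j) = 0"
    proof (rule sum.neutral, rule ballI)
      fix j assume "j \<in> {..<m}"
      then have "a j = 0" by (intro less.IH mono[OF less.prems]) auto
      then show "fourier_term a \<kappa> (\<i> * of_real y) j = 0" by simp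
    qed
    finally have "(\<lambda>j. fourier_term a \<kappa> (\<i> * of_real y) (j + m) * ?E y)
       sums (f (\<i> * of_real y) * ?E y)"
      by (intro sums_mult2) simp
    moreover have "fourier_term a \<kappa> (\<i> * of_real y) (j + m) * ?E y =
        a (j + m) * ?q y ^ j" for j
    proof -
      have "fourier_exp (real (j + m) + \<kappa>) (\<i> * of_real y) * ?E y
        = exp (2 * of_real pi * \<i> * of_real (real (j + m) + \<kappa>) * (\<i> * of_real y) + of_real (2 * pi * (real m + \<kappa>) * y))"
        by (simp only: exp_add exp_of_real)
      also have "2 * of_real pi * \<i> * of_real (real (j + m) + \<kappa>) * (\<i> * of_real y) + of_real (2 * pi * (real m + \<kappa>) * y) =
          of_nat j * complex_of_real (- 2 * pi * y)"
        by (simp add: algebra_simps)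
      also have "exp (of_nat j * complex_of_real (- 2 * pi * y)) = ?q y ^ j"
        by (simp only: exp_of_nat_mult exp_of_real)
      finally show ?thesis by (simp only: mult.assoc)
    qed
    ultimately have "(\<lambda>j. a (j + m) * ?q y ^ j)
       sums (f (\<i> * of_real y) * ?E y)"
      by (simp only:)
    then show ?case unfolding g_def by (rule sums_unique)
  qed
  ultimately have "((\<lambda>y. f (\<i> * of_real y) * ?E y) \<longlongrightarrow> a m) at_top"
    by (simp add: tendsto_cong)
  moreover have "((\<lambda>y. f (\<i> * of_real y) * ?E y) \<longlongrightarrow> 0) at_top"
    by (rule lim[OF less.prems])
  ultimately show ?case by (rule tendsto_unique[rotated]) simp
qed

lemma filterlim_imaginary_axis: "filterlim (\<lambda>y. \<i> * of_real y) (filtercomap Im at_top) at_top"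
  by (simp add: filterlim_filtercomap_iff o_def filterlim_ident)

lemma modular_form_coeff_zero:
  assumes f: "\<And>z. z \<in> upper_hp \<Longrightarrow> fourier_term a \<kappa> z sums f z"
    and mf: "f \<in> modular_forms r v" and m: "real m + \<kappa> < 0"
  shows "a m = 0"
proof (rule fourier_coeff_zero[OF f, where P = "\<lambda>\<mu>. \<mu> < 0"])
  fix \<mu> :: real assume \<mu>: "\<mu> < 0"
  have "f \<in> O[filtercomap Im at_top](\<lambda>_. 1)" using mf by (simp add: modular_forms_def)
  then have "(\<lambda>y. f (\<i> * of_real y)) \<in> O[at_top](\<lambda>_. 1)"
    by (rule landau_o.big.compose[OF _ filterlim_imaginary_axis])
  then obtain C where "\<forall>\<^sub>F y in at_top. norm (f (\<i> * of_real y)) \<le> C * norm (1::complex)"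
    by (elim landau_o.bigE)
  then have ev: "\<forall>\<^sub>F y in at_top. norm (f (\<i> * of_real y) * of_real (exp (2 * pi * \<mu> * y))) \<le> C * exp (2 * pi * \<mu> * y)"
    by (rule eventually_mono) (simp add: norm_mult)
  have "((\<lambda>y. C * exp (c * y)) \<longlongrightarrow> 0) at_top" if "c < 0" for c :: real
    using that by real_asymp
  from this[of "2 * pi * \<mu>"] have "((\<lambda>y. C * exp (2 * pi * \<mu> * y)) \<longlongrightarrow> 0) at_top"
    using \<mu> by (simp add: mult_pos_neg)
  then show "((\<lambda>y. f (\<i> * of_real y) * of_real (exp (2 * pi * \<mu> * y))) \<longlongrightarrow> 0) at_top"
    by (rule Lim_null_comparison[OF ev])
qed (use m in auto)

text \<open>The decay like \<open>1 / y\<close> is what also excludes frequency 0, for which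
  boundedness alone would allow a constant term.\<close>

lemma cusp_form_coeff_zero:
  assumes f: "\<And>z. z \<in> upper_hp \<Longrightarrow> fourier_term a \<kappa> z sums f z"
    and cf: "f \<in> cusp_forms r v" and m: "real m + \<kappa> \<le> 0"
  shows "a m = 0"
proof (rule fourier_coeff_zero[OF f, where P = "\<lambda>\<mu>. \<mu> \<le> 0"])
  fix \<mu> :: real assume \<mu>: "\<mu> \<le> 0"
  have "\<forall>a>0. f \<in> O[filtercomap Im at_top](\<lambda>z. of_real (Im z powr (- a)))"
    using cf by (simp add: cusp_forms_def)
  from this[rule_format, of 1]
  have "f \<in> O[filtercomap Im at_top](\<lambda>z. of_real (Im z powr (- 1)))" by simp
  then have "(\<lambda>y. f (\<i> * of_real y)) \<in> O[at_top](\<lambda>y. of_real (Im (\<i> * of_real y) powr (- 1)))"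
    by (rule landau_o.big.compose[OF _ filterlim_imaginary_axis])
  then obtain C where C: "C > 0"
    "\<forall>\<^sub>F y in at_top. norm (f (\<i> * of_real y)) \<le> C * norm (of_real (Im (\<i> * of_real y) powr (- 1)) :: complex)"
    by (elim landau_o.bigE) auto
  have ev: "\<forall>\<^sub>F y in at_top. norm (f (\<i> * of_real y) * of_real (exp (2 * pi * \<mu> * y))) \<le> C * y powr (- 1)"
    using C(2) eventually_gt_at_top[of 0]
  proof eventually_elim
    case (elim y)
    have "exp (2 * pi * \<mu> * y) \<le> 1" using \<mu> elim by (simp add: mult_nonneg_nonpos mult_nonpos_nonneg)
    then have "norm (f (\<i> * of_real y)) * exp (2 * pi * \<mu> * y) \<le> (C * y powr (- 1)) * 1"
      using elim C(1) by (intro mult_mono) (auto simp: norm_divide powr_minus_divide)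
    then show ?case by (simp add: norm_mult)
  qed
  have "((\<lambda>y. C * y powr (- 1)) \<longlongrightarrow> 0) at_top"
    by real_asymp
  then show "((\<lambda>y. f (\<i> * of_real y) * of_real (exp (2 * pi * \<mu> * y))) \<longlongrightarrow> 0) at_top"
    by (rule Lim_null_comparison[OF ev])
qed (use m in auto)

section \<open>Growth of modular forms towards the real line\<close>

lemma norm_fourier_translate:
  assumes f: "\<And>z. z \<in> upper_hp \<Longrightarrow> fourier_term a \<kappa> z sums f z" and z: "z \<in> upper_hp"
  shows "norm (f (z + of_int n)) = norm (f z)"
proof -
  let ?e = "exp (\<i> * of_real (2 * pi * \<kappa> * of_int n))"
  \<comment> \<open>All frequencies differ by integers, so a translation by \<open>n\<close>
    multiplies every term by the same phase.\<close>
  have eq: "fourier_term a \<kappa> (z + of_int n) m = ?e * fourier_term a \<kappa> z m" for m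
  proof -
    have "fourier_exp (real m + \<kappa>) (z + of_int n) =
       fourier_exp (real m + \<kappa>) z * ?e * exp (2 * of_int (int m * n) * of_real pi * \<i>)"
      by (simp add: exp_add[symmetric] algebra_simps)
    also have "exp (2 * of_int (int m * n) * of_real pi * \<i>) = 1"
      using exp_integer_2pi[of "of_int (int m * n)"] by (simp add: mult_ac)
    finally show ?thesis by simp
  qed
  have "fourier_term a \<kappa> (z + of_int n) sums (?e * f z)"
    unfolding eq by (rule sums_mult[OF f[OF z]])
  moreover have "fourier_term a \<kappa> (z + of_int n) sums f (z + of_int n)"
    by (rule f) (use z in \<open>simp add: upper_hp_def\<close>)
  ultimately have "f (z + of_int n) = ?e * f z" by (rule sums_unique2[symmetric])
  then show ?thesis by (simp only: norm_mult norm_exp_i_times)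
qed

text \<open>Since $S^2 = -1$, the multiplier has absolute value 1 at $S$ as soon as the form does not vanish.\<close>
lemma norm_automorphic_inversion:
  assumes f: "f \<in> automorphic_forms r v" and z: "z \<in> upper_hp"
  shows "norm (f (- 1 / z)) = norm z powr r * norm (f z)"
proof -
  define V where "V = norm (v 0 (- 1) 1 0)"
  have S: "norm (f (- 1 / w)) = V * norm w powr r * norm (f w)" "- 1 / w \<in> upper_hp" "w \<noteq> 0" if "w \<in> upper_hp" for w
  proof -
    show "w \<noteq> 0" using that by (auto simp: upper_hp_def)
    have "\<forall>a b c d. a * d - b * c = 1 \<longrightarrow> (\<forall>z\<in>upper_hp.
        f (moeb a b c d z) = v a b c d * (of_int c * z + of_int d) powr of_real r * f z)"
      using f by (simp add: automorphic_forms_def)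
    from this[rule_format, of 0 0 "-1" 1 w] that
    show "norm (f (- 1 / w)) = V * norm w powr r * norm (f w)"
      by (simp add: moeb_def norm_mult norm_powr_real_powr' V_def)
    have "Im (- 1 / w) = Im w / ((Re w)\<^sup>2 + (Im w)\<^sup>2)" by (simp add: Im_divide)
    moreover have "0 < (Re w)\<^sup>2 + (Im w)\<^sup>2" using that by (simp add: upper_hp_def add_nonneg_pos)
    ultimately show "- 1 / w \<in> upper_hp" using that by (simp add: upper_hp_def)
  qed
  show ?thesis
  proof (cases "f z = 0")
    case False
    have "norm (f z) = norm (f (- 1 / (- 1 / z)))" by simp
    also have "\<dots> = V * norm (- 1 / z) powr r * (V * norm z powr r * norm (f z))"
      by (simp only: S(1)[OF S(2)[OF z]] S(1)[OF z])
    also have "\<dots> = V\<^sup>2 * (norm (- 1 / z) * norm z) powr r * norm (f z)"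
      by (simp add: powr_mult power2_eq_square)
    also have "norm (- 1 / z) * norm z = 1" using S(3)[OF z] by (simp add: norm_divide)
    finally have "V\<^sup>2 = 1" using False by simp
    moreover have "V \<ge> 0" by (simp add: V_def)
    ultimately have "V = 1" by (simp add: power2_eq_1_iff)
    then show ?thesis using S(1)[OF z] by simp
  qed (use S(1)[OF z] in simp)
qed

text \<open>Below height $1/2$, a translation to $|\Re z| \le 1/2$ followed by $z \mapsto -1/z$ at least
  doubles the imaginary part, so the bound near the real line reduces to the one above height $1/2$.\<close>
lemma modular_form_growth:
  assumes r: "r > 0" and mf: "f \<in> modular_forms r v"
    and f: "\<And>z. z \<in> upper_hp \<Longrightarrow> fourier_term a \<kappa> z sums f z"
  obtains K where "K \<ge> 0" "\<And>z. z \<in> upper_hp \<Longrightarrow> norm (f z) \<le> K * (1 + Im z powr (- r))"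
proof -
  have af: "f \<in> automorphic_forms r v" using mf by (simp add: modular_forms_def)
  define K where "K = (\<Sum>m. norm (a m) * exp (- 2 * pi * (real m + \<kappa>) * (1 / 2)))"
  have Ks: "summable (\<lambda>m. norm (a m) * exp (- 2 * pi * (real m + \<kappa>) * (1 / 2)))"
    by (rule fourier_abs_summable[OF f]) simp_all
  have K: "K \<ge> 0" unfolding K_def by (rule suminf_nonneg[OF Ks]) simp
  have high: "norm (f z) \<le> K" if z: "z \<in> upper_hp" "Im z \<ge> 1 / 2" for z
  proof -
    have "norm (fourier_term a \<kappa> z m) \<le> norm (a m) * exp (- 2 * pi * (real m + \<kappa>) * (1 / 2))" for m
    proof (cases "real m + \<kappa> < 0")
      case True
      then show ?thesis using modular_form_coeff_zero[OF f mf] by simp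
    next
      case False
      then have "2 * pi * (real m + \<kappa>) * (1 / 2) \<le> 2 * pi * (real m + \<kappa>) * Im z"
        using z by (intro mult_left_mono) auto
      then show ?thesis unfolding norm_fourier_term by (intro mult_left_mono) auto
    qed
    then have "norm (\<Sum>m. fourier_term a \<kappa> z m) \<le> K"
      unfolding K_def by (intro norm_suminf_le Ks)
    then show ?thesis using f[OF z(1)] by (simp add: sums_iff)
  qed
  \<comment> \<open>The index \<open>n\<close> bounds the number of inversions needed to reach
    height \<open>1 / 2\<close>; for \<open>n = 0\<close> the two bounds on the height contradict
    each other.\<close>
  have low: "norm (f z) \<le> K * Im z powr (- r)"
    if "z \<in> upper_hp" "Im z < 1 / 2" "1 / 2 ^ n \<le> Im z" for z n
    using that
  proof (induction n arbitrary: z)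
    case 0
    then show ?case by simp
  next
    case (Suc n)
    define y where "y = Im z"
    have y: "0 < y" "y < 1 / 2" using Suc.prems by (auto simp: y_def upper_hp_def)
    define w where "w = z + of_int (- round (Re z))"
    have w: "w \<in> upper_hp" "Im w = y" "\<bar>Re w\<bar> \<le> 1 / 2"
      using Suc.prems(1) of_int_round_abs_le[of "Re z"]
      by (auto simp: w_def upper_hp_def y_def abs_minus_commute)
    have fw: "norm (f z) = norm (f w)"
      unfolding w_def by (rule norm_fourier_translate[OF f Suc.prems(1), symmetric])
    have w2: "(norm w)\<^sup>2 \<le> 1 / 2"
    proof -
      have "(Re w)\<^sup>2 \<le> (1 / 2)\<^sup>2" using w(3) by (subst abs_le_square_iff[symmetric]) simp
      moreover have "(Im w)\<^sup>2 \<le> (1 / 2)\<^sup>2" using w(2) y by (intro power_mono) auto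
      ultimately show ?thesis unfolding cmod_power2 by (simp add: power2_eq_square)
    qed
    have w0: "norm w > 0" using w(2) y by auto
    have w1: "norm w \<le> 1"
      by (rule power2_le_imp_le) (use w2 in auto)
    have wy: "y \<le> norm w" using abs_Im_le_cmod[of w] w(2) y by simp
    define y' where "y' = Im (- 1 / w)"
    have y': "y' = y / (norm w)\<^sup>2"
      unfolding y'_def by (simp add: Im_divide cmod_power2 w(2))
    have "y / (1 / 2) \<le> y / (norm w)\<^sup>2"
      using w2 w0 y by (intro divide_left_mono) auto
    then have y2: "2 * y \<le> y'" by (simp add: y')
    have inv: "norm (f w) = norm w powr (- r) * norm (f (- 1 / w))"
      using norm_automorphic_inversion[OF af w(1)] w0
      by (simp add: powr_minus field_simps)
    have up: "- 1 / w \<in> upper_hp" using y2 y by (simp add: upper_hp_def y'_def)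
    show ?case
    proof (cases "y' < 1 / 2")
      case False
      have "norm (f z) \<le> norm w powr (- r) * K"
        unfolding fw inv using high[OF up] False by (intro mult_left_mono) (auto simp: y'_def)
      also have "\<dots> \<le> y powr (- r) * K"
        using wy y r K by (intro mult_right_mono powr_mono2') auto
      finally show ?thesis by (simp add: y_def mult.commute)
    next
      case True
      have "1 / 2 ^ n \<le> y'"
      proof -
        have "1 / 2 ^ n = 2 * (1 / (2::real) ^ Suc n)" by simp
        then show ?thesis using Suc.prems(3) y2 unfolding y_def by linarith
      qed
      then have "norm (f (- 1 / w)) \<le> K * y' powr (- r)"
        using Suc.IH[OF up] True by (simp add: y'_def)
      then have "norm (f z) \<le> norm w powr (- r) * (K * y' powr (- r))"
        unfolding fw inv by (intro mult_left_mono) auto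
      \<comment> \<open>As \<open>y' = y / |w|^2\<close>, the powers of \<open>|w|\<close> combine
        to \<open>|w| powr r\<close>, which is at most 1. Hence the constant \<open>K\<close> does
        not deteriorate along the recursion.\<close>
      also have "\<dots> = K * (y powr (- r) * norm w powr r)"
        unfolding y' using w0 y
        by (simp add: powr_minus powr_divide powr_mult power2_eq_square field_simps)
      also have "\<dots> \<le> K * (y powr (- r) * 1)"
        using w0 w1 r K by (intro mult_left_mono powr_le1) auto
      finally show ?thesis by (simp add: y_def)
    qed
  qed
  show thesis
  proof (rule that[OF K])
    fix z assume z: "z \<in> upper_hp"
    show "norm (f z) \<le> K * (1 + Im z powr (- r))"
    proof (cases "Im z < 1 / 2")
      case True
      have "Im z > 0" using z by (simp add: upper_hp_def)
      then obtain n where "1 / Im z < 2 ^ n"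
        using real_arch_pow[of 2 "1 / Im z"] by auto
      then have "1 / 2 ^ n \<le> Im z" using \<open>Im z > 0\<close> by (simp add: field_simps)
      from low[OF z True this] show ?thesis using K by (simp add: algebra_simps)
    next
      case False
      have "0 \<le> K * Im z powr (- r)" using K by simp
      then show ?thesis using high[OF z] False by (simp add: algebra_simps)
    qed
  qed
qed

text \<open>The weight contributes \<open>(1 + |z|) powr r\<close> and the form
  \<open>y powr (- r)\<close>, whereas the space asks for a sum and not a product. The inequality
  \<open>2 * p * s \<le> p^2 + s^2\<close> splits the product; hence the exponent
  \<open>2 * r\<close>.\<close>

lemma modular_form_in_plus_D_minus_infty:
  assumes r: "r > 0" and mf: "f \<in> modular_forms r v"
    and f: "\<And>z. z \<in> upper_hp \<Longrightarrow> fourier_term a \<kappa> z sums f z"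
  shows "f \<in> plus_D_minus_infty r"
proof -
  obtain K where K: "K \<ge> 0" "\<And>z. z \<in> upper_hp \<Longrightarrow> norm (f z) \<le> K * (1 + Im z powr (- r))"
    using modular_form_growth[OF assms] by blast
  have "norm (plus_wt r f z) \<le> (K * (2 * 4 powr r + 1)) * (Im z powr (- (2 * r)) + norm z powr (2 * r))"
    if z: "z \<in> upper_hp" for z
  proof -
    define x y where "x = norm z" and "y = Im z"
    have y: "0 < y" "y \<le> x"
      using z abs_Im_le_cmod[of z] by (auto simp: upper_hp_def x_def y_def)
    have "norm (- \<i> - z) \<le> 1 + x"
      using norm_triangle_ineq4[of "- \<i>" z] by (simp add: x_def)
    then have n: "norm (- \<i> - z) powr r \<le> (1 + x) powr r"
      using r by (intro powr_mono2) auto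
    have "norm (plus_wt r f z) = norm (- \<i> - z) powr r * norm (f z)"
      by (simp add: plus_wt_def norm_mult norm_powr_real_powr')
    also have "\<dots> \<le> (1 + x) powr r * (K * (1 + y powr (- r)))"
      using n K(2)[OF z] by (intro mult_mono) (auto simp: y_def)
    also have "\<dots> = K * ((1 + x) powr r * (1 + y powr (- r)))" by simp
    also have "\<dots> \<le> K * ((2 * 4 powr r + 1) * (y powr (- (2 * r)) + x powr (2 * r)))"
    proof (rule mult_left_mono[OF _ K(1)])
      have sq: "t powr (2 * r) = (t powr r)\<^sup>2" if "t > 0" for t :: real
        using that by (simp add: power2_eq_square flip: powr_add)
      have four: "4 powr r = ((2::real) powr r)\<^sup>2"
        using powr_mult[of 2 2 r] by (simp add: power2_eq_square)
      have "1 + x \<le> 2 * max 1 x" by simp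
      then have a: "(1 + x) powr r \<le> 2 powr r * max 1 x powr r"
        using y r by (subst powr_mult[symmetric]) (auto intro!: powr_mono2)
      show "(1 + x) powr r * (1 + y powr (- r)) \<le> (2 * 4 powr r + 1) * (y powr (- (2 * r)) + x powr (2 * r))"
      proof (cases "y \<ge> 1")
        \<comment> \<open>Here \<open>y powr (- r)\<close> is at most 1 and
          \<open>|z| \<ge> y \<ge> 1\<close>, so the term in \<open>|z|\<close> suffices
          alone.\<close>
        case True
        then have x: "x \<ge> 1" using y by simp
        have "y powr (- r) \<le> 1" using powr_mono2'[of "- r" 1 y] True r by simp
        then have "(1 + x) powr r * (1 + y powr (- r)) \<le> (2 powr r * x powr r) * 2"
          using a x by (intro mult_mono) (auto simp: max_def)
        also have "\<dots> \<le> (4 powr r * x powr (2 * r)) * 2"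
          using x r by (intro mult_right_mono mult_mono powr_mono2 powr_mono) auto
        also have "\<dots> \<le> (2 * 4 powr r + 1) * (y powr (- (2 * r)) + x powr (2 * r))"
          by (simp add: algebra_simps)
        finally show ?thesis .
      next
        case False
        define s where "s = y powr (- r)"
        have s: "s \<ge> 1" using False y r by (simp add: s_def powr_minus one_le_inverse_iff powr_le1)
        have s2: "y powr (- (2 * r)) = s\<^sup>2"
          using y by (simp add: s_def power2_eq_square flip: powr_add)
        define p where "p = (1 + x) powr r"
        have "p\<^sup>2 \<le> (2 powr r * max 1 x powr r)\<^sup>2"
          unfolding p_def using a by (intro power_mono) auto
        also have "\<dots> = 4 powr r * (max 1 x powr r)\<^sup>2" by (simp add: power_mult_distrib four)
        also have "(max 1 x powr r)\<^sup>2 \<le> s\<^sup>2 + x powr (2 * r)"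
        proof (cases "x \<ge> 1")
          case True
          then show ?thesis using sq[of x] by (simp add: max_def)
        next
          case False
          then have "(max 1 x powr r)\<^sup>2 = 1" by (simp add: max_def)
          also have "1 \<le> s\<^sup>2" using s by simp
          finally show ?thesis by (simp add: add_increasing2)
        qed
        finally have p2: "p\<^sup>2 \<le> 4 powr r * (s\<^sup>2 + x powr (2 * r))" by simp
        have p0: "p \<ge> 0" by (simp add: p_def)
        have "p * (1 + s) \<le> p * (2 * s)" using s p0 by (intro mult_left_mono) auto
        also have "\<dots> \<le> p\<^sup>2 + s\<^sup>2"
          using sum_squares_bound[of p s] by (simp add: power2_eq_square)
        also have "\<dots> \<le> 4 powr r * (s\<^sup>2 + x powr (2 * r)) + (s\<^sup>2 + x powr (2 * r))"
          using p2 by (intro add_mono) auto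
        also have "\<dots> = (4 powr r + 1) * (s\<^sup>2 + x powr (2 * r))"
          by (simp add: algebra_simps)
        also have "\<dots> \<le> (2 * 4 powr r + 1) * (s\<^sup>2 + x powr (2 * r))"
          by (intro mult_right_mono) auto
        finally show ?thesis by (simp add: s2 p_def s_def)
      qed
    qed
    finally show ?thesis by (simp add: x_def y_def mult.assoc)
  qed
  moreover have "f holomorphic_on upper_hp"
    using mf by (simp add: modular_forms_def automorphic_forms_def)
  ultimately show ?thesis
    unfolding plus_D_minus_infty_def using r
    by (intro CollectI conjI exI[of _ "2 * r"] exI[of _ "K * (2 * 4 powr r + 1)"]) auto
qed

section \<open>The bilinear form on superpositions of kernels\<close>

lemma power_le_fact_exp:
  assumes "y \<ge> (0::real)"
  shows "y ^ j \<le> fact j * exp y"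
proof -
  have "sum (\<lambda>n. y ^ n /\<^sub>R fact n) {j} \<le> (\<Sum>n. y ^ n /\<^sub>R fact n)"
    by (rule sum_le_suminf[OF summable_exp_generic]) (use assms in auto)
  then show ?thesis by (simp add: exp_def field_simps)
qed

text \<open>Trades powers of \<open>n\<close> for powers of \<open>1 / (1 - x)\<close>. With
  \<open>y = (n + 1) * (1 - x)\<close> one has \<open>x ^ n \<le> exp (1 - y)\<close>, and
  \<open>y ^ j \<le> fact j * exp y\<close> removes the exponential.\<close>

lemma weighted_power_le:
  fixes x :: real
  assumes "0 \<le> x" "x < 1"
  shows "(real n + 1) ^ j * x ^ n \<le> fact j * exp 1 * (1 / (1 - x)) ^ j"
proof -
  define y where "y = (real n + 1) * (1 - x)"
  have y: "y \<ge> 0" using assms by (simp add: y_def)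
  have "x \<le> exp (- (1 - x))" using exp_ge_add_one_self[of "x - 1"] by simp
  then have "x ^ n \<le> exp (- (1 - x)) ^ n" using assms by (intro power_mono) auto
  also have "\<dots> = exp (real n * (- (1 - x)))" by (rule exp_of_nat_mult[symmetric])
  also have "\<dots> \<le> exp (1 - y)" using assms by (simp add: y_def algebra_simps)
  finally have xn: "x ^ n \<le> exp (1 - y)" .
  have "(real n + 1) ^ j * x ^ n = (1 / (1 - x)) ^ j * (y ^ j * x ^ n)"
    using assms by (simp add: y_def power_mult_distrib power_divide)
  also have "\<dots> \<le> (1 / (1 - x)) ^ j * ((fact j * exp y) * exp (1 - y))"
    using assms y by (intro mult_left_mono mult_mono power_le_fact_exp xn) auto
  also have "\<dots> = fact j * exp 1 * (1 / (1 - x)) ^ j"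
    by (simp add: exp_diff)
  finally show ?thesis .
qed

text \<open>For the disc point \<open>w\<close> of \<open>\<tau>\<close> this equals
  \<open>4 / (1 - |w|^2)\<close>, a bound for \<open>1 / (1 - |w|)\<close> that is easy to estimate
  in \<open>\<tau>\<close>.\<close>

abbreviation depth :: "complex \<Rightarrow> real" where
  "depth \<tau> \<equiv> (norm (\<tau> + \<i>))\<^sup>2 / Im \<tau>"

lemma disc_point:
  assumes "Im \<tau> > 0"
  shows "norm ((\<tau> - \<i>) / (\<tau> + \<i>)) < 1"
    "1 / (1 - norm ((\<tau> - \<i>) / (\<tau> + \<i>))) \<le> depth \<tau>"
    "upper_of_w ((\<tau> - \<i>) / (\<tau> + \<i>)) = \<tau>" "norm (\<tau> + \<i>) \<ge> 1"
proof -
  define w where "w = (\<tau> - \<i>) / (\<tau> + \<i>)"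
  have ne: "\<tau> + \<i> \<noteq> 0" using assms by (auto simp: complex_eq_iff)
  have sq: "(norm (\<tau> + \<i>))\<^sup>2 - (norm (\<tau> - \<i>))\<^sup>2 = 4 * Im \<tau>"
    unfolding cmod_power2 by (simp add: power2_eq_square algebra_simps)
  have "norm (\<tau> - \<i>) < norm (\<tau> + \<i>)"
    by (rule power2_less_imp_less) (use sq assms in auto)
  then show lt: "norm ((\<tau> - \<i>) / (\<tau> + \<i>)) < 1" using ne by (simp add: norm_divide)
  have w2: "1 - (norm w)\<^sup>2 = 4 * Im \<tau> / (norm (\<tau> + \<i>))\<^sup>2"
  proof -
    have "(norm w)\<^sup>2 = (norm (\<tau> - \<i>))\<^sup>2 / (norm (\<tau> + \<i>))\<^sup>2"
      by (simp only: w_def norm_divide power_divide)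
    then have "1 - (norm w)\<^sup>2 = ((norm (\<tau> + \<i>))\<^sup>2 - (norm (\<tau> - \<i>))\<^sup>2) / (norm (\<tau> + \<i>))\<^sup>2"
      using ne by (simp add: diff_divide_distrib)
    then show ?thesis unfolding sq .
  qed
  have w1: "norm w < 1" using lt by (simp add: w_def)
  have "1 - (norm w)\<^sup>2 = (1 - norm w) * (1 + norm w)" by (simp add: power2_eq_square algebra_simps)
  also have "\<dots> \<le> (1 - norm w) * 4" using w1 by (intro mult_left_mono) auto
  finally have "Im \<tau> / (norm (\<tau> + \<i>))\<^sup>2 \<le> 1 - norm w" using w2 by simp
  moreover have "Im \<tau> / (norm (\<tau> + \<i>))\<^sup>2 > 0" using assms ne by simp
  ultimately have "1 / (1 - norm w) \<le> 1 / (Im \<tau> / (norm (\<tau> + \<i>))\<^sup>2)"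
    by (intro divide_left_mono mult_pos_pos) (use w1 in auto)
  then show "1 / (1 - norm ((\<tau> - \<i>) / (\<tau> + \<i>))) \<le> depth \<tau>"
    by (simp add: w_def)
  have "1 + w = 2 * \<tau> / (\<tau> + \<i>)" "1 - w = 2 * \<i> / (\<tau> + \<i>)"
    using ne by (auto simp: w_def field_simps)
  then show "upper_of_w ((\<tau> - \<i>) / (\<tau> + \<i>)) = \<tau>"
    using ne by (simp add: upper_of_w_def w_def)
  have "1 \<le> \<bar>Im (\<tau> + \<i>)\<bar>" using assms by simp
  then show "norm (\<tau> + \<i>) \<ge> 1" using abs_Im_le_cmod[of "\<tau> + \<i>"] by linarith
qed

text \<open>Two arguments of absolute value below \<open>pi / 2\<close> add up without leaving the
  principal range.\<close>

lemma powr_mult_right_half: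
  assumes "Re x > 0" "Re y > 0"
  shows "(x * y) powr s = x powr s * (y::complex) powr s"
proof -
  have "x \<noteq> 0" "y \<noteq> 0" using assms by auto
  moreover have "\<bar>Im (Ln x)\<bar> < pi / 2" "\<bar>Im (Ln y)\<bar> < pi / 2"
    using assms Re_Ln_pos_lt_imp by auto
  ultimately have "Ln (x * y) = Ln x + Ln y"
    by (intro Ln_times_simple) auto
  then show ?thesis using \<open>x \<noteq> 0\<close> \<open>y \<noteq> 0\<close> by (simp add: powr_def exp_add[symmetric] algebra_simps)
qed

text \<open>With \<open>Bu = 2 / (1 - u)\<close>, \<open>A = (\<tau> + \<i>) / (2 * \<i>)\<close>
  and \<open>C = 1 - w * u\<close>, the two bases are \<open>\<i> * Bu\<close> and
  \<open>\<i> * (Bu * (A * C))\<close>. The powers of \<open>\<i>\<close> and \<open>Bu\<close>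
  cancel, provided the principal powers split over these products.\<close>

lemma disc_minus_kernel:
  assumes \<tau>: "Im \<tau> > 0" and u: "norm u < 1"
  shows "(\<i> - lower_of_u u) powr of_real r * (\<tau> - lower_of_u u) powr (- of_real r) =
    ((\<tau> + \<i>) / (2 * \<i>)) powr (- of_real r) * (1 - (\<tau> - \<i>) / (\<tau> + \<i>) * u) powr (- of_real r)"
proof -
  define w where "w = (\<tau> - \<i>) / (\<tau> + \<i>)"
  have ne: "\<tau> + \<i> \<noteq> 0" using \<tau> by (auto simp: complex_eq_iff)
  have u1: "1 - u \<noteq> 0" using u by auto
  define A where "A = (\<tau> + \<i>) / (2 * \<i>)"
  define C where "C = 1 - w * u"
  have wu: "norm (w * u) < 1"
  proof -
    have "norm w * norm u \<le> 1 * norm u"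
      using disc_point(1)[OF \<tau>] by (intro mult_right_mono) (auto simp: w_def)
    then show ?thesis using u by (simp add: norm_mult)
  qed
  have A: "Re A > 0" using \<tau> by (simp add: A_def Re_divide)
  have C: "Re C > 0" using wu complex_Re_le_cmod[of "w * u"] by (simp add: C_def)
  have it: "\<i> - lower_of_u u = \<i> * (2 / (1 - u))"
    using i_minus_lower_of_u[of u] u1 by simp
  have B: "Re (2 / (1 - u)) > 0"
  proof -
    have "Re (1 - u) > 0" using u complex_Re_le_cmod[of u] by simp
    moreover have "Re (2 / (1 - u)) = 2 * Re (1 - u) / (norm (1 - u))\<^sup>2"
      by (simp add: Re_divide cmod_power2)
    ultimately show ?thesis using u1 by simp
  qed
  define Bu where "Bu = 2 / (1 - u)"
  have tt: "\<tau> - lower_of_u u = \<i> * (Bu * (A * C))"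
  proof -
    have "\<tau> - lower_of_u u = ((\<tau> + \<i>) - (\<tau> - \<i>) * u) / (1 - u)"
      using u1 by (simp add: lower_of_u_def field_simps)
    also have "(\<tau> + \<i>) - (\<tau> - \<i>) * u = (\<tau> + \<i>) * C"
      using ne by (simp add: C_def w_def field_simps)
    also have "(\<tau> + \<i>) * C / (1 - u) = \<i> * (Bu * (A * C))"
    proof -
      have "x * C / y = \<i> * (2 / y * (x / (2 * \<i>) * C))" for x y :: complex
        by (cases "y = 0") (auto simp: field_simps)
      then show ?thesis by (simp only: Bu_def A_def)
    qed
    finally show ?thesis .
  qed
  have rot: "(\<i> * z) powr s = exp (\<i> * of_real pi / 2 * s) * z powr s" if "Im (\<i> * z) > 0" for z s
  proof -
    have "(- \<i> * (\<i> * z)) powr s = exp (- \<i> * of_real pi / 2 * s) * (\<i> * z) powr s"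
      by (rule powr_rotate_upper[OF that])
    then have "exp (\<i> * of_real pi / 2 * s) * z powr s = (exp (\<i> * of_real pi / 2 * s) * exp (- \<i> * of_real pi / 2 * s)) * (\<i> * z) powr s"
      by simp
    also have "exp (\<i> * of_real pi / 2 * s) * exp (- \<i> * of_real pi / 2 * s) = 1"
      by (simp flip: exp_add)
    finally show ?thesis by simp
  qed
  have Im1: "Im (\<i> * Bu) > 0" using B unfolding Bu_def[symmetric] by simp
  have "lower_of_u u \<in> lower_hp" using u by (rule lower_of_u_in)
  then have "Im (\<tau> - lower_of_u u) > 0" using \<tau> by (simp add: lower_hp_def)
  then have Im2: "Im (\<i> * (Bu * (A * C))) > 0" by (simp add: tt)
  have AC: "(A * C) powr s = A powr s * C powr s" for s by (rule powr_mult_right_half[OF A C])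
  have Bu: "Re Bu > 0" "Bu \<noteq> 0" using B unfolding Bu_def[symmetric] by auto
  have iBu: "Re (1 / Bu) > 0" using u complex_Re_le_cmod[of u] by (simp add: Bu_def)
  \<comment> \<open>Three arguments of right half-plane points could wrap around. Instead
    \<open>A * C\<close> is written as the product of \<open>Bu * (A * C)\<close> and
    \<open>1 / Bu\<close>, both in the right half-plane; for the former this is
    \<open>Im2\<close>.\<close>
  have X: "(Bu * (A * C)) powr s = Bu powr s * (A * C) powr s" for s
  proof -
    have "(Bu * (A * C) * (1 / Bu)) powr s = (Bu * (A * C)) powr s * (1 / Bu) powr s"
      by (rule powr_mult_right_half) (use Im2 iBu in simp_all)
    moreover have "(Bu * (1 / Bu)) powr s = Bu powr s * (1 / Bu) powr s"
      by (rule powr_mult_right_half[OF Bu(1) iBu])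
    ultimately show ?thesis using Bu(2) by (simp add: mult_ac)
  qed
  have e1: "exp (\<i> * of_real pi / 2 * of_real r) * exp (\<i> * of_real pi / 2 * (- of_real r)) = 1"
    by (simp flip: exp_add)
  have b1: "Bu powr of_real r * Bu powr (- of_real r) = 1"
    using Bu(2) by (simp add: powr_minus)
  have "(\<i> - lower_of_u u) powr of_real r * (\<tau> - lower_of_u u) powr (- of_real r) =
    (exp (\<i> * of_real pi / 2 * of_real r) * Bu powr of_real r) *
    (exp (\<i> * of_real pi / 2 * (- of_real r)) * (Bu powr (- of_real r) * (A powr (- of_real r) * C powr (- of_real r))))"
    unfolding tt it Bu_def[symmetric] rot[OF Im1] rot[OF Im2] X AC ..
  also have "\<dots> = (exp (\<i> * of_real pi / 2 * of_real r) * exp (\<i> * of_real pi / 2 * (- of_real r))) *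
     (Bu powr of_real r * Bu powr (- of_real r)) * (A powr (- of_real r) * C powr (- of_real r))"
    by (simp only: mult_ac)
  finally show ?thesis unfolding e1 b1 by (simp add: A_def C_def w_def)
qed

text \<open>The origin of the factor \<open>(-2i)^r\<close>: the base \<open>- \<i> - \<tau>\<close>
  is \<open>- 2 * \<i>\<close> times a point of the right half-plane, and the sum of the arguments
  stays between \<open>- pi\<close> and 0.\<close>

lemma plus_kernel:
  assumes "Im \<tau> > 0"
  shows "((\<tau> + \<i>) / (2 * \<i>)) powr (- of_real r) * (- \<i> - \<tau>) powr of_real r = (- 2 * \<i>) powr of_real r"
proof -
  define A where "A = (\<tau> + \<i>) / (2 * \<i>)"
  have A: "Re A > 0" using assms by (simp add: A_def Re_divide)
  have e: "- \<i> - \<tau> = (- 2 * \<i>) * A" by (simp add: A_def field_simps)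
  have A0: "A \<noteq> 0" using A by auto
  have "\<bar>Im (Ln A)\<bar> < pi / 2" using Re_Ln_pos_lt_imp[OF A] by simp
  moreover have "Ln (- 2 * \<i>) = of_real (ln 2) - \<i> * of_real pi / 2"
  proof -
    have "Ln 2 = complex_of_real (ln 2)" using Ln_of_real[of 2] by simp
    then show ?thesis using Ln_times_of_real[of 2 "- \<i>"] by simp
  qed
  ultimately have "Ln ((- 2 * \<i>) * A) = Ln (- 2 * \<i>) + Ln A"
    using A0 by (intro Ln_times_simple) auto
  then have "(- \<i> - \<tau>) powr of_real r = (- 2 * \<i>) powr of_real r * A powr of_real r"
    unfolding e using A0 by (simp add: powr_def exp_add[symmetric] algebra_simps)
  then show ?thesis using A0 by (simp add: A_def powr_minus)
qed


section \<open>Rapidly decaying superpositions of kernels\<close>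

lemma integrable_mult_bounded_pow:
  fixes \<psi> W :: "'a \<Rightarrow> complex"
  assumes "integrable M \<psi>" "W \<in> borel_measurable M" "\<And>x. x \<in> space M \<Longrightarrow> norm (W x) \<le> 1"
  shows "integrable M (\<lambda>x. \<psi> x * W x ^ n)"
proof (rule Bochner_Integration.integrable_bound[OF assms(1)])
  have [measurable]: "\<psi> \<in> borel_measurable M" using assms(1) by auto
  have [measurable]: "W \<in> borel_measurable M" by fact
  show "(\<lambda>x. \<psi> x * W x ^ n) \<in> borel_measurable M" by measurable
  show "AE x in M. norm (\<psi> x * W x ^ n) \<le> norm (\<psi> x)"
  proof (rule AE_I2)
    fix x assume "x \<in> space M"
    then have "norm (\<psi> x) * norm (W x) ^ n \<le> norm (\<psi> x) * 1"
      using assms(3) by (intro mult_left_mono power_le_one) auto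
    then show "norm (\<psi> x * W x ^ n) \<le> norm (\<psi> x)" by (simp add: norm_mult norm_power)
  qed
qed

lemma summable_weighted_plus_coeff:
  assumes "h \<in> plus_D_minus_infty r" "norm w < 1"
  shows "summable (\<lambda>n. norm (plus_coeff r h n * w ^ n))"
proof -
  have hol: "disc_plus r h holomorphic_on ball 0 1"
    using assms(1) by (intro disc_plus_holomorphic) (auto simp: plus_D_minus_infty_def)
  define q where "q = (1 + norm w) / 2"
  have q: "norm w < q" "q < 1" "0 < q" using assms(2) norm_ge_zero[of w] by (auto simp: q_def simp del: norm_ge_zero)
  have "summable (\<lambda>n. plus_coeff r h n * of_real q ^ n)"
    using fps_expansion_sums[OF hol, of "of_real q"] q by (auto simp: plus_coeff_def sums_iff)
  then show ?thesis by (rule powser_insidea) (use q in simp)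
qed

text \<open>The n-th coefficient of \<open>f^-\<close> is \<open>(r)_n / n!\<close> times the
  integral of \<open>\<psi> * W ^ n\<close>. The moment condition makes these integrals decay
  rapidly, which gives membership and lets the integral pass through the bracket series.\<close>

lemma bracket_disc_superposition:
  fixes \<psi> W :: "'a \<Rightarrow> complex"
  assumes r: "r > 0" and h: "h \<in> plus_D_minus_infty r"
    and \<psi>: "\<psi> \<in> borel_measurable M" and Wm: "W \<in> borel_measurable M"
    and W: "\<And>x. x \<in> space M \<Longrightarrow> norm (W x) < 1"
    and mom: "\<And>k. integrable M (\<lambda>x. norm (\<psi> x) * (1 / (1 - norm (W x))) ^ k)"
    and f: "\<And>u. norm u < 1 \<Longrightarrow> disc_minus r f u = (\<integral>x. \<psi> x * (1 - W x * u) powr (- of_real r) \<partial>M)"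
  shows "f \<in> minus_D_infty r" "bracket r h f = (\<integral>x. \<psi> x * disc_plus r h (W x) \<partial>M)"
proof -
  note [measurable] = \<psi> Wm
  have int\<psi>: "integrable M \<psi>"
    using mom[of 0] by (subst integrable_norm_iff[symmetric]) auto
  have intp: "integrable M (\<lambda>x. \<psi> x * W x ^ n)" for n
    by (rule integrable_mult_bounded_pow[OF int\<psi> Wm]) (use W in \<open>auto intro: less_imp_le\<close>)
  define m where "m n = (\<integral>x. \<psi> x * W x ^ n \<partial>M)" for n
  define N where "N n = (\<integral>x. norm (\<psi> x * W x ^ n) \<partial>M)" for n
  have mN: "norm (m n) \<le> N n" for n unfolding m_def N_def by (rule integral_norm_bound)
  have N0: "N n \<ge> 0" for n unfolding N_def by (rule integral_nonneg_AE) auto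
  define D where "D j = fact j * exp 1 * (\<integral>x. norm (\<psi> x) * (1 / (1 - norm (W x))) ^ j \<partial>M)" for j
  \<comment> \<open>This is where moments are converted: the j-th moment of
    \<open>1 / (1 - |W|)\<close> bounds the j-th power of \<open>n\<close>, uniformly in
    \<open>n\<close>.\<close>
  have decay: "(real n + 1) ^ j * N n \<le> D j" for n j
  proof -
    have "(real n + 1) ^ j * N n = (\<integral>x. (real n + 1) ^ j * norm (\<psi> x * W x ^ n) \<partial>M)"
      by (simp add: N_def)
    also have "\<dots> \<le> (\<integral>x. fact j * exp 1 * (norm (\<psi> x) * (1 / (1 - norm (W x))) ^ j) \<partial>M)"
    proof (intro integral_mono integrable_mult_right integrable_norm intp mom)
      fix x assume x: "x \<in> space M"
      have "norm (\<psi> x) * ((real n + 1) ^ j * norm (W x) ^ n) \<le>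
          norm (\<psi> x) * (fact j * exp 1 * (1 / (1 - norm (W x))) ^ j)"
        using W[OF x] by (intro mult_left_mono weighted_power_le) auto
      then show "(real n + 1) ^ j * norm (\<psi> x * W x ^ n) \<le> fact j * exp 1 * (norm (\<psi> x) * (1 / (1 - norm (W x))) ^ j)"
        by (simp add: norm_mult norm_power mult_ac)
    qed
    also have "\<dots> = D j" by (simp add: D_def)
    finally show ?thesis .
  qed
  have Nsum: "summable (\<lambda>n. (real n + 1) ^ k * N n)" for k
  proof (rule summable_comparison_test')
    show "summable (\<lambda>n. D (k + 2) * (1 / (real n + 1) ^ 2))"
      by (intro summable_mult summable_inverse_Suc_squares)
    fix n
    have "(real n + 1) ^ k * N n = ((real n + 1) ^ (k + 2) * N n) * (1 / (real n + 1) ^ 2)"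
      unfolding power_add by simp
    also have "\<dots> \<le> D (k + 2) * (1 / (real n + 1) ^ 2)"
      by (intro mult_right_mono decay) auto
    finally show "norm ((real n + 1) ^ k * N n) \<le> D (k + 2) * (1 / (real n + 1) ^ 2)"
      using N0[of n] by simp
  qed
  define d where "d n = of_real (pochhammer r n / fact n) * m n" for n
  have poch: "pochhammer r n / fact n \<ge> 0" for n using pochhammer_pos[OF r, of n] by simp
  have dsum: "summable (\<lambda>n. (real n + 1) ^ k * norm (d n))" for k
  proof (rule summable_comparison_test'[OF Nsum[of "k + nat \<lceil>r\<rceil>"]])
    fix n
    have "(real n + 1) ^ k * norm (d n) = (real n + 1) ^ k * (pochhammer r n / fact n * norm (m n))"
      using poch[of n] by (simp only: d_def norm_mult norm_of_real abs_of_nonneg)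
    also have "\<dots> \<le> (real n + 1) ^ k * ((real n + 1) ^ nat \<lceil>r\<rceil> * N n)"
      by (intro mult_left_mono mult_mono pochhammer_over_fact_le r mN) auto
    finally show "norm ((real n + 1) ^ k * norm (d n)) \<le> (real n + 1) ^ (k + nat \<lceil>r\<rceil>) * N n"
      by (simp add: power_add mult_ac)
  qed
  have dser: "(\<lambda>n. d n * u ^ n) sums disc_minus r f u" if u: "u \<in> ball 0 1" for u
  proof -
    have nu: "norm u < 1" using u by simp
    define F where "F n x = of_real (pochhammer r n / fact n) * u ^ n * (\<psi> x * W x ^ n)" for n x
    have "(\<lambda>n. \<integral>x. F n x \<partial>M) sums (\<integral>x. (\<Sum>n. F n x) \<partial>M)"
    proof (rule sums_integral)
      show "integrable M (F n)" for n unfolding F_def[abs_def] by (intro integrable_mult_right intp)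
      show "AE x in M. summable (\<lambda>n. norm (F n x))"
      proof (rule AE_I2)
        fix x assume "x \<in> space M"
        then have "norm (W x * u) < 1"
          using W[of x] nu mult_left_le[of "norm u" "norm (W x)"] by (simp add: norm_mult)
        then have "summable (\<lambda>n. norm (\<psi> x) * (\<bar>pochhammer r n / fact n\<bar> * norm (W x * u) ^ n))"
          by (intro summable_mult summable_pochhammer_power) auto
        then show "summable (\<lambda>n. norm (F n x))"
          by (simp add: F_def norm_mult norm_power norm_divide power_mult_distrib mult_ac)
      qed
      show "summable (\<lambda>n. \<integral>x. norm (F n x) \<partial>M)"
      proof (rule summable_comparison_test'[OF Nsum[of "nat \<lceil>r\<rceil>"]])
        fix n
        have "(\<integral>x. norm (F n x) \<partial>M) = pochhammer r n / fact n * norm u ^ n * N n"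
          unfolding F_def N_def norm_mult[of "_ * _ ^ n"] integral_mult_right_zero
          using poch[of n] by (simp only: norm_mult norm_power norm_of_real abs_of_nonneg)
        also have "\<dots> \<le> (real n + 1) ^ nat \<lceil>r\<rceil> * 1 * N n"
          using nu by (intro mult_mono mult_right_mono pochhammer_over_fact_le r power_le_one N0) auto
        finally show "norm (\<integral>x. norm (F n x) \<partial>M) \<le> (real n + 1) ^ nat \<lceil>r\<rceil> * N n"
          by (simp add: integral_nonneg_AE)
      qed
    qed
    also have "(\<lambda>n. \<integral>x. F n x \<partial>M) = (\<lambda>n. d n * u ^ n)"
      unfolding F_def integral_mult_right_zero d_def m_def by (simp only: mult_ac)
    also have "(\<integral>x. (\<Sum>n. F n x) \<partial>M) = disc_minus r f u"
      unfolding f[OF nu]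
    proof (rule Bochner_Integration.integral_cong[OF refl])
      fix x assume "x \<in> space M"
      then have "norm (W x * u) < 1"
        using W[of x] nu mult_left_le[of "norm u" "norm (W x)"] by (simp add: norm_mult)
      from sums_mult[OF one_minus_powr_sums[OF this, of r], of "\<psi> x"]
      have "(\<lambda>n. F n x) sums (\<psi> x * (1 - W x * u) powr (- of_real r))"
        by (simp add: F_def power_mult_distrib mult_ac)
      then show "(\<Sum>n. F n x) = \<psi> x * (1 - W x * u) powr (- of_real r)" by (simp add: sums_iff)
    qed
    finally show ?thesis .
  qed
  show f': "f \<in> minus_D_infty r" by (rule minus_D_infty_power_series(1)[OF dsum dser])
  have mc: "minus_coeff r f n = d n" for n by (rule minus_D_infty_power_series(2)[OF dsum dser])
  have "(\<lambda>n. of_real (fact n / pochhammer r n) * plus_coeff r h n * minus_coeff r f n) sums bracket r h f"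
    by (rule bracket_sums[OF r h f'])
  \<comment> \<open>The binomial coefficient of the kernel cancels the factor that defines the
    form.\<close>
  moreover have "of_real (fact n / pochhammer r n) * plus_coeff r h n * minus_coeff r f n = plus_coeff r h n * m n" for n
    using pochhammer_pos[OF r, of n] by (simp add: mc d_def)
  ultimately have s1: "(\<lambda>n. plus_coeff r h n * m n) sums bracket r h f" by simp
  obtain K L where K: "K \<ge> 0" and c: "\<And>n. norm (plus_coeff r h n) \<le> K * (real n + 1) ^ L"
    using plus_coeff_bound[OF h] by blast
  define G where "G n x = plus_coeff r h n * (\<psi> x * W x ^ n)" for n x
  \<comment> \<open>The polynomial growth of the coefficients of \<open>h^+\<close> is absorbed by
    the rapid decay of \<open>N\<close>, so sum and integral may be exchanged.\<close>
  have "(\<lambda>n. \<integral>x. G n x \<partial>M) sums (\<integral>x. (\<Sum>n. G n x) \<partial>M)"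
  proof (rule sums_integral)
    show "integrable M (G n)" for n unfolding G_def[abs_def] by (intro integrable_mult_right intp)
    show "AE x in M. summable (\<lambda>n. norm (G n x))"
    proof (rule AE_I2)
      fix x assume "x \<in> space M"
      from summable_mult[OF summable_weighted_plus_coeff[OF h W[OF this]], of "norm (\<psi> x)"]
      show "summable (\<lambda>n. norm (G n x))" by (simp add: G_def norm_mult mult_ac)
    qed
    show "summable (\<lambda>n. \<integral>x. norm (G n x) \<partial>M)"
    proof (rule summable_comparison_test'[OF summable_mult[OF Nsum[of L]]])
      fix n
      have "(\<integral>x. norm (G n x) \<partial>M) = norm (plus_coeff r h n) * N n"
        by (simp add: G_def N_def norm_mult)
      also have "\<dots> \<le> (K * (real n + 1) ^ L) * N n"
        by (intro mult_right_mono c N0)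
      finally show "norm (\<integral>x. norm (G n x) \<partial>M) \<le> K * ((real n + 1) ^ L * N n)"
        by (simp add: integral_nonneg_AE mult_ac)
    qed
  qed
  also have "(\<lambda>n. \<integral>x. G n x \<partial>M) = (\<lambda>n. plus_coeff r h n * m n)"
    by (simp add: G_def m_def)
  also have "(\<integral>x. (\<Sum>n. G n x) \<partial>M) = (\<integral>x. \<psi> x * disc_plus r h (W x) \<partial>M)"
  proof (rule Bochner_Integration.integral_cong[OF refl])
    fix x assume "x \<in> space M"
    have hol: "disc_plus r h holomorphic_on ball 0 1"
      using h by (intro disc_plus_holomorphic) (auto simp: plus_D_minus_infty_def)
    from sums_mult[OF fps_expansion_sums[OF hol W[OF \<open>x \<in> space M\<close>]], of "\<psi> x"]
    have "(\<lambda>n. G n x) sums (\<psi> x * disc_plus r h (W x))"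
      by (simp add: G_def plus_coeff_def mult_ac)
    then show "(\<Sum>n. G n x) = \<psi> x * disc_plus r h (W x)" by (simp add: sums_iff)
  qed
  finally show "bracket r h f = (\<integral>x. \<psi> x * disc_plus r h (W x) \<partial>M)"
    using sums_unique2[OF s1] by simp
qed

text \<open>The disc version transported to the half-plane: the constant in front of each kernel is
  moved into \<open>\<psi>\<close>, and \<open>plus_kernel\<close> recombines it with the weight of
  \<open>h\<close> into a factor that no longer depends on the point.\<close>

theorem bracket_superposition:
  fixes \<phi> \<tau> :: "'a \<Rightarrow> complex"
  assumes r: "r > 0" and h: "h \<in> plus_D_minus_infty r"
    and \<phi>: "\<phi> \<in> borel_measurable M" and \<tau>m: "\<tau> \<in> borel_measurable M"
    and \<tau>: "\<And>x. x \<in> space M \<Longrightarrow> Im (\<tau> x) > 0"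
    and mom: "\<And>k. integrable M (\<lambda>x. norm (\<phi> x) * depth (\<tau> x) ^ k)"
    and f: "\<And>t. t \<in> lower_hp \<Longrightarrow> f t = (\<integral>x. \<phi> x * (\<tau> x - t) powr (- of_real r) \<partial>M)"
  shows "bracket r h f = (- 2 * \<i>) powr of_real r * (\<integral>x. \<phi> x * h (\<tau> x) \<partial>M)"
proof -
  note [measurable] = \<phi> \<tau>m
  define \<psi> where "\<psi> x = \<phi> x * ((\<tau> x + \<i>) / (2 * \<i>)) powr (- of_real r)" for x
  define W where "W x = (\<tau> x - \<i>) / (\<tau> x + \<i>)" for x
  have [measurable]: "(\<lambda>z::complex. z powr s) \<in> borel_measurable borel" for s
    unfolding powr_def by measurable
  have [measurable]: "\<psi> \<in> borel_measurable M"
    unfolding \<psi>_def[abs_def] by measurable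
  have [measurable]: "W \<in> borel_measurable M" unfolding W_def[abs_def] by measurable
  have W: "norm (W x) < 1" if "x \<in> space M" for x
    unfolding W_def by (rule disc_point(1)[OF \<tau>[OF that]])
  have "bracket r h f = (\<integral>x. \<psi> x * disc_plus r h (W x) \<partial>M)"
  proof (rule bracket_disc_superposition(2)[OF r h _ _ W])
    show "integrable M (\<lambda>x. norm (\<psi> x) * (1 / (1 - norm (W x))) ^ k)" for k
    proof (rule Bochner_Integration.integrable_bound[OF integrable_mult_right[OF mom[of k], of "2 powr r"]])
      show "AE x in M. norm (norm (\<psi> x) * (1 / (1 - norm (W x))) ^ k)
          \<le> norm (2 powr r * (norm (\<phi> x) * depth (\<tau> x) ^ k))"
      proof (rule AE_I2)
        fix x assume x: "x \<in> space M"
        note p = disc_point[OF \<tau>[OF x]]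
        \<comment> \<open>The constants moved into \<open>\<psi>\<close> are bounded by
          \<open>2 powr r\<close>, because \<open>|\<tau> + \<i>| \<ge> 1\<close>; so the moments of
          \<open>\<phi>\<close> control those of \<open>\<psi>\<close>.\<close>
        have "norm (((\<tau> x + \<i>) / (2 * \<i>)) powr (- of_real r)) = (norm (\<tau> x + \<i>) / 2) powr (- r)"
          using norm_powr_real_powr'[of "- of_real r" "(\<tau> x + \<i>) / (2 * \<i>)"]
          by (simp add: norm_divide norm_mult)
        also have "\<dots> \<le> (1 / 2) powr (- r)"
          using p(4) r by (intro powr_mono2') auto
        also have "\<dots> = 2 powr r" by (simp add: powr_minus_divide powr_divide)
        finally have "norm (\<psi> x) \<le> 2 powr r * norm (\<phi> x)"
          unfolding \<psi>_def norm_mult by (subst mult.commute) (rule mult_right_mono, simp_all)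
        moreover have "(1 / (1 - norm (W x))) ^ k \<le> depth (\<tau> x) ^ k"
          unfolding W_def using p(1,2) by (intro power_mono) auto
        ultimately have "norm (\<psi> x) * (1 / (1 - norm (W x))) ^ k \<le>
            (2 powr r * norm (\<phi> x)) * depth (\<tau> x) ^ k"
          using W[OF x] by (intro mult_mono) auto
        moreover have "0 \<le> norm (\<psi> x) * (1 / (1 - norm (W x))) ^ k" using W[OF x] by simp
        ultimately show "norm (norm (\<psi> x) * (1 / (1 - norm (W x))) ^ k)
          \<le> norm (2 powr r * (norm (\<phi> x) * depth (\<tau> x) ^ k))"
          using \<tau>[OF x] by (simp only: real_norm_def abs_of_nonneg mult.assoc)
      qed
    qed measurable
    fix u :: complex assume u: "norm u < 1"
    have "disc_minus r f u = (\<i> - lower_of_u u) powr of_real r * (\<integral>x. \<phi> x * (\<tau> x - lower_of_u u) powr (- of_real r) \<partial>M)"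
      using f[OF lower_of_u_in[OF u]] by (simp add: disc_minus_def minus_wt_def)
    also have "\<dots> = (\<integral>x. \<phi> x * ((\<i> - lower_of_u u) powr of_real r * (\<tau> x - lower_of_u u) powr (- of_real r)) \<partial>M)"
      by (subst integral_mult_right_zero[symmetric]) (simp add: mult_ac)
    also have "\<dots> = (\<integral>x. \<psi> x * (1 - W x * u) powr (- of_real r) \<partial>M)"
      by (rule Bochner_Integration.integral_cong[OF refl])
         (simp add: disc_minus_kernel[OF \<tau> u] \<psi>_def W_def mult.assoc)
    finally show "disc_minus r f u = (\<integral>x. \<psi> x * (1 - W x * u) powr (- of_real r) \<partial>M)" .
  qed measurable
  also have "\<dots> = (\<integral>x. (- 2 * \<i>) powr of_real r * (\<phi> x * h (\<tau> x)) \<partial>M)"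
  proof (rule Bochner_Integration.integral_cong[OF refl])
    fix x assume x: "x \<in> space M"
    have "\<psi> x * disc_plus r h (W x) =
      (((\<tau> x + \<i>) / (2 * \<i>)) powr (- of_real r) * (- \<i> - \<tau> x) powr of_real r) * (\<phi> x * h (\<tau> x))"
      unfolding \<psi>_def disc_plus_def W_def disc_point(3)[OF \<tau>[OF x]] plus_wt_def by (simp only: mult_ac)
    then show "\<psi> x * disc_plus r h (W x) = (- 2 * \<i>) powr of_real r * (\<phi> x * h (\<tau> x))"
      unfolding plus_kernel[OF \<tau>[OF x]] .
  qed
  finally show ?thesis by (simp only: integral_mult_right_zero)
qed

section \<open>Sums and integrals over products\<close>

lemma has_sum_mult_pair:
  fixes f :: "'a \<Rightarrow> complex" and g :: "'b \<Rightarrow> complex"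
  assumes f: "(\<lambda>x. norm (f x)) summable_on A" "(f has_sum s) A" and g: "(\<lambda>y. norm (g y)) summable_on B" "(g has_sum t) B"
  shows "(\<lambda>p. norm (case p of (x, y) \<Rightarrow> f x * g y)) summable_on A \<times> B"
    "((\<lambda>(x, y). f x * g y) has_sum (s * t)) (A \<times> B)"
proof -
  show abs: "(\<lambda>p. norm (case p of (x, y) \<Rightarrow> f x * g y)) summable_on A \<times> B"
  proof (subst Infinite_Sum.abs_summable_on_Sigma_iff, intro conjI ballI)
    show "(\<lambda>y. norm (case (x, y) of (x, y) \<Rightarrow> f x * g y)) summable_on B" for x
      using summable_on_cmult_right[OF g(1), of "norm (f x)"] by (simp add: norm_mult)
    show "(\<lambda>x. norm (\<Sum>\<^sub>\<infinity>y\<in>B. norm (case (x, y) of (x, y) \<Rightarrow> f x * g y))) summable_on A"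
      using summable_on_cmult_left[OF f(1), of "infsum (\<lambda>y. norm (g y)) B"]
      by (simp add: norm_mult infsum_cmult_right' infsum_nonneg abs_mult)
  qed
  show "((\<lambda>(x, y). f x * g y) has_sum (s * t)) (A \<times> B)"
  proof (rule has_sum_SigmaI)
    show "((\<lambda>y. case (x, y) of (x, y) \<Rightarrow> f x * g y) has_sum (f x * t)) B" for x
      using has_sum_cmult_right[OF g(2), of "f x"] by simp
    show "((\<lambda>x. f x * t) has_sum (s * t)) A"
      by (rule has_sum_cmult_left[OF f(2)])
    show "(\<lambda>(x, y). f x * g y) summable_on A \<times> B"
      by (rule Infinite_Sum.abs_summable_summable[OF abs])
  qed
qed

lemma has_sum_triple:
  fixes a b c :: "nat \<Rightarrow> complex"
  assumes "summable (\<lambda>n. norm (a n))" "summable (\<lambda>n. norm (b n))" "summable (\<lambda>n. norm (c n))"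
  shows "(\<lambda>p. norm (case p of (i, j, k) \<Rightarrow> a i * b j * c k)) summable_on UNIV"
    "((\<lambda>(i, j, k). a i * b j * c k) has_sum (suminf a * suminf b * suminf c)) UNIV"
proof -
  have 1: "(\<lambda>n. norm (x n)) summable_on UNIV" "(x has_sum suminf x) UNIV" if "summable (\<lambda>n. norm (x n))" for x :: "nat \<Rightarrow> complex"
    using norm_summable_imp_summable_on[of "\<lambda>n. norm (x n)"] norm_summable_imp_has_sum[OF that]
      summable_sums[OF summable_norm_cancel[OF that]] that by auto
  note bc = has_sum_mult_pair[OF 1[OF assms(2)] 1[OF assms(3)]]
  note abc = has_sum_mult_pair[OF 1[OF assms(1)] bc]
  show "(\<lambda>p. norm (case p of (i, j, k) \<Rightarrow> a i * b j * c k)) summable_on UNIV"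
    using abc(1) by (simp add: case_prod_unfold mult.assoc)
  show "((\<lambda>(i, j, k). a i * b j * c k) has_sum (suminf a * suminf b * suminf c)) UNIV"
    using abc(2) by (simp add: case_prod_unfold mult.assoc)
qed

context pair_sigma_finite
begin

lemma integrable_tensor:
  fixes f :: "'a \<Rightarrow> 'c :: {real_normed_field, banach, second_countable_topology}" and g :: "'b \<Rightarrow> 'c"
  assumes f: "integrable M1 f" and g: "integrable M2 g"
  shows "integrable (M1 \<Otimes>\<^sub>M M2) (\<lambda>(x, y). f x * g y)"
proof (rule Fubini_integrable)
  have [measurable]: "f \<in> borel_measurable M1" "g \<in> borel_measurable M2" using f g by auto
  show "(\<lambda>(x, y). f x * g y) \<in> borel_measurable (M1 \<Otimes>\<^sub>M M2)" by measurable
  show "integrable M1 (\<lambda>x. \<integral>y. norm (case (x, y) of (x, y) \<Rightarrow> f x * g y) \<partial>M2)"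
    using f by (simp add: norm_mult)
  show "AE x in M1. integrable M2 (\<lambda>y. case (x, y) of (x, y) \<Rightarrow> f x * g y)"
    using g by simp
qed

lemma integral_tensor:
  fixes f :: "'a \<Rightarrow> 'c :: {real_normed_field, banach, second_countable_topology}" and g :: "'b \<Rightarrow> 'c"
  assumes f: "integrable M1 f" and g: "integrable M2 g"
  shows "(\<integral>p. f (fst p) * g (snd p) \<partial>(M1 \<Otimes>\<^sub>M M2)) = (\<integral>x. f x \<partial>M1) * (\<integral>y. g y \<partial>M2)"
proof -
  have "integrable (M1 \<Otimes>\<^sub>M M2) (\<lambda>p. f (fst p) * g (snd p))"
    using integrable_tensor[OF assms] by (simp add: case_prod_unfold)
  from integral_fst'[OF this] show ?thesis by simp
qed

end

lemma exp_half_line: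
  fixes c :: real
  assumes "c > 0"
  shows "integrable lborel (\<lambda>y. indicator {0..} y * exp (- c * y))"
    "(\<integral>y. indicator {0..} y * exp (- c * y) \<partial>lborel) = 1 / c"
  using nonneg_has_integral_imp_lborel[OF has_integral_exp_minus_to_infinity[OF assms, of 0]] by auto

text \<open>Half of the decay rate pays for the polynomial. The base \<open>3 + y\<close> is the
  bound used later for \<open>|mix_point p + \<i>|\<close>.\<close>

lemma poly_exp_half_line_integrable:
  fixes c :: real
  assumes c: "c > 0"
  shows "integrable lborel (\<lambda>y. indicator {0..} y * (exp (- c * y) * (3 + y) ^ n))"
proof -
  define d where "d = c / 2"
  have d: "d > 0" using c by (simp add: d_def)
  define K where "K = fact n * (1 / d) ^ n * exp (3 * d)"
  show ?thesis
  proof (rule Bochner_Integration.integrable_bound[OF integrable_mult_right[OF exp_half_line(1)[OF d], of K]])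
    show "AE y in lborel. norm (indicator {0..} y * (exp (- c * y) * (3 + y) ^ n))
        \<le> norm (K * (indicator {0..} y * exp (- d * y)))"
    proof (rule AE_I2)
      fix y :: real
      show "norm (indicator {0..} y * (exp (- c * y) * (3 + y) ^ n)) \<le> norm (K * (indicator {0..} y * exp (- d * y)))"
      proof (cases "y \<ge> 0")
        case True
        have "(3 + y) ^ n = (1 / d) ^ n * (d * (3 + y)) ^ n"
          using d by (simp add: power_mult_distrib power_divide)
        also have "\<dots> \<le> (1 / d) ^ n * (fact n * exp (d * (3 + y)))"
          using d True by (intro mult_left_mono power_le_fact_exp) auto
        finally have "exp (- c * y) * (3 + y) ^ n \<le> exp (- c * y) * ((1 / d) ^ n * (fact n * exp (d * (3 + y))))"
          by (intro mult_left_mono) auto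
        also have "\<dots> = K * (exp (- c * y) * exp (d * y))"
          by (simp add: K_def ring_distribs exp_add mult_ac)
        also have "exp (- c * y) * exp (d * y) = exp (- d * y)"
          by (simp add: d_def exp_add[symmetric])
        finally have "exp (- c * y) * (3 + y) ^ n \<le> K * exp (- d * y)" .
        then show ?thesis using True d by (simp add: K_def abs_mult)
      qed simp
    qed
  qed measurable
qed

lemma rho_eq: "rho = Complex (1 / 2) (sqrt 3 / 2)"
  by (simp add: rho_def exp_eq_polar cos_60 sin_60 complex_eq_iff Re_exp Im_exp)

text \<open>The endpoints are \<open>-1/2\<close> and \<open>1/2\<close> at height
  \<open>sqrt 3 / 2\<close>, so the height gives the exponential and the difference of conjugate
  phases gives a sine.\<close>

lemma exp_segment_integral:
  fixes k :: real
  shows "(\<integral>x. indicator {0..1} x *\<^sub>R fourier_exp k (rho - 1 + of_real x) \<partial>lborel) =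
    of_real (exp (- pi * sqrt 3 * k) * sinc (pi * k))"
proof -
  let ?f = "\<lambda>x::real. fourier_exp k (rho - 1 + of_real x)"
  have "set_integrable lborel {0..1} ?f"
    by (intro borel_integrable_atLeastAtMost' continuous_intros)
  from set_borel_integral_eq_integral(2)[OF this]
  have e: "(\<integral>x. indicator {0..1} x *\<^sub>R ?f x \<partial>lborel) = integral {0..1} ?f"
    by (simp add: set_lebesgue_integral_def)
  show ?thesis
  proof (cases "k = 0")
    case True
    then show ?thesis unfolding e by (simp add: sinc_def)
  next
    case False
    define C where "C = 2 * of_real pi * \<i> * complex_of_real k"
    have C: "C \<noteq> 0" using False by (simp add: C_def)
    have "(?f has_integral (exp (C * (rho - 1 + of_real 1)) / C - exp (C * (rho - 1 + of_real 0)) / C)) {0..1}"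
    proof (rule fundamental_theorem_of_calculus)
      fix x :: real
      have "((\<lambda>z. exp (C * (rho - 1 + z)) / C) has_field_derivative exp (C * (rho - 1 + of_real x))) (at (of_real x))"
        using C by (auto intro!: derivative_eq_intros)
      from has_vector_derivative_real_field[OF this, of "{0..1}"]
      show "((\<lambda>x. exp (C * (rho - 1 + of_real x)) / C) has_vector_derivative ?f x) (at x within {0..1})"
        by (simp add: C_def)
    qed simp
    then have i: "integral {0..1} ?f = (exp (C * rho) - exp (C * (rho - 1))) / C"
      by (simp add: integral_unique diff_divide_distrib)
    have r1: "C * rho = of_real (- pi * sqrt 3 * k) + \<i> * of_real (pi * k)"
      "C * (rho - 1) = of_real (- pi * sqrt 3 * k) + \<i> * of_real (- (pi * k))"
      by (simp_all add: C_def rho_eq complex_eq_iff)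
    have "exp (C * rho) - exp (C * (rho - 1)) = of_real (exp (- pi * sqrt 3 * k)) * (cis (pi * k) - cis (- (pi * k)))"
      unfolding r1 exp_add exp_of_real cis_conv_exp by (simp add: algebra_simps)
    also have "cis (pi * k) - cis (- (pi * k)) = 2 * \<i> * of_real (sin (pi * k))"
      by (simp add: complex_eq_iff)
    finally show ?thesis
      unfolding e i using False by (simp add: C_def sinc_def)
  qed
qed

lemma Psi_eq_beta_weight:
  "Psi r1 r2 \<mu>1 \<mu>2 \<mu>3 =
     of_real (exp (- 2 * pi * \<mu>2 - pi * sqrt 3 * (\<mu>1 + \<mu>3))) / (2 * of_real pi * \<i>) *
     of_real (\<integral>u. beta_weight (2 - r1) (2 - r2) u *
        (exp (- pi * (2 - sqrt 3) * \<mu>3 * u) / (\<mu>2 + \<mu>3 * u) * sinc (pi * (\<mu>1 + (1 - u) * \<mu>3))) \<partial>lborel)"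
  unfolding Psi_def set_lebesgue_integral_def beta_weight_def by (simp add: mult_ac)

text \<open>Substitution of \<open>\<mu>3 * u\<close> for \<open>u\<close>: the two powers release
  \<open>\<mu>3\<close> to the exponent \<open>(1 - r2) + (1 - r1) = r3 - 2\<close>, and the
  differential adds one more.\<close>

lemma Psi_rescale:
  assumes "\<mu>3 > 0" and r: "r1 + r2 + r3 = 4"
  shows "(LINT u:{0..1}|lborel. u powr (1 - r2) * (1 - u) powr (1 - r1) *
        (exp (- pi * (2 - sqrt 3) * \<mu>3 * u) / (\<mu>2 + \<mu>3 * u)) *
        sinc (pi * (\<mu>1 + (1 - u) * \<mu>3))) =
    \<mu>3 powr (1 - r3) *
          (LINT u:{0..\<mu>3}|lborel. u powr (1 - r2) * (\<mu>3 - u) powr (1 - r1) *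
             (exp (- pi * (2 - sqrt 3) * u) / (\<mu>2 + u)) *
             sinc (pi * (\<mu>1 + \<mu>3 - u)))"
proof -
  define F where "F = (\<lambda>u. indicator {0..\<mu>3} u *\<^sub>R (u powr (1 - r2) * (\<mu>3 - u) powr (1 - r1) *
             (exp (- pi * (2 - sqrt 3) * u) / (\<mu>2 + u)) * sinc (pi * (\<mu>1 + \<mu>3 - u))))"
  define G where "G = (\<lambda>u. indicator {0..1} u *\<^sub>R (u powr (1 - r2) * (1 - u) powr (1 - r1) *
        (exp (- pi * (2 - sqrt 3) * \<mu>3 * u) / (\<mu>2 + \<mu>3 * u)) * sinc (pi * (\<mu>1 + (1 - u) * \<mu>3))))"
  have FG: "F (0 + \<mu>3 * u) = \<mu>3 powr (r3 - 2) * G u" for u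
  proof (cases "u \<in> {0..1}")
    case True
    then have u: "0 \<le> u" "u \<le> 1" by auto
    have "\<mu>3 * u \<le> \<mu>3 * 1" using u assms by (intro mult_left_mono) auto
    then have i: "\<mu>3 * u \<in> {0..\<mu>3}" using u assms by simp
    have p1: "(\<mu>3 * u) powr (1 - r2) = \<mu>3 powr (1 - r2) * u powr (1 - r2)"
      using u assms by (simp add: powr_mult)
    have "(\<mu>3 - \<mu>3 * u) = \<mu>3 * (1 - u)" by (simp add: algebra_simps)
    then have p2: "(\<mu>3 - \<mu>3 * u) powr (1 - r1) = \<mu>3 powr (1 - r1) * (1 - u) powr (1 - r1)"
      using u assms by (simp add: powr_mult)
    have p3: "\<mu>3 powr (1 - r2) * \<mu>3 powr (1 - r1) = \<mu>3 powr (r3 - 2)"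
    proof -
      have "1 - r2 + (1 - r1) = r3 - 2" using r by simp
      then show ?thesis by (simp only: powr_add[symmetric])
    qed
    have p4: "\<mu>1 + \<mu>3 - \<mu>3 * u = \<mu>1 + (1 - u) * \<mu>3" by (simp add: algebra_simps)
    show ?thesis
      using True i unfolding F_def G_def add_0_left p1 p2 p3[symmetric] p4 by (simp add: mult_ac)
  next
    case False
    then have "\<mu>3 * u \<notin> {0..\<mu>3}" using assms by (auto simp: zero_le_mult_iff)
    then show ?thesis using False by (simp add: F_def G_def)
  qed
  have "(\<integral>u. F u \<partial>lborel) = \<bar>\<mu>3\<bar> *\<^sub>R (\<integral>u. F (0 + \<mu>3 * u) \<partial>lborel)"
    by (rule lborel_integral_real_affine) (use assms in simp)
  also have "\<dots> = \<mu>3 * \<mu>3 powr (r3 - 2) * (\<integral>u. G u \<partial>lborel)"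
    unfolding FG using assms by simp
  also have "\<mu>3 * \<mu>3 powr (r3 - 2) = \<mu>3 powr (r3 - 1)"
    using assms by (simp add: powr_mult_base)
  finally have "\<mu>3 powr (1 - r3) * (\<integral>u. F u \<partial>lborel) = (\<mu>3 powr (1 - r3) * \<mu>3 powr (r3 - 1)) * (\<integral>u. G u \<partial>lborel)"
    by simp
  also have "\<mu>3 powr (1 - r3) * \<mu>3 powr (r3 - 1) = 1"
    using assms by (simp flip: powr_add)
  finally show ?thesis unfolding F_def G_def set_lebesgue_integral_def by simp
qed

section \<open>The trilinear form\<close>

abbreviation lborel3 :: "(real \<times> real \<times> real) measure" where
  "lborel3 \<equiv> lborel \<Otimes>\<^sub>M (lborel \<Otimes>\<^sub>M lborel)"

definition seg_point :: "real \<Rightarrow> complex" where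
  "seg_point x = rho - 1 + of_real x"

definition ray_point :: "real \<Rightarrow> complex" where
  "ray_point y = \<i> + \<i> * of_real y"

definition clamp01 :: "real \<Rightarrow> real" where
  "clamp01 x = max 0 (min 1 x)"

text \<open>The clamping keeps the point in the upper half-plane for all parameters.\<close>
definition mix_point :: "real \<times> real \<times> real \<Rightarrow> complex" where
  "mix_point = (\<lambda>(u, x, y). (1 - of_real (clamp01 u)) * seg_point (clamp01 x) +
     of_real (clamp01 u) * ray_point (max 0 y))"

lemma clamp01: "0 \<le> clamp01 x" "clamp01 x \<le> 1" "x \<in> {0..1} \<Longrightarrow> clamp01 x = x"
  by (auto simp: clamp01_def)

lemma mix_point_eq:
  "u \<in> {0..1} \<Longrightarrow> x \<in> {0..1} \<Longrightarrow> y \<in> {0..} \<Longrightarrow>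
    mix_point (u, x, y) = (1 - of_real u) * seg_point x + of_real u * ray_point y"
  by (simp add: mix_point_def clamp01 max_def)

lemma Im_seg_point [simp]: "Im (seg_point x) = sqrt 3 / 2"
  by (simp add: seg_point_def rho_eq)

lemma Im_ray_point [simp]: "Im (ray_point y) = 1 + y"
  by (simp add: ray_point_def)

lemma seg_point_in [simp]: "seg_point x \<in> upper_hp"
  by (simp add: upper_hp_def)

lemma ray_point_in: "y \<ge> 0 \<Longrightarrow> ray_point y \<in> upper_hp"
  by (simp add: upper_hp_def)

lemma sqrt3_bounds: "1 / 2 \<le> sqrt 3 / 2" "sqrt 3 / 2 \<le> 1"
proof -
  have "1 \<le> sqrt 3" "sqrt 3 \<le> 2" by (auto intro: real_le_rsqrt real_le_lsqrt)
  then show "1 / 2 \<le> sqrt 3 / 2" "sqrt 3 / 2 \<le> 1" by simp_all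
qed

lemma Im_mix_point: "sqrt 3 / 2 \<le> Im (mix_point p)"
proof -
  obtain u x y where p: "p = (u, x, y)" by (cases p)
  define c where "c = clamp01 u"
  have c: "0 \<le> c" "c \<le> 1" using clamp01 by (auto simp: c_def)
  have "sqrt 3 / 2 = (1 - c) * (sqrt 3 / 2) + c * (sqrt 3 / 2)" by (simp add: field_simps)
  also have "\<dots> \<le> (1 - c) * (sqrt 3 / 2) + c * (1 + max 0 y)"
    using c sqrt3_bounds(2) by (intro add_left_mono mult_left_mono) auto
  also have "\<dots> = Im (mix_point p)"
    by (simp add: mix_point_def p c_def)
  finally show ?thesis .
qed

lemma Im_mix_point_pos: "Im (mix_point p) > 0"
  using Im_mix_point[of p] sqrt3_bounds by linarith

lemma norm_seg_point:
  assumes "x \<in> {0..1}"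
  shows "norm (seg_point x) \<le> 1"
proof (rule power2_le_imp_le)
  have "x * x \<le> x * 1" using assms by (intro mult_left_mono) auto
  then show "(norm (seg_point x))\<^sup>2 \<le> 1\<^sup>2"
    unfolding cmod_power2 by (simp add: seg_point_def rho_eq power2_eq_square algebra_simps)
qed simp

lemma norm_mix_point: "norm (mix_point (u, x, y)) \<le> 1 + max 0 y"
proof -
  have 1: "norm (seg_point (clamp01 x)) \<le> 1 + max 0 y"
    using norm_seg_point[of "clamp01 x"] clamp01[of x] by simp
  have "ray_point (max 0 y) = \<i> * of_real (1 + max 0 y)"
    by (simp add: ray_point_def algebra_simps)
  then have "norm (ray_point (max 0 y)) = \<bar>1 + max 0 y\<bar>"
    by (simp only: norm_mult norm_of_real) simp
  then have 2: "norm (ray_point (max 0 y)) \<le> 1 + max 0 y" by simp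
  show ?thesis
    unfolding mix_point_def prod.case by (rule norm_segment_le[OF 1 2]) (simp add: clamp01)
qed

lemma mix_point_measurable [measurable]:
  "mix_point \<in> borel_measurable lborel3"
  unfolding mix_point_def[abs_def] clamp01_def[abs_def] seg_point_def[abs_def] ray_point_def[abs_def]
  by measurable

lemma cint_seg:
  assumes f: "continuous_on upper_hp f" and t: "t \<in> lower_hp"
  shows "integrable lborel (\<lambda>x. indicator {0..1} x *\<^sub>R (f (seg_point x) * (seg_point x - t) powr of_real (r - 2)))"
    and "cint r f (rho - 1) rho t =
      (\<integral>x. indicator {0..1} x *\<^sub>R (f (seg_point x) * (seg_point x - t) powr of_real (r - 2)) \<partial>lborel)"
proof -
  let ?F = "\<lambda>x. f (seg_point x) * (seg_point x - t) powr of_real (r - 2)"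
  have c: "continuous_on A seg_point" for A
    unfolding seg_point_def[abs_def] by (intro continuous_intros)
  have pos: "Im (seg_point x - t) > 0" for x
  proof -
    have "Im (seg_point x - t) = sqrt 3 / 2 - Im t" by simp
    moreover have "Im t < 0" using t by (simp add: lower_hp_def)
    ultimately show ?thesis using sqrt3_bounds(1) by linarith
  qed
  have pw: "continuous_on {z. Im z > 0} (\<lambda>z. z powr of_real (r - 2))"
    by (intro holomorphic_on_imp_continuous_on holomorphic_intros) (auto simp: complex_nonpos_Reals_iff)
  have "continuous_on {0..1} ?F"
    by (intro continuous_on_mult continuous_on_compose2[OF f c] continuous_on_compose2[OF pw]
        continuous_on_diff c continuous_on_const) (use pos in auto)
  then have si: "set_integrable lborel {0..1} ?F"
    by (rule borel_integrable_atLeastAtMost')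
  then show "integrable lborel (\<lambda>x. indicator {0..1} x *\<^sub>R ?F x)"
    by (simp add: set_integrable_def)
  have "cint r f (rho - 1) rho t = integral {0..1} ?F"
    unfolding cint_def contour_integral_integral
    by (intro integral_cong) (simp add: linepath_def seg_point_def scaleR_conv_of_real algebra_simps)
  then show "cint r f (rho - 1) rho t = (\<integral>x. indicator {0..1} x *\<^sub>R ?F x \<partial>lborel)"
    using set_borel_integral_eq_integral(2)[OF si] by (simp add: set_lebesgue_integral_def)
qed

lemma sums_norm_bound:
  assumes "f sums (s :: complex)" "\<And>n. norm (f n) \<le> g n" "summable g"
  shows "norm s \<le> suminf g"
  using norm_suminf_le[OF assms(2,3)] assms(1) by (simp add: sums_iff)

section \<open>The setting and the majorants of the three Fourier series\<close>

locale fourier_triple =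
  fixes r1 r2 r3 \<kappa>1 \<kappa>2 \<kappa>3 :: real and f1 f2 f3 :: "complex \<Rightarrow> complex"
    and v1 v2 v3 :: "int \<Rightarrow> int \<Rightarrow> int \<Rightarrow> int \<Rightarrow> complex" and a1 a2 a3 :: "nat \<Rightarrow> complex"
  assumes r1: "r1 < 2" and r2: "r2 < 2" and r3: "r3 > 0" and rsum: "r1 + r2 + r3 = 4"
    and f1: "f1 \<in> automorphic_forms r1 v1" and f2: "f2 \<in> cusp_forms r2 v2"
    and f3: "f3 \<in> modular_forms r3 v3"
    and s1: "z \<in> upper_hp \<Longrightarrow> fourier_term a1 \<kappa>1 z sums f1 z"
    and s2: "z \<in> upper_hp \<Longrightarrow> fourier_term a2 \<kappa>2 z sums f2 z"
    and s3: "z \<in> upper_hp \<Longrightarrow> fourier_term a3 \<kappa>3 z sums f3 z"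
begin

abbreviation weight :: "real \<Rightarrow> real" where
  "weight \<equiv> beta_weight (2 - r1) (2 - r2)"

lemma continuous: "continuous_on upper_hp f1" "continuous_on upper_hp f2" "continuous_on upper_hp f3"
  using f1 f2 f3 by (auto simp: cusp_forms_def modular_forms_def automorphic_forms_def
      intro: holomorphic_on_imp_continuous_on)

text \<open>\<open>2 * pi\<close> times the least positive frequency. Every frequency occurring in a
  cusp form is at least that one, so this is a decay rate for \<open>f2\<close> along the
  ray.\<close>

definition rate :: real where
  "rate = 2 * pi * (real (LEAST m. real m + \<kappa>2 > 0) + \<kappa>2)"

lemma rate_pos: "rate > 0"
proof -
  obtain m :: nat where "real m > - \<kappa>2" using reals_Archimedean2 by blast
  then have "real m + \<kappa>2 > 0" by simp
  then have "real (LEAST m. real m + \<kappa>2 > 0) + \<kappa>2 > 0" by (rule LeastI)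
  then show ?thesis by (simp add: rate_def)
qed

lemma rate_le: "real m + \<kappa>2 > 0 \<Longrightarrow> rate \<le> 2 * pi * (real m + \<kappa>2)"
  unfolding rate_def by (intro mult_left_mono add_right_mono) (auto intro: Least_le)

text \<open>The heights are the lowest ones met: \<open>sqrt 3 / 2\<close> on the segment, 1 at the
  foot of the ray, and \<open>sqrt 3 / 2\<close> for the convex combinations of their
  points.\<close>

definition "b1 m = norm (a1 m) * exp (- 2 * pi * (real m + \<kappa>1) * (sqrt 3 / 2))"
definition "b2 m = norm (a2 m) * exp (- 2 * pi * (real m + \<kappa>2) * 1)"
definition "b3 m = norm (a3 m) * exp (- 2 * pi * (real m + \<kappa>3) * (sqrt 3 / 2))"

lemma b_summable: "summable b1" "summable b2" "summable b3"
  unfolding b1_def[abs_def] b2_def[abs_def] b3_def[abs_def]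
  by (rule fourier_abs_summable[OF s1] fourier_abs_summable[OF s2] fourier_abs_summable[OF s3]; simp)+

lemma b_nonneg: "b1 m \<ge> 0" "b2 m \<ge> 0" "b3 m \<ge> 0"
  by (simp_all add: b1_def b2_def b3_def)

lemma norm_term1: "norm (fourier_term a1 \<kappa>1 (seg_point x) m) \<le> b1 m"
  unfolding norm_fourier_term b1_def by simp

text \<open>Cuspidality removes the nonpositive frequencies; the remaining ones are at least
  \<open>rate / (2 * pi)\<close>, which gives a decay uniform in \<open>m\<close>.\<close>

lemma norm_term2:
  assumes "y \<ge> 0"
  shows "norm (fourier_term a2 \<kappa>2 (ray_point y) m) \<le> b2 m * exp (- rate * y)"
proof (cases "real m + \<kappa>2 \<le> 0")
  case True
  then show ?thesis using cusp_form_coeff_zero[OF s2 f2] by (simp add: b2_def)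
next
  case False
  then have "rate * y \<le> 2 * pi * (real m + \<kappa>2) * y"
    using assms by (intro mult_right_mono rate_le) auto
  then have "exp (- 2 * pi * (real m + \<kappa>2) * Im (ray_point y)) \<le> exp (- 2 * pi * (real m + \<kappa>2) * 1) * exp (- rate * y)"
    by (simp add: exp_add[symmetric] algebra_simps)
  then have "norm (a2 m) * exp (- 2 * pi * (real m + \<kappa>2) * Im (ray_point y)) \<le>
      norm (a2 m) * (exp (- 2 * pi * (real m + \<kappa>2) * 1) * exp (- rate * y))"
    by (rule mult_left_mono) simp
  then show ?thesis
    unfolding norm_fourier_term b2_def by (simp only: mult.assoc)
qed

text \<open>Frequencies with nonzero coefficient are nonnegative, so the terms do not grow with the
  height and the lowest level bounds them.\<close>

lemma norm_term3:
  assumes "Im z \<ge> sqrt 3 / 2"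
  shows "norm (fourier_term a3 \<kappa>3 z m) \<le> b3 m"
proof (cases "real m + \<kappa>3 < 0")
  case True
  then show ?thesis using modular_form_coeff_zero[OF s3 f3] by (simp add: b3_def)
next
  case False
  then have "2 * pi * (real m + \<kappa>3) * (sqrt 3 / 2) \<le> 2 * pi * (real m + \<kappa>3) * Im z"
    using assms by (intro mult_left_mono) auto
  then show ?thesis unfolding norm_fourier_term b3_def by (intro mult_left_mono) auto
qed

lemma norm_f1: "norm (f1 (seg_point x)) \<le> suminf b1"
  by (rule sums_norm_bound[OF s1[OF seg_point_in] norm_term1 b_summable(1)])

lemma norm_f2: "y \<ge> 0 \<Longrightarrow> norm (f2 (ray_point y)) \<le> suminf b2 * exp (- rate * y)"
  using sums_norm_bound[OF s2[OF ray_point_in] norm_term2 summable_mult2[OF b_summable(2)], of y]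
  by (simp add: suminf_mult2[OF b_summable(2)])

definition g1 :: "real \<Rightarrow> complex" where
  "g1 x = indicator {0..1} x *\<^sub>R f1 (seg_point x)"

definition g2 :: "real \<Rightarrow> complex" where
  "g2 y = indicator {0..} y *\<^sub>R f2 (ray_point y)"

lemma g_measurable [measurable]: "g1 \<in> borel_measurable borel" "g2 \<in> borel_measurable borel"
proof -
  have "continuous_on {0..1} (\<lambda>x. f1 (seg_point x))"
    by (rule continuous_on_compose2[OF continuous(1)])
       (auto simp: seg_point_def[abs_def] rho_eq upper_hp_def intro!: continuous_intros)
  then show "g1 \<in> borel_measurable borel"
    unfolding g1_def[abs_def] by (intro borel_measurable_continuous_on_indicator) auto
  have "continuous_on {0..} (\<lambda>y. f2 (ray_point y))"
    by (rule continuous_on_compose2[OF continuous(2)])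
       (auto simp: ray_point_def[abs_def] upper_hp_def intro!: continuous_intros)
  then show "g2 \<in> borel_measurable borel"
    unfolding g2_def[abs_def] by (intro borel_measurable_continuous_on_indicator) auto
qed

text \<open>The factor \<open>\<i>\<close> is the derivative of \<open>ray_point\<close>.\<close>

definition density :: "real \<times> real \<times> real \<Rightarrow> complex" where
  "density = (\<lambda>(u, x, y). \<i> * of_real (weight u) * (g1 x * g2 y))"

text \<open>The common majorant on the parameter space. Exponent 0 dominates the density itself;
  higher exponents absorb powers of \<open>depth\<close>.\<close>

definition dom :: "nat \<Rightarrow> real \<times> real \<times> real \<Rightarrow> real" where
  "dom n = (\<lambda>(u, x, y). weight u *
     (indicator {0..1} x * (indicator {0..} y * (exp (- rate * y) * (3 + y) ^ n))))"

lemma density_measurable [measurable]: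
  "density \<in> borel_measurable lborel3"
  unfolding density_def[abs_def] by measurable

lemma dom_integrable: "integrable lborel3 (dom n)"
proof -
  have P: "pair_sigma_finite (lborel :: real measure) (lborel :: real measure)"
    and Q: "pair_sigma_finite (lborel :: real measure) (lborel \<Otimes>\<^sub>M lborel :: (real \<times> real) measure)"
    by unfold_locales
  have 1: "integrable lborel (indicator {0..1} :: real \<Rightarrow> real)"
    by (rule integrable_real_indicator) auto
  have 2: "integrable (lborel \<Otimes>\<^sub>M lborel)
     (\<lambda>(x :: real, y :: real). indicator {0..1} x * (indicator {0..} y * (exp (- rate * y) * (3 + y) ^ n)))"
    by (rule pair_sigma_finite.integrable_tensor[OF P 1 poly_exp_half_line_integrable[OF rate_pos]])
  have 3: "integrable lborel (weight)"
    using r1 r2 by (intro beta_weight_integral(1)) auto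
  have "dom n = (\<lambda>(u, p). weight u *
     (case p of (x, y) \<Rightarrow> indicator {0..1} x * (indicator {0..} y * (exp (- rate * y) * (3 + y) ^ n))))"
    by (auto simp: dom_def fun_eq_iff)
  then show ?thesis using pair_sigma_finite.integrable_tensor[OF Q 3 2] by simp
qed

lemma dom_nonneg: "dom n p \<ge> 0"
  by (cases p) (auto simp: dom_def indicator_def)

lemma norm_density: "norm (density p) \<le> suminf b1 * suminf b2 * dom 0 p"
proof -
  obtain u x y where p: "p = (u, x, y)" by (cases p)
  show ?thesis
  proof (cases "x \<in> {0..1} \<and> y \<in> {0..}")
    case True
    have "norm (g1 x * g2 y) \<le> suminf b1 * (suminf b2 * exp (- rate * y))"
      unfolding norm_mult using True norm_f1[of x] norm_f2[of y] suminf_nonneg[OF b_summable(1) b_nonneg(1)]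
      by (intro mult_mono) (auto simp: g1_def g2_def)
    then have "weight u * norm (g1 x * g2 y) \<le>
        weight u * (suminf b1 * (suminf b2 * exp (- rate * y)))"
      by (rule mult_left_mono) simp
    then show ?thesis using True by (simp add: p density_def dom_def norm_mult mult_ac)
  qed (auto simp: p density_def dom_def g1_def g2_def)
qed

text \<open>On the support \<open>|mix_point p + \<i>| \<le> 3 + y\<close> and
  \<open>Im (mix_point p) \<ge> 1 / 2\<close>, so \<open>depth\<close> is at most
  \<open>2 * (3 + y)^2\<close>; its k-th power raises the exponent in \<open>dom\<close> to
  \<open>2 * k\<close>.\<close>

lemma moments_integrable:
  "integrable lborel3
     (\<lambda>p. norm (density p) * depth (mix_point p) ^ k)"
proof (rule Bochner_Integration.integrable_bound[OF integrable_mult_right[OF dom_integrable[of "2 * k"], of "suminf b1 * suminf b2 * 2 ^ k"]])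
  show "AE p in lborel3. norm (norm (density p) * depth (mix_point p) ^ k)
      \<le> norm (suminf b1 * suminf b2 * 2 ^ k * dom (2 * k) p)"
  proof (rule AE_I2)
    fix p :: "real \<times> real \<times> real"
    obtain u x y where p: "p = (u, x, y)" by (cases p)
    define q where "q = depth (mix_point p)"
    have q0: "q \<ge> 0" using Im_mix_point_pos[of p] by (simp add: q_def)
    have B: "suminf b1 \<ge> 0" "suminf b2 \<ge> 0" using suminf_nonneg b_summable b_nonneg by auto
    have le: "norm (density p) * q ^ k \<le> suminf b1 * suminf b2 * 2 ^ k * dom (2 * k) p"
    proof (cases "y \<ge> 0")
      case True
      have "norm (mix_point p + \<i>) \<le> 3 + y"
        using norm_triangle_ineq[of "mix_point p" \<i>] norm_mix_point[of u x y] True by (simp add: p)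
      moreover have "1 / 2 \<le> Im (mix_point p)" using Im_mix_point[of p] sqrt3_bounds(1) by linarith
      ultimately have "q \<le> (3 + y)\<^sup>2 / (1 / 2)"
        unfolding q_def using True by (intro frac_le power_mono) auto
      then have "q ^ k \<le> (2 * (3 + y)\<^sup>2) ^ k" using q0 by (intro power_mono) auto
      then have "norm (density p) * q ^ k \<le> (suminf b1 * suminf b2 * dom 0 p) * (2 * (3 + y)\<^sup>2) ^ k"
        using q0 by (intro mult_mono norm_density) (auto intro!: mult_nonneg_nonneg B dom_nonneg)
      also have "\<dots> = suminf b1 * suminf b2 * 2 ^ k * dom (2 * k) p"
      proof -
        have e: "(3 + y) ^ (2 * k) = ((3 + y)\<^sup>2) ^ k" by (rule power_mult)
        show ?thesis
          unfolding p dom_def prod.case power_mult_distrib e power_0 mult_1_right by (simp only: mult_ac)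
      qed
      finally show ?thesis .
    qed (simp add: p density_def g2_def dom_def)
    have "0 \<le> norm (density p) * q ^ k" using q0 by simp
    then show "norm (norm (density p) * q ^ k) \<le> norm (suminf b1 * suminf b2 * 2 ^ k * dom (2 * k) p)"
      using le by (simp only: real_norm_def abs_of_nonneg)
  qed
qed measurable

text \<open>Integrating over \<open>u\<close> first leaves, for fixed \<open>x\<close> and
  \<open>y\<close>, Feynman's integral for two points shifted by \<open>t\<close>, which lie in the
  upper half-plane since \<open>t\<close> lies in the lower one. The result separates in
  \<open>x\<close> and \<open>y\<close> and gives back the two period integrals.\<close>

lemma cint_product:
  assumes t: "t \<in> lower_hp"
  shows "cint r1 f1 (rho - 1) rho t * cint_infty r2 f2 \<i> t =
    (\<integral>p. density p / of_real (Beta (2 - r1) (2 - r2)) * (mix_point p - t) powr (- of_real r3)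
       \<partial>lborel3)"
proof -
  have P: "pair_sigma_finite (lborel :: real measure) (lborel :: real measure)"
    and Q: "pair_sigma_finite (lborel :: real measure) (lborel \<Otimes>\<^sub>M lborel :: (real \<times> real) measure)"
    by unfold_locales
  define Bt where "Bt = Beta (2 - r1) (2 - r2)"
  have ab: "2 - r1 > 0" "2 - r2 > 0" using r1 r2 by auto
  have "Bt > 0"
    unfolding Bt_def Beta_def using ab by (intro divide_pos_pos mult_pos_pos Gamma_real_pos) auto
  then have Bt: "Bt \<noteq> 0" by simp
  have Imt: "Im t < 0" using t by (simp add: lower_hp_def)
  have [measurable]: "(\<lambda>z::complex. z powr s) \<in> borel_measurable borel" for s
    unfolding powr_def by measurable
  have powr_bound: "norm (z powr of_real (- s)) \<le> 2 powr s" if "Im z \<ge> 1 / 2" "s \<ge> 0" for z s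
  proof -
    have n: "1 / 2 \<le> norm z" using that(1) abs_Im_le_cmod[of z] by linarith
    have "norm (z powr of_real (- s)) = norm z powr (- s)"
      using norm_powr_real_powr'[of "of_real (- s)" z] by simp
    also have "\<dots> \<le> (1 / 2) powr (- s)" using n that(2) by (intro powr_mono2') auto
    also have "\<dots> = 2 powr s" by (simp add: powr_minus_divide powr_divide)
    finally show ?thesis .
  qed
  define F where "F p = density p * (mix_point p - t) powr of_real (- r3)" for p
  have Fint: "integrable lborel3 F"
  proof (rule Bochner_Integration.integrable_bound[OF integrable_mult_right[OF dom_integrable[of 0], of "suminf b1 * suminf b2 * 2 powr r3"]])
    show "F \<in> borel_measurable lborel3"
      unfolding F_def[abs_def] by measurable
    show "AE p in lborel3. norm (F p) \<le> norm (suminf b1 * suminf b2 * 2 powr r3 * dom 0 p)"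
    proof (rule AE_I2)
      fix p :: "real \<times> real \<times> real"
      have "Im (mix_point p - t) \<ge> 1 / 2"
        using Im_mix_point[of p] sqrt3_bounds(1) Imt unfolding minus_complex.simps by linarith
      then have "norm (F p) \<le> (suminf b1 * suminf b2 * dom 0 p) * 2 powr r3"
        unfolding F_def norm_mult using r3
        by (intro mult_mono norm_density powr_bound)
           (auto intro!: mult_nonneg_nonneg dom_nonneg suminf_nonneg b_summable b_nonneg)
      also have "\<dots> \<le> norm (suminf b1 * suminf b2 * 2 powr r3 * dom 0 p)"
        by (simp add: mult_ac)
      finally show "norm (F p) \<le> norm (suminf b1 * suminf b2 * 2 powr r3 * dom 0 p)" .
    qed
  qed
  define G1 where "G1 x = indicator {0..1} x *\<^sub>R (f1 (seg_point x) * (seg_point x - t) powr of_real (r1 - 2))" for x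
  define G2 where "G2 y = indicator {0..} y *\<^sub>R (f2 (ray_point y) * (ray_point y - t) powr of_real (r2 - 2))" for y
  have G1: "integrable lborel G1" "cint r1 f1 (rho - 1) rho t = (\<integral>x. G1 x \<partial>lborel)"
    unfolding G1_def[abs_def] by (rule cint_seg[OF continuous(1) t])+
  have G2_eq: "G2 y = g2 y * (ray_point y - t) powr of_real (r2 - 2)" for y
    by (simp add: G2_def g2_def)
  have G2: "integrable lborel G2"
  proof (rule Bochner_Integration.integrable_bound[OF integrable_mult_right[OF exp_half_line(1)[OF rate_pos], of "suminf b2 * 2 powr (2 - r2)"]])
    have [measurable]: "ray_point \<in> borel_measurable borel" unfolding ray_point_def[abs_def] by measurable
    show "G2 \<in> borel_measurable lborel" unfolding G2_eq[abs_def] by measurable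
    show "AE y in lborel. norm (G2 y) \<le> norm (suminf b2 * 2 powr (2 - r2) * (indicator {0..} y * exp (- rate * y)))"
    proof (rule AE_I2)
      fix y :: real
      show "norm (G2 y) \<le> norm (suminf b2 * 2 powr (2 - r2) * (indicator {0..} y * exp (- rate * y)))"
      proof (cases "y \<ge> 0")
        case True
        have "norm (f2 (ray_point y) * (ray_point y - t) powr of_real (- (2 - r2))) \<le> (suminf b2 * exp (- rate * y)) * 2 powr (2 - r2)"
          unfolding norm_mult using True ab Imt
          by (intro mult_mono norm_f2 powr_bound)
             (auto intro!: mult_nonneg_nonneg suminf_nonneg b_summable b_nonneg)
        also have "\<dots> \<le> norm (suminf b2 * 2 powr (2 - r2) * exp (- rate * y))"
          by (simp add: mult_ac)
        finally show ?thesis using True by (simp add: G2_def)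
      qed (simp add: G2_def)
    qed
  qed
  have inner: "(\<integral>u. F (u, x, y) \<partial>lborel) = \<i> * of_real Bt * (G1 x * G2 y)" for x y
  proof (cases "x \<in> {0..1} \<and> y \<in> {0..}")
    case True
    define A B where "A = seg_point x - t" and "B = ray_point y - t"
    have "Im A = sqrt 3 / 2 - Im t" "Im B = 1 + y - Im t" by (simp_all add: A_def B_def)
    then have AB: "Im A > 0" "Im B > 0" using True Imt sqrt3_bounds(1) unfolding atLeast_iff by linarith+
    \<comment> \<open>The place where \<open>r1 + r2 + r3 = 4\<close> makes the superposition one of
      kernels of weight \<open>r3\<close>.\<close>
    have s: "- of_real (2 - r1 + (2 - r2)) = (of_real (- r3) :: complex)"
    proof -
      have "2 - r1 + (2 - r2) = r3" using rsum by simp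
      then show ?thesis by (simp only: of_real_minus)
    qed
    have "F (u, x, y) = \<i> * (g1 x * g2 y) * feynman_kernel (2 - r1) (2 - r2) A B u" for u
    proof (cases "u \<in> {0..1}")
      case u: True
      have "mix_point (u, x, y) - t = (1 - of_real u) * A + of_real u * B"
        using True u by (simp add: mix_point_eq A_def B_def algebra_simps)
      then show ?thesis unfolding s by (simp add: F_def density_def mult_ac)
    qed (simp add: F_def density_def beta_weight_def)
    then have "(\<integral>u. F (u, x, y) \<partial>lborel) = \<i> * (g1 x * g2 y) *
        (of_real Bt * A powr (- of_real (2 - r1)) * B powr (- of_real (2 - r2)))"
      by (simp only: integral_mult_right_zero feynman_upper[OF ab AB] Bt_def)
    then show ?thesis using True
      by (simp add: G1_def G2_def g1_def g2_def A_def B_def mult_ac)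
  next
    case False
    then have "F (u, x, y) = 0" for u by (auto simp: F_def density_def g1_def g2_def)
    then show ?thesis using False by (auto simp: G1_def G2_def)
  qed
  have "(\<integral>p. F p \<partial>lborel3) =
      (\<integral>q. (\<integral>u. F (u, q) \<partial>lborel) \<partial>(lborel \<Otimes>\<^sub>M lborel))"
    using pair_sigma_finite.integral_snd[OF Q, of "\<lambda>u q. F (u, q)"] Fint by simp
  also have "\<dots> = (\<integral>q. \<i> * of_real Bt * (G1 (fst q) * G2 (snd q)) \<partial>(lborel \<Otimes>\<^sub>M lborel))"
    by (rule Bochner_Integration.integral_cong[OF refl]) (auto simp: inner split: prod.splits)
  also have "\<dots> = \<i> * of_real Bt * ((\<integral>x. G1 x \<partial>lborel) * (\<integral>y. G2 y \<partial>lborel))"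
    by (simp only: integral_mult_right_zero pair_sigma_finite.integral_tensor[OF P G1(1) G2])
  also have "\<dots> = of_real Bt * (cint r1 f1 (rho - 1) rho t * cint_infty r2 f2 \<i> t)"
    by (simp add: G1(2) cint_infty_def G2_def set_lebesgue_integral_def ray_point_def mult_ac)
  finally have "cint r1 f1 (rho - 1) rho t * cint_infty r2 f2 \<i> t =
      (\<integral>p. F p \<partial>lborel3) / of_real Bt"
    using Bt by simp
  also have "\<dots> = (\<integral>p. F p / of_real Bt \<partial>lborel3)"
    by (rule integral_divide_zero[symmetric])
  finally show ?thesis by (simp add: F_def Bt_def)
qed

lemma trilinear_eq_integral:
  "trilinear r1 r2 r3 f1 f2 f3 = (- 2 * \<i>) powr of_real r3 / of_real (Beta (2 - r1) (2 - r2)) *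
     (\<integral>p. density p * f3 (mix_point p) \<partial>lborel3)"
proof -
  define Bt where "Bt = complex_of_real (Beta (2 - r1) (2 - r2))"
  have "trilinear r1 r2 r3 f1 f2 f3 = (- 2 * \<i>) powr of_real r3 *
     (\<integral>p. density p / Bt * f3 (mix_point p) \<partial>lborel3)"
    unfolding trilinear_def
  proof (rule bracket_superposition[OF r3])
    show "f3 \<in> plus_D_minus_infty r3"
      by (rule modular_form_in_plus_D_minus_infty[OF r3 f3 s3])
    show "integrable lborel3
       (\<lambda>p. norm (density p / Bt) * depth (mix_point p) ^ k)" for k
      using integrable_mult_right[OF moments_integrable[of k], of "1 / norm Bt"] by (simp add: norm_divide)
    show "cint r1 f1 (rho - 1) rho t * cint_infty r2 f2 \<i> t =
      (\<integral>p. density p / Bt * (mix_point p - t) powr (- of_real r3) \<partial>lborel3)"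
      if "t \<in> lower_hp" for t
      unfolding Bt_def by (rule cint_product[OF that])
  qed (use Im_mix_point_pos in measurable)
  also have "(\<integral>p. density p / Bt * f3 (mix_point p) \<partial>lborel3) =
     (\<integral>p. density p * f3 (mix_point p) \<partial>lborel3) / Bt"
    by (subst integral_divide_zero[symmetric]) simp
  finally show ?thesis by (simp add: Bt_def)
qed

section \<open>Termwise integration of the triple Fourier series\<close>

definition summand :: "nat \<times> nat \<times> nat \<Rightarrow> real \<times> real \<times> real \<Rightarrow> complex" where
  "summand = (\<lambda>(m1, m2, m3) (u, x, y). \<i> * of_real (weight u) *
     ((indicator {0..1} x *\<^sub>R fourier_term a1 \<kappa>1 (seg_point x) m1) *
      (indicator {0..} y *\<^sub>R fourier_term a2 \<kappa>2 (ray_point y) m2)) *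
     fourier_term a3 \<kappa>3 (mix_point (u, x, y)) m3)"

definition majorant :: "nat \<times> nat \<times> nat \<Rightarrow> real" where
  "majorant = (\<lambda>(m1, m2, m3). b1 m1 * b2 m2 * b3 m3)"

lemma summand_measurable [measurable]:
  "summand m \<in> borel_measurable lborel3"
proof -
  obtain m1 m2 m3 where m: "m = (m1, m2, m3)" by (cases m)
  have [measurable]: "seg_point \<in> borel_measurable borel" "ray_point \<in> borel_measurable borel"
    unfolding seg_point_def[abs_def] ray_point_def[abs_def] by measurable
  have "summand m = (\<lambda>p. \<i> * of_real (weight (fst p)) *
     ((indicator {0..1} (fst (snd p)) *\<^sub>R fourier_term a1 \<kappa>1 (seg_point (fst (snd p))) m1) *
      (indicator {0..} (snd (snd p)) *\<^sub>R fourier_term a2 \<kappa>2 (ray_point (snd (snd p))) m2)) *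
     fourier_term a3 \<kappa>3 (mix_point p) m3)"
    by (auto simp: summand_def m fun_eq_iff)
  then show ?thesis by simp
qed

lemma norm_summand: "norm (summand m p) \<le> majorant m * dom 0 p"
proof -
  obtain m1 m2 m3 where m: "m = (m1, m2, m3)" by (cases m)
  obtain u x y where p: "p = (u, x, y)" by (cases p)
  show ?thesis
  proof (cases "x \<in> {0..1} \<and> y \<in> {0..}")
    case True
    define w where "w = weight u"
    have w: "w \<ge> 0" by (simp add: w_def)
    have "norm (summand m p) = w * (norm (fourier_term a1 \<kappa>1 (seg_point x) m1) *
        norm (fourier_term a2 \<kappa>2 (ray_point y) m2)) * norm (fourier_term a3 \<kappa>3 (mix_point p) m3)"
      using True w by (simp add: summand_def m p w_def norm_mult)
    also have "\<dots> \<le> w * (b1 m1 * (b2 m2 * exp (- rate * y))) * b3 m3"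
      using True w Im_mix_point
      by (intro mult_mono norm_term1 norm_term2 norm_term3 mult_left_mono)
         (auto intro!: mult_nonneg_nonneg b_nonneg)
    finally show ?thesis using True by (simp add: majorant_def dom_def m p w_def mult_ac)
  qed (auto simp: m p summand_def dom_def)
qed

lemma summand_integrable: "integrable lborel3 (summand m)"
proof (rule Bochner_Integration.integrable_bound[OF integrable_mult_right[OF dom_integrable[of 0], of "majorant m"]])
  show "AE p in lborel3. norm (summand m p) \<le> norm (majorant m * dom 0 p)"
    using norm_summand[of m] by (intro AE_I2) (metis abs_ge_self order_trans real_norm_def)
qed measurable

lemma majorant_summable: "majorant summable_on UNIV"
proof -
  have "summable (\<lambda>n. norm (complex_of_real (b1 n)))" "summable (\<lambda>n. norm (complex_of_real (b2 n)))"
    "summable (\<lambda>n. norm (complex_of_real (b3 n)))"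
    using b_summable b_nonneg by simp_all
  from has_sum_triple(1)[OF this] show ?thesis
    using b_nonneg by (simp add: majorant_def case_prod_unfold norm_mult)
qed

lemma summand_has_sum: "((\<lambda>m. summand m p) has_sum (density p * f3 (mix_point p))) UNIV"
proof -
  obtain u x y where p: "p = (u, x, y)" by (cases p)
  show ?thesis
  proof (cases "x \<in> {0..1} \<and> y \<in> {0..}")
    case True
    have mp: "mix_point p \<in> upper_hp" using Im_mix_point_pos by (simp add: upper_hp_def)
    have rp: "ray_point y \<in> upper_hp" using True by (intro ray_point_in) simp
    have s: "summable (\<lambda>n. norm (fourier_term a1 \<kappa>1 (seg_point x) n))"
      "summable (\<lambda>n. norm (fourier_term a2 \<kappa>2 (ray_point y) n))"
      "summable (\<lambda>n. norm (fourier_term a3 \<kappa>3 (mix_point p) n))"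
      using fourier_abs_summable[OF s1, of "Im (seg_point x)"] fourier_abs_summable[OF s2, of "Im (ray_point y)"]
        fourier_abs_summable[OF s3, of "Im (mix_point p)"] True Im_mix_point_pos[of p]
      unfolding norm_fourier_term by simp_all
    have e: "suminf (fourier_term a1 \<kappa>1 (seg_point x)) = f1 (seg_point x)"
      "suminf (fourier_term a2 \<kappa>2 (ray_point y)) = f2 (ray_point y)"
      "suminf (fourier_term a3 \<kappa>3 (mix_point p)) = f3 (mix_point p)"
      using s1[OF seg_point_in] s2[OF rp] s3[OF mp] by (simp_all only: sums_iff)
    from has_sum_cmult_right[OF has_sum_triple(2)[OF s, unfolded e], of "\<i> * of_real (weight u)"]
    show ?thesis
      using True by (simp add: summand_def density_def g1_def g2_def p case_prod_unfold mult.assoc)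
  next
    case False
    then have "density p = 0" "summand m p = 0" for m
      by (auto simp: density_def g1_def g2_def summand_def p case_prod_unfold)
    then show ?thesis by simp
  qed
qed

text \<open>The triples are enumerated by natural numbers so that dominated exchange of series and
  integral applies; absolute convergence then carries the result back to the unordered sum.\<close>

lemma integral_has_sum:
  "((\<lambda>m. \<integral>p. summand m p \<partial>lborel3) has_sum
     (\<integral>p. density p * f3 (mix_point p) \<partial>lborel3)) UNIV"
proof -
  define e where "e = from_nat_into (UNIV :: (nat \<times> nat \<times> nat) set)"
  have e: "bij_betw e UNIV UNIV"
    unfolding e_def by (rule bij_betw_from_nat_into) (auto simp: finite_prod)
  have "(\<lambda>n. majorant (e n)) summable_on UNIV"
    using majorant_summable by (simp add: summable_on_reindex_bij_betw[OF e])
  then have maj: "summable (\<lambda>n. majorant (e n))"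
    by (rule summable_on_imp_summable)
  have "(\<lambda>n. \<integral>p. summand (e n) p \<partial>lborel3) sums (\<integral>p. (\<Sum>n. summand (e n) p) \<partial>lborel3)"
    and norms: "summable (\<lambda>n. \<integral>p. norm (summand (e n) p) \<partial>lborel3)"
  proof -
    show n: "summable (\<lambda>n. \<integral>p. norm (summand (e n) p) \<partial>lborel3)"
    proof (rule summable_comparison_test'[OF summable_mult2[OF maj]])
      fix n
      have "(\<integral>p. norm (summand (e n) p) \<partial>lborel3) \<le> (\<integral>p. majorant (e n) * dom 0 p \<partial>lborel3)"
        by (intro integral_mono integrable_norm summand_integrable integrable_mult_right dom_integrable norm_summand)
      then show "norm (\<integral>p. norm (summand (e n) p) \<partial>lborel3) \<le> majorant (e n) * (\<integral>p. dom 0 p \<partial>lborel3)"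
        by (simp add: integral_nonneg_AE)
    qed
    show "(\<lambda>n. \<integral>p. summand (e n) p \<partial>lborel3) sums (\<integral>p. (\<Sum>n. summand (e n) p) \<partial>lborel3)"
    proof (rule sums_integral[OF summand_integrable _ n], rule AE_I2)
      fix p
      show "summable (\<lambda>n. norm (summand (e n) p))"
        by (rule summable_comparison_test'[OF summable_mult2[OF maj, of "dom 0 p"]])
           (simp add: norm_summand)
    qed
  qed
  moreover have "(\<Sum>n. summand (e n) p) = density p * f3 (mix_point p)" for p
  proof -
    have "((\<lambda>n. summand (e n) p) has_sum (density p * f3 (mix_point p))) UNIV"
      using summand_has_sum[of p] by (simp add: has_sum_reindex_bij_betw[OF e, of "\<lambda>m. summand m p"])
    then have "(\<lambda>n. summand (e n) p) sums (density p * f3 (mix_point p))" by (rule has_sum_imp_sums)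
    then show ?thesis by (simp add: sums_iff)
  qed
  ultimately have s: "(\<lambda>n. \<integral>p. summand (e n) p \<partial>lborel3) sums (\<integral>p. density p * f3 (mix_point p) \<partial>lborel3)" by simp
  have "summable (\<lambda>n. norm (\<integral>p. summand (e n) p \<partial>lborel3))"
    by (rule summable_comparison_test'[OF norms]) (simp add: integral_norm_bound)
  from norm_summable_imp_has_sum[OF this s] show ?thesis
    by (simp add: has_sum_reindex_bij_betw[OF e, of "\<lambda>m. \<integral>p. summand m p \<partial>lborel3"])
qed

text \<open>For fixed \<open>u\<close> the third point is a convex combination of the first two, so
  its exponential can be distributed over them. The integral over \<open>x\<close> and
  \<open>y\<close> becomes a product: the segment gives \<open>sinc\<close>, the ray gives
  \<open>1 / (2 * pi * \<nu>)\<close>.\<close>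

lemma integral_summand:
  "(\<integral>p. summand (m1, m2, m3) p \<partial>lborel3) =
    - (a1 m1 * a2 m2 * a3 m3 * Psi r1 r2 (real m1 + \<kappa>1) (real m2 + \<kappa>2) (real m3 + \<kappa>3))"
proof (cases "a2 m2 = 0 \<or> a3 m3 = 0")
  case True
  then have "summand (m1, m2, m3) p = 0" for p by (auto simp: summand_def case_prod_unfold)
  then show ?thesis using True by auto
next
  case False
  define \<mu>1 \<mu>2 \<mu>3 where "\<mu>1 = real m1 + \<kappa>1" and "\<mu>2 = real m2 + \<kappa>2" and "\<mu>3 = real m3 + \<kappa>3"
  \<comment> \<open>The growth conditions only speak about frequencies that occur, whence the case
    distinction on the coefficients. These signs make \<open>\<nu>\<close> positive below and the
    ray integral convergent.\<close>
  have \<mu>2: "\<mu>2 > 0" using cusp_form_coeff_zero[OF s2 f2, of m2] False unfolding \<mu>2_def by linarith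
  have \<mu>3: "\<mu>3 \<ge> 0" using modular_form_coeff_zero[OF s3 f3, of m3] False unfolding \<mu>3_def by linarith
  have P: "pair_sigma_finite (lborel :: real measure) (lborel :: real measure)"
    and Q: "pair_sigma_finite (lborel :: real measure) (lborel \<Otimes>\<^sub>M lborel :: (real \<times> real) measure)"
    by unfold_locales
  define c where "c = a1 m1 * a2 m2 * a3 m3"
  define h1 where "h1 k x = indicator {0..1} x *\<^sub>R fourier_exp k (rho - 1 + of_real x)" for k x :: real
  define h2 where "h2 k y = indicator {0..} y *\<^sub>R fourier_exp k (ray_point y)" for k y :: real
  have h1i: "integrable lborel (h1 k)" for k
  proof -
    have "set_integrable lborel {0..1} (\<lambda>x. fourier_exp k (rho - 1 + of_real x))"
      by (intro borel_integrable_atLeastAtMost' continuous_intros)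
    then show ?thesis by (simp add: set_integrable_def h1_def[abs_def])
  qed
  have h2_eq: "h2 k y = of_real (exp (- 2 * pi * k)) * of_real (indicator {0..} y * exp (- (2 * pi * k) * y))" for k y
  proof -
    have "2 * of_real pi * \<i> * of_real k * ray_point y = of_real (- 2 * pi * k + - (2 * pi * k) * y)"
      by (simp add: ray_point_def complex_eq_iff algebra_simps)
    then have "fourier_exp k (ray_point y) = of_real (exp (- 2 * pi * k) * exp (- (2 * pi * k) * y))"
      by (simp only: exp_of_real exp_add)
    then show ?thesis by (simp add: h2_def scaleR_conv_of_real)
  qed
  have h2i: "integrable lborel (h2 k)" "(\<integral>y. h2 k y \<partial>lborel) = of_real (exp (- 2 * pi * k) / (2 * pi * k))" if "k > 0" for k
  proof -
    have k: "2 * pi * k > 0" using that by simp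
    show "integrable lborel (h2 k)"
      unfolding h2_eq[abs_def] by (intro integrable_mult_right integrable_of_real exp_half_line(1) k)
    show "(\<integral>y. h2 k y \<partial>lborel) = of_real (exp (- 2 * pi * k) / (2 * pi * k))"
      unfolding h2_eq integral_mult_right_zero integral_complex_of_real exp_half_line(2)[OF k] by simp
  qed
  define w where "w u = weight u" for u
  have inner: "(\<integral>q. summand (m1, m2, m3) (u, q) \<partial>(lborel \<Otimes>\<^sub>M lborel)) =
     c * (\<i> / (2 * of_real pi)) * of_real (exp (- 2 * pi * \<mu>2 - pi * sqrt 3 * (\<mu>1 + \<mu>3))) *
       of_real (w u * (exp (- pi * (2 - sqrt 3) * \<mu>3 * u) / (\<mu>2 + \<mu>3 * u) * sinc (pi * (\<mu>1 + (1 - u) * \<mu>3))))" for u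
  proof (cases "u \<in> {0..1}")
    case u: True
    \<comment> \<open>The frequency \<open>\<mu>3\<close> is shared out in the proportion
      \<open>1 - u\<close> to \<open>u\<close> between segment and ray.\<close>
    define k \<nu> where "k = \<mu>1 + (1 - u) * \<mu>3" and "\<nu> = \<mu>2 + \<mu>3 * u"
    have \<nu>: "\<nu> > 0" using \<mu>2 \<mu>3 u by (simp add: \<nu>_def add_pos_nonneg)
    have "summand (m1, m2, m3) (u, q) = \<i> * of_real (w u) * c * (h1 k (fst q) * h2 \<nu> (snd q))" for q
    proof -
      obtain x y where q: "q = (x, y)" by (cases q)
      show ?thesis
      proof (cases "x \<in> {0..1} \<and> y \<in> {0..}")
        case True
        have "2 * of_real pi * \<i> * of_real \<mu>1 * seg_point x + 2 * of_real pi * \<i> * of_real \<mu>2 * ray_point y +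
            2 * of_real pi * \<i> * of_real \<mu>3 * mix_point (u, x, y) =
          2 * of_real pi * \<i> * of_real k * (rho - 1 + of_real x) + 2 * of_real pi * \<i> * of_real \<nu> * ray_point y"
          using True u by (simp add: mix_point_eq k_def \<nu>_def seg_point_def algebra_simps)
        then have "fourier_exp \<mu>1 (seg_point x) * fourier_exp \<mu>2 (ray_point y) *
            fourier_exp \<mu>3 (mix_point (u, x, y)) =
          fourier_exp k (rho - 1 + of_real x) * fourier_exp \<nu> (ray_point y)"
          unfolding exp_add[symmetric] by (rule arg_cong)
        moreover have "summand (m1, m2, m3) (u, q) = \<i> * of_real (w u) * c *
            (fourier_exp \<mu>1 (seg_point x) * fourier_exp \<mu>2 (ray_point y) *
            fourier_exp \<mu>3 (mix_point (u, x, y)))"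
          using True unfolding summand_def q prod.case \<mu>1_def[symmetric] \<mu>2_def[symmetric] \<mu>3_def[symmetric] w_def c_def
          by simp
        ultimately show ?thesis using True by (simp add: q h1_def h2_def)
      qed (auto simp: q summand_def h1_def h2_def)
    qed
    then have "(\<integral>q. summand (m1, m2, m3) (u, q) \<partial>(lborel \<Otimes>\<^sub>M lborel)) =
       \<i> * of_real (w u) * c * ((\<integral>x. h1 k x \<partial>lborel) * (\<integral>y. h2 \<nu> y \<partial>lborel))"
      by (simp only: integral_mult_right_zero pair_sigma_finite.integral_tensor[OF P h1i h2i(1)[OF \<nu>]])
    also have "\<dots> = \<i> * of_real (w u) * c *
        (of_real (exp (- pi * sqrt 3 * k) * sinc (pi * k)) * of_real (exp (- 2 * pi * \<nu>) / (2 * pi * \<nu>)))"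
      unfolding h2i(2)[OF \<nu>] h1_def exp_segment_integral ..
    also have "\<dots> = c * (\<i> / (2 * of_real pi)) * of_real ((exp (- pi * sqrt 3 * k) * exp (- 2 * pi * \<nu>)) * (w u * (sinc (pi * k) / \<nu>)))"
      by simp
    \<comment> \<open>The part of the exponent linear in \<open>u\<close> is
      \<open>(pi * sqrt 3 - 2 * pi) * \<mu>3 * u\<close>, which explains the constant
      \<open>2 - sqrt 3\<close>.\<close>
    also have "exp (- pi * sqrt 3 * k) * exp (- 2 * pi * \<nu>) =
       exp (- 2 * pi * \<mu>2 - pi * sqrt 3 * (\<mu>1 + \<mu>3)) * exp (- pi * (2 - sqrt 3) * \<mu>3 * u)"
      by (simp add: exp_add[symmetric] k_def \<nu>_def algebra_simps)
    finally show ?thesis by (simp add: k_def \<nu>_def)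
  qed (simp add: summand_def beta_weight_def w_def case_prod_unfold)
  have "(\<integral>p. summand (m1, m2, m3) p \<partial>lborel3) =
     (\<integral>u. (\<integral>q. summand (m1, m2, m3) (u, q) \<partial>(lborel \<Otimes>\<^sub>M lborel)) \<partial>lborel)"
    by (rule pair_sigma_finite.integral_fst'[OF Q summand_integrable, symmetric])
  also have "\<dots> = c * (\<i> / (2 * of_real pi)) * of_real (exp (- 2 * pi * \<mu>2 - pi * sqrt 3 * (\<mu>1 + \<mu>3))) *
     of_real (\<integral>u. w u * (exp (- pi * (2 - sqrt 3) * \<mu>3 * u) / (\<mu>2 + \<mu>3 * u) * sinc (pi * (\<mu>1 + (1 - u) * \<mu>3))) \<partial>lborel)"
    unfolding inner integral_mult_right_zero integral_complex_of_real ..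
  \<comment> \<open>\<open>\<i> / (2 * pi)\<close> is \<open>- 1 / (2 * pi * \<i>)\<close>; here the
    sign enters.\<close>
  also have "\<dots> = - (c * Psi r1 r2 \<mu>1 \<mu>2 \<mu>3)"
    unfolding Psi_eq_beta_weight w_def by (simp add: field_simps)
  finally show ?thesis by (simp add: c_def \<mu>1_def \<mu>2_def \<mu>3_def)
qed

end

theorem proposition8p5:
  fixes r1 r2 r3 p1 p2 p3 :: real
    and f1 f2 f3 :: "complex \<Rightarrow> complex"
    and a1 a2 a3 :: "nat \<Rightarrow> complex"
  assumes "r1 < 2" and "0 < r2" and "r2 < 2" and "r3 > 0" and "r1 + r2 + r3 = 4"
    and "[p1 = r1] (rmod 2)" and "[p2 = r2] (rmod 2)" and "[p3 = r3] (rmod 2)"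
    and "p1 + p2 + p3 = 0"
    and "f1 \<in> automorphic_forms r1 (eta_mult p1)"
    and "f2 \<in> cusp_forms r2 (eta_mult p2)"
    and "f3 \<in> modular_forms r3 (eta_mult p3)"
    and "\<And>z. z \<in> upper_hp \<Longrightarrow>
      (\<lambda>m. a1 m * exp (2 * of_real pi * \<i> * of_real (real m + p1 / 12) * z)) sums f1 z"
    and "\<And>z. z \<in> upper_hp \<Longrightarrow>
      (\<lambda>m. a2 m * exp (2 * of_real pi * \<i> * of_real (real m + p2 / 12) * z)) sums f2 z"
    and "\<And>z. z \<in> upper_hp \<Longrightarrow>
      (\<lambda>m. a3 m * exp (2 * of_real pi * \<i> * of_real (real m + p3 / 12) * z)) sums f3 z"
  shows "(\<lambda>(m1, m2, m3). a1 m1 * a2 m2 * a3 m3 *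
            Psi r1 r2 ((12 * real m1 + p1) / 12) ((12 * real m2 + p2) / 12)
              ((12 * real m3 + p3) / 12)) summable_on UNIV \<and>
    trilinear r1 r2 r3 f1 f2 f3 =
      - ((- 2 * \<i>) powr of_real r3 / of_real (Beta (2 - r1) (2 - r2)) *
         (\<Sum>\<^sub>\<infinity>(m1, m2, m3). a1 m1 * a2 m2 * a3 m3 *
            Psi r1 r2 ((12 * real m1 + p1) / 12) ((12 * real m2 + p2) / 12)
              ((12 * real m3 + p3) / 12))) \<and>
    (\<forall>\<mu>1 \<mu>2 \<mu>3. \<mu>2 > 0 \<and> \<mu>3 > 0 \<longrightarrow>
      Psi r1 r2 \<mu>1 \<mu>2 \<mu>3 =
        of_real (exp (- 2 * pi * \<mu>2 - pi * sqrt 3 * (\<mu>1 + \<mu>3))) / (2 * of_real pi * \<i>) *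
        of_real (\<mu>3 powr (1 - r3) *
          (LINT u:{0..\<mu>3}|lborel. u powr (1 - r2) * (\<mu>3 - u) powr (1 - r1) *
             (exp (- pi * (2 - sqrt 3) * u) / (\<mu>2 + u)) *
             sinc (pi * (\<mu>1 + \<mu>3 - u)))))"
proof -
  let ?t = "\<lambda>(m1, m2, m3). a1 m1 * a2 m2 * a3 m3 *
            Psi r1 r2 ((12 * real m1 + p1) / 12) ((12 * real m2 + p2) / 12)
              ((12 * real m3 + p3) / 12)"
  let ?I = "\<integral>p. fourier_triple.density r1 r2 f1 f2 p * f3 (mix_point p) \<partial>lborel3"
  interpret fourier_triple r1 r2 r3 "p1 / 12" "p2 / 12" "p3 / 12" f1 f2 f3
    "eta_mult p1" "eta_mult p2" "eta_mult p3" a1 a2 a3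
    by unfold_locales (use assms in auto)
  have e: "(12 * x + q) / 12 = x + q / 12" for x q :: real by simp
  have t: "(\<integral>p. summand m p \<partial>lborel3) = - ?t m" for m
    by (cases m) (simp only: integral_summand prod.case e)
  have "((\<lambda>m. - ?t m) has_sum ?I) UNIV"
    using integral_has_sum unfolding t .
  then have hs: "(?t has_sum - ?I) UNIV" by (rule has_sum_uminus[THEN iffD1])
  have "Psi r1 r2 \<mu>1 \<mu>2 \<mu>3 =
        of_real (exp (- 2 * pi * \<mu>2 - pi * sqrt 3 * (\<mu>1 + \<mu>3))) / (2 * of_real pi * \<i>) *
        of_real (\<mu>3 powr (1 - r3) *
          (LINT u:{0..\<mu>3}|lborel. u powr (1 - r2) * (\<mu>3 - u) powr (1 - r1) *
             (exp (- pi * (2 - sqrt 3) * u) / (\<mu>2 + u)) *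
             sinc (pi * (\<mu>1 + \<mu>3 - u))))" if "\<mu>3 > 0" for \<mu>1 \<mu>2 \<mu>3
    unfolding Psi_def Psi_rescale[OF that assms(5)] ..
  \<comment> \<open>Since \<open>infsum\<close> is 0 on families that are not summable, this is what
    gives the series in the formula its meaning.\<close>
  moreover have "?t summable_on UNIV" using hs by (auto simp: summable_on_def)
  moreover have "trilinear r1 r2 r3 f1 f2 f3 =
      - ((- 2 * \<i>) powr of_real r3 / of_real (Beta (2 - r1) (2 - r2)) * infsum ?t UNIV)"
    unfolding trilinear_eq_integral infsumI[OF hs] by simp
  ultimately show ?thesis by blast
qed

end
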